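(* Let $d\geq 3$. Then $$ \int_{\mathbb{R}^d}|\Delta u(x)|^2\,dx\geq\frac{d^4(d^2-4)^2}{16}\int_{\mathbb{R}^d}\frac{|u(x)|^2}{|x|^4}\,dx\qquad\text{for all }u\in W^{2,2}_{A}(\mathbb{R}^d), $$ and $$ \int_{\mathbb{R}^d}|\Delta u(x)|^2\,dx\geq\frac{(d^2-4)^2}{16}\int_{\mathbb{R}^d}\frac{|u(x)|^2}{|x|^4}\,dx\qquad\text{for all }u\in W^{2,2}_{O}(\mathbb{R}^d). $$
   Context: A function $u$ on $\mathbb{R}^d$ is antisymmetric if $u(x_1,\dots,x_i,\dots,x_j,\dots,x_d)=-u(x_1,\dots,x_j,\dots,x_i,\dots,x_d)$ for all $1\leq i\neq j\leq d$ (i.e. it changes sign when any two coordinates are swapped), and odd if $u(-x)=-u(x)$. $W^{k,p}(\mathbb{R}^d)$ is the usual Sobolev space; $W^{k,p}_{A}(\mathbb{R}^d)$ and $W^{k,p}_{O}(\mathbb{R}^d)$ are its subspaces of antisymmetric and of odd functions, respectively. $\Delta$ is the Laplacian and $|\cdot|$ the Euclidean norm. *)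

theory Defs
  imports "HOL-Analysis.Analysis"
begin

definition partial_deriv :: "'n::finite \<Rightarrow> (real^'n \<Rightarrow> real) \<Rightarrow> real^'n \<Rightarrow> real" where
  "partial_deriv i f x = frechet_derivative f (at x) (axis i 1)"

text \<open>A multi-index is encoded as a list of coordinate directions, so that its order
  is the length of the list. Test functions are smooth, hence the order of the
  directions does not matter.\<close>

primrec iterated_partial :: "'n::finite list \<Rightarrow> (real^'n \<Rightarrow> real) \<Rightarrow> real^'n \<Rightarrow> real" where
  "iterated_partial [] f = f"
| "iterated_partial (i # \<alpha>) f = partial_deriv i (iterated_partial \<alpha> f)"

definition test_function :: "(real^'n::finite \<Rightarrow> real) \<Rightarrow> bool" where
  "test_function \<phi> \<longleftrightarrow>
     (\<forall>\<alpha>. iterated_partial \<alpha> \<phi> differentiable_on UNIV) \<and> compact (closure {x. \<phi> x \<noteq> 0})"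

text \<open>Elements of Lebesgue and Sobolev spaces are represented by arbitrary Lebesgue
  measurable representatives, not by equivalence classes.\<close>

definition locally_integrable :: "(real^'n::finite \<Rightarrow> complex) \<Rightarrow> bool" where
  "locally_integrable u \<longleftrightarrow> (\<forall>K. compact K \<longrightarrow> set_integrable lebesgue K u)"

definition is_weak_deriv ::
    "'n::finite list \<Rightarrow> (real^'n \<Rightarrow> complex) \<Rightarrow> (real^'n \<Rightarrow> complex) \<Rightarrow> bool" where
  "is_weak_deriv \<alpha> u v \<longleftrightarrow> locally_integrable u \<and> locally_integrable v \<and>
     (\<forall>\<phi>. test_function \<phi> \<longrightarrow>
        (LINT x|lebesgue. iterated_partial \<alpha> \<phi> x *\<^sub>R u x) =
        (-1) ^ length \<alpha> * (LINT x|lebesgue. \<phi> x *\<^sub>R v x))"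

text \<open>Weak derivatives are unique up to a null set, so the choice below is immaterial
  under integrals.\<close>

definition weak_deriv ::
    "'n::finite list \<Rightarrow> (real^'n \<Rightarrow> complex) \<Rightarrow> real^'n \<Rightarrow> complex" where
  "weak_deriv \<alpha> u = (SOME v. is_weak_deriv \<alpha> u v)"

definition laplacian :: "(real^'n::finite \<Rightarrow> complex) \<Rightarrow> real^'n \<Rightarrow> complex" where
  "laplacian u x = (\<Sum>i\<in>UNIV. weak_deriv [i, i] u x)"

text \<open>Intended for \<open>1 \<le> p\<close>; the exponent infinity is not covered.\<close>

definition Lp_space :: "real \<Rightarrow> (real^'n::finite \<Rightarrow> complex) set" where
  "Lp_space p =
     {u. u \<in> borel_measurable lebesgue \<and> integrable lebesgue (\<lambda>x. norm (u x) powr p)}"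

definition sobolev :: "nat \<Rightarrow> real \<Rightarrow> (real^'n::finite \<Rightarrow> complex) set" where
  "sobolev k p =
     {u \<in> Lp_space p. \<forall>\<alpha>. length \<alpha> \<le> k \<longrightarrow> (\<exists>v\<in>Lp_space p. is_weak_deriv \<alpha> u v)}"

text \<open>As Sobolev functions are only determined up to null sets, antisymmetry and oddness
  are required almost everywhere.\<close>

definition antisymmetric :: "(real^'n::finite \<Rightarrow> complex) \<Rightarrow> bool" where
  "antisymmetric u \<longleftrightarrow> (\<forall>i j. i \<noteq> j \<longrightarrow>
     (AE x in lebesgue. u (\<chi> k. x $ Transposition.transpose i j k) = - u x))"

definition odd_function :: "(real^'n::finite \<Rightarrow> complex) \<Rightarrow> bool" where
  "odd_function u \<longleftrightarrow> (AE x in lebesgue. u (- x) = - u x)"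

definition sobolev_antisym :: "nat \<Rightarrow> real \<Rightarrow> (real^'n::finite \<Rightarrow> complex) set" where
  "sobolev_antisym k p = {u \<in> sobolev k p. antisymmetric u}"

definition sobolev_odd :: "nat \<Rightarrow> real \<Rightarrow> (real^'n::finite \<Rightarrow> complex) set" where
  "sobolev_odd k p = {u \<in> sobolev k p. odd_function u}"

end

theory Submission
  imports Defs
begin

text \<open>
  Both inequalities follow from one first-order inequality. Let \<open>V\<close> be a harmonic polynomial,
  homogeneous of degree \<open>k\<close>, whose zero set is contained in the set where the symmetry forces
  \<open>u\<close> to vanish: the Vandermonde product, with \<open>k = d (d - 1) / 2\<close>, for antisymmetric \<open>u\<close>, and a
  single coordinate, with \<open>k = 1\<close>, for \<open>u\<close> odd in that coordinate. Put \<open>s = k + d/2 - 2\<close>,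
  \<open>h = V |x|^(-s)\<close> and \<open>X = grad h / h\<close>. Integrating
  \<open>|grad u|^2 \<ge> 2 u grad u . X - u^2 |X|^2\<close> against \<open>|x|^(-2)\<close> and integrating by parts yields
  \<open>- \<integral> u \<Delta>u / |x|^2 \<ge> m \<integral> u^2 / |x|^4\<close> with \<open>m = s (s + 2)\<close>. Since
  \<open>- u \<Delta>u / |x|^2 \<le> (\<Delta>u)^2 / (2 m) + m u^2 / (2 |x|^4)\<close>, this gives
  \<open>\<integral> (\<Delta>u)^2 \<ge> m^2 \<integral> u^2 / |x|^4\<close>, and \<open>m^2\<close> is the asserted constant in both cases: \<open>k\<close> is the
  lowest degree of a spherical harmonic with the given symmetry.

  An odd function need not vanish on a hyperplane, but it is a sum of functions each of which is odd
  in some coordinate. The parts of a function that are odd and even in one coordinate are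
  orthogonal for all the quadratic forms involved, so the first-order inequality may be checked on
  the parts (\<open>hardy_ineq_parity_split\<close>, \<open>hardy_ineq_odd\<close>).

  To make the integrations by parts legitimate, \<open>|x|^(-2)\<close> is replaced by
  \<open>max 0 (1 - |x|^2/R^2)^3 / (|x|^2 + \<delta>)\<close> and \<open>|x|^(-s)\<close> by \<open>(|x|^2 + \<delta>)^(-s/2)\<close>. All errors made
  by this have a favourable sign, except for one that is bounded by \<open>12 / R^4\<close> times \<open>\<integral> u^2\<close>
  and disappears as \<open>R \<rightarrow> \<infinity>\<close> (\<open>rellich_weight_inequality\<close>, \<open>rellich_cutoff\<close>). The
  singularities of \<open>grad V / V\<close> on the hyperplanes are smoothed out and recovered by dominated
  convergence, because \<open>u\<close> is Lipschitz and vanishes there (\<open>hardy_ineq_limit\<close>).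

  Sobolev functions are reached by mollification with a radial kernel, which preserves both
  symmetries, is a contraction in the \<open>L^2\<close> norm and commutes with the weak Laplacian. Weak convergence
  of the mollifications suffices to pass to the limit (\<open>weighted_square_le_weak_limit\<close>). Finally
  \<open>R \<rightarrow> \<infinity>\<close> and \<open>\<delta> \<rightarrow> 0\<close> by Fatou's lemma.
\<close>


section \<open>Partial derivatives and integration by parts\<close>

text \<open>Only derivatives along coordinate lines enter the argument. Working with them instead of
  total derivatives makes differentiation under the integral sign a one-variable matter.\<close>

definition has_pd :: "'n::finite \<Rightarrow> (real^'n \<Rightarrow> real) \<Rightarrow> (real^'n \<Rightarrow> real) \<Rightarrow> bool" where
  "has_pd i F F' \<longleftrightarrow> (\<forall>x. ((\<lambda>t. F (x + t *\<^sub>R axis i 1)) has_real_derivative F' x) (at 0))"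

lemma has_pd_line:
  assumes "has_pd i F F'"
  shows "((\<lambda>t. F (x + t *\<^sub>R axis i 1)) has_real_derivative F' (x + t *\<^sub>R axis i 1)) (at t)"
proof -
  have "((\<lambda>r. F ((x + t *\<^sub>R axis i 1) + r *\<^sub>R axis i 1)) has_real_derivative F' (x + t *\<^sub>R axis i 1)) (at 0)"
    using assms unfolding has_pd_def by blast
  then have "((\<lambda>r. F (x + (r + t) *\<^sub>R axis i 1)) has_real_derivative F' (x + t *\<^sub>R axis i 1)) (at 0)"
    by (simp add: algebra_simps)
  then show ?thesis using DERIV_shift[of "\<lambda>r. F (x + r *\<^sub>R axis i 1)" _ 0 t] by simp
qed

lemma has_pd_const: "has_pd i (\<lambda>x. c) (\<lambda>x. 0)"
  by (simp add: has_pd_def)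

lemma has_pd_coord: "has_pd i (\<lambda>x. x $ j) (\<lambda>x. if j = i then 1 else 0)"
  unfolding has_pd_def
  by (auto simp: axis_def intro!: derivative_eq_intros)

lemma has_pd_add:
  "has_pd i F F' \<Longrightarrow> has_pd i G G' \<Longrightarrow> has_pd i (\<lambda>x. F x + G x) (\<lambda>x. F' x + G' x)"
  unfolding has_pd_def by (auto intro!: DERIV_add)

lemma has_pd_diff:
  "has_pd i F F' \<Longrightarrow> has_pd i G G' \<Longrightarrow> has_pd i (\<lambda>x. F x - G x) (\<lambda>x. F' x - G' x)"
  unfolding has_pd_def by (auto intro!: DERIV_diff)

lemma has_pd_mult:
  assumes "has_pd i F F'" "has_pd i G G'"
  shows "has_pd i (\<lambda>x. F x * G x) (\<lambda>x. F' x * G x + F x * G' x)"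
  using assms unfolding has_pd_def
  by (auto intro!: derivative_eq_intros simp: mult.commute)

lemma has_pd_cmult: "has_pd i F F' \<Longrightarrow> has_pd i (\<lambda>x. c * F x) (\<lambda>x. c * F' x)"
  unfolding has_pd_def by (auto intro!: DERIV_cmult)

lemma has_pd_sum:
  "(\<And>a. a \<in> A \<Longrightarrow> has_pd i (F a) (F' a)) \<Longrightarrow> has_pd i (\<lambda>x. \<Sum>a\<in>A. F a x) (\<lambda>x. \<Sum>a\<in>A. F' a x)"
  unfolding has_pd_def by (auto intro!: DERIV_sum)

lemma has_pd_compose:
  assumes "has_pd i F F'" "\<And>x. (g has_real_derivative g' (F x)) (at (F x))"
  shows "has_pd i (\<lambda>x. g (F x)) (\<lambda>x. g' (F x) * F' x)"
  unfolding has_pd_def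
proof
  fix x
  have "((\<lambda>t. F (x + t *\<^sub>R axis i 1)) has_real_derivative F' x) (at 0)"
    using assms(1) unfolding has_pd_def by blast
  moreover have "(g has_real_derivative g' (F x)) (at (F (x + 0 *\<^sub>R axis i 1)))"
    using assms(2) by simp
  ultimately show "((\<lambda>t. g (F (x + t *\<^sub>R axis i 1))) has_real_derivative g' (F x) * F' x) (at 0)"
    by (rule DERIV_chain2[rotated])
qed

lemma has_pd_eq: "has_pd i F F' \<Longrightarrow> (\<And>x. F' x = G' x) \<Longrightarrow> has_pd i F G'"
  unfolding has_pd_def by simp

lemma has_pd_normsq: "has_pd i (\<lambda>x. x \<bullet> x) (\<lambda>x. 2 * x $ i)"
proof -
  have "has_pd i (\<lambda>x. \<Sum>j\<in>UNIV. x $ j * x $ j)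
     (\<lambda>x. \<Sum>j\<in>UNIV. (if j = i then 1 else 0) * x $ j + x $ j * (if j = i then 1 else 0))"
    by (intro has_pd_sum has_pd_mult has_pd_coord)
  then show ?thesis
    unfolding inner_vec_def inner_real_def
    by (rule has_pd_eq) (simp add: if_distrib if_distribR sum.distrib cong: if_cong)
qed

text \<open>Differentiation under the integral sign at a single parameter value: the difference quotients
  are dominated by \<open>B\<close>. It serves both for the divergence theorem below and for derivatives
  of mollifications.\<close>

lemma integral_has_derivative_lipschitz:
  fixes f :: "real \<Rightarrow> 'a \<Rightarrow> real"
  assumes int: "\<And>t. \<bar>t\<bar> \<le> 1 \<Longrightarrow> integrable M (f t)"
    and der: "\<And>y. ((\<lambda>t. f t y) has_real_derivative f' y) (at 0)"
    and B: "integrable M B" and lip: "\<And>t y. \<bar>t\<bar> \<le> 1 \<Longrightarrow> \<bar>f t y - f 0 y\<bar> \<le> \<bar>t\<bar> * B y"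
  shows "((\<lambda>t. \<integral>y. f t y \<partial>M) has_real_derivative (\<integral>y. f' y \<partial>M)) (at 0)" "integrable M f'"
proof -
  have seq: "(\<lambda>n. (f (s n) y - f 0 y) / s n) \<longlonglongrightarrow> f' y"
    if "\<And>n. s n \<noteq> 0" "s \<longlonglongrightarrow> 0" for s y
    using der[of y] that unfolding has_field_derivative_iff tendsto_at_iff_sequentially
    by (auto simp: o_def)
  have key: "integrable M f' \<and> (\<lambda>n. \<integral>y. (f (s n) y - f 0 y) / s n \<partial>M) \<longlonglongrightarrow> (\<integral>y. f' y \<partial>M)"
    if s: "\<And>n. s n \<noteq> 0" "s \<longlonglongrightarrow> 0" "\<And>n. \<bar>s n\<bar> \<le> 1" for s
  proof -
    have m: "(\<lambda>y. (f (s n) y - f 0 y) / s n) \<in> borel_measurable M" for n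
      using int[of "s n"] int[of 0] s(3)[of n] by (auto intro!: borel_measurable_divide borel_measurable_diff)
    have m': "f' \<in> borel_measurable M"
      by (rule borel_measurable_LIMSEQ_real[OF _ m]) (rule seq[OF s(1,2)])
    have b: "norm ((f (s n) y - f 0 y) / s n) \<le> B y" for n y
      using lip[OF s(3)[of n], of y] s(1)[of n] by (simp add: abs_divide divide_le_eq mult.commute)
    show ?thesis
      using integrable_dominated_convergence[where s="\<lambda>n y. (f (s n) y - f 0 y) / s n", OF m' m B AE_I2 AE_I2]
        integral_dominated_convergence[where s="\<lambda>n y. (f (s n) y - f 0 y) / s n", OF m' m B AE_I2 AE_I2]
        seq[OF s(1,2)] b by blast
  qed
  have "(\<lambda>n. 1 / real (Suc n)) \<longlonglongrightarrow> 0" using LIMSEQ_inverse_real_of_nat by (simp add: inverse_eq_divide)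
  from key[of "\<lambda>n. 1 / real (Suc n)", OF _ this] show "integrable M f'" by (auto simp: divide_le_eq)
  show "((\<lambda>t. \<integral>y. f t y \<partial>M) has_real_derivative (\<integral>y. f' y \<partial>M)) (at 0)"
    unfolding has_field_derivative_iff tendsto_at_iff_sequentially
  proof (intro allI impI)
    fix s :: "nat \<Rightarrow> real" assume s0: "\<forall>n. s n \<in> UNIV - {0}" and sl: "s \<longlonglongrightarrow> 0"
    from sl have "eventually (\<lambda>n. \<bar>s n\<bar> < 1) sequentially"
      using tendstoD[OF sl, of 1] by (simp add: dist_real_def)
    then obtain N where N: "\<And>n. n \<ge> N \<Longrightarrow> \<bar>s n\<bar> < 1" by (auto simp: eventually_sequentially)
    have "(\<lambda>n. \<integral>y. (f (s (n + N)) y - f 0 y) / s (n + N) \<partial>M) \<longlonglongrightarrow> (\<integral>y. f' y \<partial>M)"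
      using key[of "\<lambda>n. s (n + N)"] s0 LIMSEQ_ignore_initial_segment[OF sl, of N]
        less_imp_le[OF N[OF le_add2]] by simp
    moreover have "(\<integral>y. (f (s (n + N)) y - f 0 y) / s (n + N) \<partial>M)
       = ((\<integral>y. f (s (n + N)) y \<partial>M) - (\<integral>y. f 0 y \<partial>M)) / (s (n + N) - 0)" for n
      using int[of "s (n + N)"] int[of 0] N[of "n + N"] by simp
    ultimately have "(\<lambda>n. ((\<integral>y. f (s (n + N)) y \<partial>M) - (\<integral>y. f 0 y \<partial>M)) / (s (n + N) - 0)) \<longlonglongrightarrow> (\<integral>y. f' y \<partial>M)"
      by (simp only:)
    then show "((\<lambda>y. ((\<integral>x. f y x \<partial>M) - (\<integral>x. f 0 x \<partial>M)) / (y - 0)) \<circ> s) \<longlonglongrightarrow> (\<integral>y. f' y \<partial>M)"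
      unfolding o_def by (rule LIMSEQ_offset)
  qed
qed

lemma integrable_continuous_cball:
  fixes F :: "real^'n::finite \<Rightarrow> real"
  assumes "continuous_on UNIV F" "\<And>x. norm x > R \<Longrightarrow> F x = 0"
  shows "integrable lborel F"
proof -
  have "integrable lborel (\<lambda>x. indicator (cball 0 R) x *\<^sub>R F x)"
    by (rule borel_integrable_compact) (use assms(1) continuous_on_subset in auto)
  moreover have "(\<lambda>x. indicator (cball 0 R) x *\<^sub>R F x) = F"
    using assms(2) by (auto simp: indicator_def fun_eq_iff)
  ultimately show ?thesis by simp
qed

lemma bounded_continuous_cball:
  fixes F :: "real^'n::finite \<Rightarrow> real"
  assumes "continuous_on UNIV F" "\<And>x. norm x > R \<Longrightarrow> F x = 0"
  obtains M where "M \<ge> 0" "\<And>x. \<bar>F x\<bar> \<le> M"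
proof -
  have "compact (F ` cball 0 R)"
    by (rule compact_continuous_image) (use assms(1) continuous_on_subset in auto)
  then obtain M where M: "\<And>x. x \<in> cball 0 R \<Longrightarrow> \<bar>F x\<bar> \<le> M"
    using compact_imp_bounded[of "F ` cball 0 R"] unfolding bounded_iff by (metis imageI real_norm_def)
  have "\<bar>F x\<bar> \<le> max M 0" for x
    using M[of x] assms(2)[of x] by (cases "norm x > R") auto
  then show ?thesis using that[of "max M 0"] by auto
qed

lemma has_pd_zero_outside:
  assumes "has_pd i F F'" "\<And>x. norm x > R \<Longrightarrow> F x = 0" "norm x > R"
  shows "F' x = 0"
proof -
  have "((\<lambda>t. norm (x + t *\<^sub>R axis i 1)) \<longlongrightarrow> norm (x + 0 *\<^sub>R axis i 1)) (at 0)"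
    by (intro tendsto_intros)
  then have "eventually (\<lambda>t. norm (x + t *\<^sub>R axis i 1) > R) (at 0)"
    using assms(3) by (intro order_tendstoD(1)) auto
  then have "eventually (\<lambda>t. F (x + t *\<^sub>R axis i 1) = 0) (at 0)"
    by eventually_elim (rule assms(2))
  then have ev: "eventually (\<lambda>t. F (x + t *\<^sub>R axis i 1) = 0) (nhds 0)"
    using assms(2)[OF assms(3)] by (simp add: eventually_nhds_conv_at)
  have "((\<lambda>t. F (x + t *\<^sub>R axis i 1)) has_real_derivative F' x) (at 0)"
    using assms(1) by (simp add: has_pd_def)
  then have "((\<lambda>t. 0) has_real_derivative F' x) (at (0::real))"
    using DERIV_cong_ev[OF refl ev refl] by simp
  then show ?thesis using DERIV_unique DERIV_const by blast
qed

lemma has_pd_lipschitz: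
  assumes "has_pd i F F'" "\<And>x. \<bar>F' x\<bar> \<le> M"
  shows "\<bar>F (x + t *\<^sub>R axis i 1) - F x\<bar> \<le> M * \<bar>t\<bar>"
proof -
  have "norm ((\<lambda>t. F (x + t *\<^sub>R axis i 1)) t - (\<lambda>t. F (x + t *\<^sub>R axis i 1)) 0) \<le> M * norm (t - 0)"
    by (rule field_differentiable_bound[where S=UNIV and f'="\<lambda>t. F' (x + t *\<^sub>R axis i 1)"])
       (use has_pd_line[OF assms(1)] assms(2) in auto)
  then show ?thesis by simp
qed

lemma lborel_integral_translate:
  fixes F :: "real^'n::finite \<Rightarrow> real"
  assumes "F \<in> borel_measurable borel"
  shows "(LBINT x. F (x + a)) = (LBINT x. F x)"
proof -
  have "(LBINT x. F x) = (\<integral>x. F x \<partial>(distr lborel borel ((+) a)))"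
    by (simp add: lborel_distr_plus)
  also have "\<dots> = (LBINT x. F (a + x))"
    by (rule integral_distr) (use assms in auto)
  finally show ?thesis by (simp add: add.commute)
qed

text \<open>The integral of a translate \<open>F (x + t e\<^sub>i)\<close> does not depend on \<open>t\<close>, so its derivative at
  \<open>t = 0\<close>, which is the integral of \<open>F'\<close>, is zero.\<close>

lemma integral_has_pd_zero:
  fixes F :: "real^'n::finite \<Rightarrow> real"
  assumes pd: "has_pd i F F'" and cF: "continuous_on UNIV F" and cF': "continuous_on UNIV F'"
    and z: "\<And>x. norm x > R \<Longrightarrow> F x = 0"
  shows "(LBINT x. F' x) = 0"
proof -
  have z': "\<And>x. norm x > R \<Longrightarrow> F' x = 0" using has_pd_zero_outside[OF pd z] by blast
  obtain M where M: "M \<ge> 0" "\<And>x. \<bar>F' x\<bar> \<le> M" using bounded_continuous_cball[OF cF' z'] by blast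
  have zt: "F (x + t *\<^sub>R axis i 1) = 0" if "norm x > R + 1" "\<bar>t\<bar> \<le> 1" for x t
  proof (rule z)
    have "norm x - norm (t *\<^sub>R axis i (1::real)) \<le> norm (x + t *\<^sub>R axis i 1)" 
      using norm_triangle_ineq2[of x "- (t *\<^sub>R axis i 1)"] by (simp del: norm_scaleR)
    then show "norm (x + t *\<^sub>R axis i 1) > R" using that by simp
  qed
  have "((\<lambda>t. LBINT x. F (x + t *\<^sub>R axis i 1)) has_real_derivative (LBINT x. F' x)) (at 0)"
  proof (rule integral_has_derivative_lipschitz(1))
    show "integrable lborel (\<lambda>x. F (x + t *\<^sub>R axis i 1))" if "\<bar>t\<bar> \<le> 1" for t
      by (rule integrable_continuous_cball[where R="R+1"])
        (use zt that in \<open>auto intro!: continuous_on_compose2[OF cF] continuous_intros\<close>)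
    show "((\<lambda>t. F (x + t *\<^sub>R axis i 1)) has_real_derivative F' x) (at 0)" for x
      using pd by (simp add: has_pd_def)
    show "integrable lborel (\<lambda>x. indicator (cball 0 (R+1)) x *\<^sub>R M)"
      by (rule borel_integrable_compact) auto
    show "\<bar>F (x + t *\<^sub>R axis i 1) - F (x + 0 *\<^sub>R axis i 1)\<bar> \<le> \<bar>t\<bar> * (indicator (cball 0 (R+1)) x *\<^sub>R M)"
      if "\<bar>t\<bar> \<le> 1" for t x
    proof (cases "norm x > R + 1")
      case True then show ?thesis using zt[OF True that] z[of x] M(1) by auto
    next
      case False then show ?thesis using has_pd_lipschitz[OF pd M(2), of x t]
        by (simp add: mult.commute)
    qed
  qed
  moreover have "(\<lambda>t. LBINT x. F (x + t *\<^sub>R axis i 1)) = (\<lambda>t. LBINT x. F x)"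
    using lborel_integral_translate[of F] borel_measurable_continuous_onI[OF cF] by simp
  ultimately show ?thesis using DERIV_unique DERIV_const by metis
qed


section \<open>The Hardy inequality by a ground state\<close>

text \<open>The weight is \<open>W x = w (|x|^2)\<close>, and \<open>y\<close> describes the radial factor \<open>g\<close> of the ground state through
  \<open>grad g / g = y (|x|^2) x\<close>; \<open>w1\<close> and \<open>y1\<close> are the derivatives of \<open>w\<close> and \<open>y\<close>.\<close>

definition radial_weight ::
    "real \<Rightarrow> (real \<Rightarrow> real) \<Rightarrow> (real \<Rightarrow> real) \<Rightarrow> (real \<Rightarrow> real) \<Rightarrow> (real \<Rightarrow> real) \<Rightarrow> bool" where
  "radial_weight R w w1 y y1 \<longleftrightarrow>
     (\<forall>t\<ge>0. 0 \<le> w t \<and> (w has_real_derivative w1 t) (at t) \<and> (y has_real_derivative y1 t) (at t)) \<and>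
     continuous_on {0..} w1 \<and> continuous_on {0..} y1 \<and>
     (\<forall>t. t > R\<^sup>2 \<longrightarrow> w t = 0 \<and> w1 t = 0)"

text \<open>This is \<open>- div (W grad h) / h\<close> for \<open>h = V g\<close>, at \<open>t = |x|^2\<close>, where \<open>V\<close> is harmonic and homogeneous of
  degree \<open>k\<close> in \<open>d\<close> dimensions. Only \<open>k\<close> is left of \<open>V\<close>, because \<open>x . grad V = k V\<close>.\<close>

definition hardy_potential ::
    "real \<Rightarrow> real \<Rightarrow> (real \<Rightarrow> real) \<Rightarrow> (real \<Rightarrow> real) \<Rightarrow> (real \<Rightarrow> real) \<Rightarrow> (real \<Rightarrow> real) \<Rightarrow> real \<Rightarrow> real" where
  "hardy_potential d k w w1 y y1 t =
     - (2 * w1 t * (k + t * y t) + w t * (d * y t + 2 * t * y1 t + t * (y t)\<^sup>2 + 2 * k * y t))"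

text \<open>The quantification over all radial weights is what allows the inequality to be transported
  through the parity decomposition before a weight is chosen.\<close>

definition hardy_ineq :: "real \<Rightarrow> (real^'n::finite \<Rightarrow> real) \<Rightarrow> ('n \<Rightarrow> real^'n \<Rightarrow> real) \<Rightarrow> bool" where
  "hardy_ineq k U G \<longleftrightarrow> (\<forall>R w w1 y y1. R > 0 \<longrightarrow> radial_weight R w w1 y y1 \<longrightarrow>
     (LBINT x. hardy_potential CARD('n) k w w1 y y1 (x \<bullet> x) * (U x)\<^sup>2)
       \<le> (LBINT x. w (x \<bullet> x) * (\<Sum>i\<in>UNIV. (G i x)\<^sup>2)))"

lemma continuous_radial:
  fixes w :: "real \<Rightarrow> real"
  assumes "continuous_on {0..} w"
  shows "continuous_on UNIV (\<lambda>x::real^'n::finite. w (x \<bullet> x))"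
  by (rule continuous_on_compose2[OF assms]) (auto intro!: continuous_intros)

lemma continuous_on_DERIV:
  fixes w :: "real \<Rightarrow> real"
  assumes "\<And>t. t \<in> S \<Longrightarrow> (w has_real_derivative w1 t) (at t)"
  shows "continuous_on S w"
  using assms by (meson DERIV_isCont continuous_at_imp_continuous_on)

lemma norm_gt_inner: "R > 0 \<Longrightarrow> norm x > R \<Longrightarrow> x \<bullet> x > R\<^sup>2"
  for x :: "real^'n::finite"
  by (simp add: dot_square_norm power_strict_mono)

lemma radial_weightD:
  assumes "radial_weight R w w1 y y1"
  shows "\<And>t. t \<ge> 0 \<Longrightarrow> 0 \<le> w t" "\<And>t. t \<ge> 0 \<Longrightarrow> (w has_real_derivative w1 t) (at t)"
    "\<And>t. t \<ge> 0 \<Longrightarrow> (y has_real_derivative y1 t) (at t)"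
    "continuous_on {0..} w" "continuous_on {0..} w1" "continuous_on {0..} y" "continuous_on {0..} y1"
    "\<And>t. t > R\<^sup>2 \<Longrightarrow> w t = 0" "\<And>t. t > R\<^sup>2 \<Longrightarrow> w1 t = 0"
  using assms unfolding radial_weight_def
  by (auto intro!: continuous_on_DERIV[of "{0..}" w w1] continuous_on_DERIV[of "{0..}" y y1])

lemma integral_le_dominated_limit:
  fixes E :: "nat \<Rightarrow> 'a \<Rightarrow> real"
  assumes "\<And>n. E n \<in> borel_measurable M" "F \<in> borel_measurable M" "integrable M B"
    "\<And>n x. \<bar>E n x\<bar> \<le> B x" "AE x in M. (\<lambda>n. E n x) \<longlonglongrightarrow> F x" "\<And>n. (\<integral>x. E n x \<partial>M) \<le> c"
  shows "(\<integral>x. F x \<partial>M) \<le> c"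
proof -
  have "(\<lambda>n. \<integral>x. E n x \<partial>M) \<longlonglongrightarrow> (\<integral>x. F x \<partial>M)"
    by (rule integral_dominated_convergence[where w=B]) (use assms in auto)
  then show ?thesis using assms(6) by (meson LIMSEQ_le_const2)
qed

text \<open>The fields \<open>X n\<close> are smooth approximations of \<open>grad V / V\<close>. The assumptions \<open>lQ\<close> and \<open>lP\<close> say that in the
  limit \<open>V\<close> is harmonic, \<open>div X + |X|^2 = \<Delta>V / V = 0\<close>, and homogeneous of degree \<open>k\<close>, \<open>x . X = k\<close>. The
  bound \<open>bQ\<close> carries the factor \<open>(U x)\<^sup>2\<close>, so the vanishing of \<open>U\<close> compensates the
  singularity of the limit field.\<close>

lemma hardy_ineq_limit:
  fixes U :: "real^'n::finite \<Rightarrow> real" and X DX :: "nat \<Rightarrow> 'n \<Rightarrow> real^'n \<Rightarrow> real"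
  assumes pdU: "\<And>i. has_pd i U (G i)" and cU: "continuous_on UNIV U"
    and cG: "\<And>i. continuous_on UNIV (G i)"
    and pdX: "\<And>n i. has_pd i (X n i) (DX n i)"
    and cX: "\<And>n i. continuous_on UNIV (X n i)" "\<And>n i. continuous_on UNIV (DX n i)"
    and bQ: "\<And>n x. (U x)\<^sup>2 * \<bar>\<Sum>i\<in>UNIV. DX n i x + (X n i x)\<^sup>2\<bar> \<le> C"
    and lQ: "AE x in lborel. (\<lambda>n. \<Sum>i\<in>UNIV. DX n i x + (X n i x)\<^sup>2) \<longlonglongrightarrow> 0"
    and bP: "\<And>n x. \<bar>\<Sum>i\<in>UNIV. x $ i * X n i x\<bar> \<le> K"
    and lP: "AE x in lborel. (\<lambda>n. \<Sum>i\<in>UNIV. x $ i * X n i x) \<longlonglongrightarrow> k"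
  shows "hardy_ineq k U G"
  unfolding hardy_ineq_def
proof (intro allI impI)
  fix R w w1 y y1 assume R: "R > 0" and rw: "radial_weight R w w1 y y1"
  note rwD = radial_weightD[OF rw]
  define q where "q = (\<lambda>x::real^'n. x \<bullet> x)"
  define W where "W = (\<lambda>x::real^'n. w (q x))"
  define W1 where "W1 = (\<lambda>x::real^'n. w1 (q x))"
  define Y where "Y = (\<lambda>x::real^'n. y (q x))"
  define Y1 where "Y1 = (\<lambda>x::real^'n. y1 (q x))"
  define P where "P = (\<lambda>n x. \<Sum>i\<in>UNIV. x $ i * X n i x)"
  define Q where "Q = (\<lambda>n x. \<Sum>i\<in>UNIV. DX n i x + (X n i x)\<^sup>2)"
  have q0: "q x \<ge> 0" for x by (simp add: q_def)
  have cq: "continuous_on UNIV q" unfolding q_def by (intro continuous_intros)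
  have cW: "continuous_on UNIV W" "continuous_on UNIV W1" "continuous_on UNIV Y" "continuous_on UNIV Y1"
    unfolding W_def W1_def Y_def Y1_def q_def by (intro continuous_radial rwD)+
  have W0: "W x \<ge> 0" for x using rwD(1) q0 by (simp add: W_def)
  have Wz: "W x = 0" "W1 x = 0" if "norm x > R" for x
    using rwD(8,9)[OF norm_gt_inner[OF R that]] by (simp_all add: W_def W1_def q_def)
  have pdq: "has_pd i q (\<lambda>x. 2 * x $ i)" for i unfolding q_def by (rule has_pd_normsq)
  have pdW: "has_pd i W (\<lambda>x. W1 x * (2 * x $ i))" for i
    unfolding W_def W1_def by (rule has_pd_compose[OF pdq rwD(2)[OF q0]])
  have pdY: "has_pd i Y (\<lambda>x. Y1 x * (2 * x $ i))" for i
    unfolding Y_def Y1_def by (rule has_pd_compose[OF pdq rwD(3)[OF q0]])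
  define a where "a = (\<lambda>x. - (2 * W1 x * (U x)\<^sup>2 * (q x * Y x) + W x * (U x)\<^sup>2 *
     (CARD('n) * Y x + 2 * q x * Y1 x + q x * (Y x)\<^sup>2)))"
  define b where "b = (\<lambda>x. 2 * (U x)\<^sup>2 * (W1 x + W x * Y x))"
  define E where "E = (\<lambda>n x. a x - b x * P n x - W x * ((U x)\<^sup>2 * Q n x))"
  have ca: "continuous_on UNIV a" "continuous_on UNIV b" "continuous_on UNIV (P n)" "continuous_on UNIV (Q n)" for n
    unfolding a_def b_def P_def Q_def by (intro continuous_intros cW cq cU cX)+
  have cE: "continuous_on UNIV (E n)" for n
    unfolding E_def by (intro continuous_intros ca cW cU)
  have az: "a x = 0" "b x = 0" "E n x = 0" if "norm x > R" for n x
    using Wz[OF that] by (simp_all add: a_def b_def E_def)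
  define S where "S = (\<lambda>n i x. W1 x * (2 * x $ i) * ((U x)\<^sup>2 * (X n i x + x $ i * Y x))
      + W x * (2 * U x * G i x * (X n i x + x $ i * Y x)
      + (U x)\<^sup>2 * (DX n i x + Y x + 2 * (x $ i)\<^sup>2 * Y1 x)))"
  have cS: "continuous_on UNIV (S n i)" for n i
    unfolding S_def by (intro continuous_intros cW cU cX cG)
  have Sz: "S n i x = 0" if "norm x > R" for n i x using Wz[OF that] by (simp add: S_def)
  have intS: "(LBINT x. S n i x) = 0" for n i
  proof (rule integral_has_pd_zero[where R=R, OF _ _ cS])
    have "has_pd i (\<lambda>x. W x * (U x * U x * (X n i x + x $ i * Y x)))
      (\<lambda>x. W1 x * (2 * x $ i) * (U x * U x * (X n i x + x $ i * Y x)) +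
         W x * ((G i x * U x + U x * G i x) * (X n i x + x $ i * Y x) +
           U x * U x * (DX n i x + ((if i = i then 1 else 0) * Y x + x $ i * (Y1 x * (2 * x $ i))))))"
      by (intro has_pd_mult has_pd_add pdW pdU pdX pdY has_pd_coord)
    then show "has_pd i (\<lambda>x. W x * (U x * U x * (X n i x + x $ i * Y x))) (S n i)"
      by (rule has_pd_eq) (simp add: S_def power2_eq_square algebra_simps)
    show "continuous_on UNIV (\<lambda>x. W x * (U x * U x * (X n i x + x $ i * Y x)))"
      by (intro continuous_intros cW cU cX)
  qed (use Wz in auto)
  define T where "T = (\<lambda>x. W x * (\<Sum>i\<in>UNIV. (G i x)\<^sup>2))"
  have cT: "continuous_on UNIV T" unfolding T_def by (intro continuous_intros cW cG)
  have iT: "integrable lborel T"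
    by (rule integrable_continuous_cball[where R=R, OF cT]) (use Wz in \<open>auto simp: T_def\<close>)
  have iE: "integrable lborel (E n)" for n
    by (rule integrable_continuous_cball[OF cE az(3)])
  have iS: "integrable lborel (S n i)" for n i
    by (rule integrable_continuous_cball[OF cS Sz])
  \<comment> \<open>Completing the square: \<open>T\<close> is the gradient term, \<open>E n\<close> the lower bound, and \<open>S n i\<close> integrates to zero.\<close>
  have key: "T x - E n x - (\<Sum>i\<in>UNIV. S n i x) = W x * (\<Sum>i\<in>UNIV. (G i x - U x * (X n i x + x $ i * Y x))\<^sup>2)" for n x
  proof -
    have qs: "q x = (\<Sum>i\<in>UNIV. (x $ i)\<^sup>2)" by (simp add: q_def inner_vec_def power2_eq_square)
    have "W x * (\<Sum>i\<in>UNIV. (G i x - U x * (X n i x + x $ i * Y x))\<^sup>2) + (\<Sum>i\<in>UNIV. S n i x)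
      = (\<Sum>i\<in>UNIV. W x * (G i x)\<^sup>2
          + (W1 x * 2 * (U x)\<^sup>2 + 2 * W x * (U x)\<^sup>2 * Y x) * (x $ i * X n i x)
          + W x * (U x)\<^sup>2 * (DX n i x + (X n i x)\<^sup>2)
          + (2 * W1 x * (U x)\<^sup>2 * Y x + W x * (U x)\<^sup>2 * (2 * Y1 x + (Y x)\<^sup>2)) * (x $ i)\<^sup>2
          + W x * (U x)\<^sup>2 * Y x)"
      unfolding sum_distrib_left sum.distrib[symmetric] S_def
      by (intro sum.cong refl) (simp add: power2_eq_square algebra_simps)
    also have "\<dots> = T x - E n x"
      unfolding sum.distrib sum_distrib_left[symmetric] P_def[symmetric] Q_def[symmetric] qs[symmetric]
        T_def E_def a_def b_def sum_constant
      by (simp add: P_def Q_def sum.distrib algebra_simps)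
    finally show ?thesis by simp
  qed
  have leE: "(LBINT x. E n x) \<le> (LBINT x. T x)" for n
  proof -
    have "0 \<le> (LBINT x. T x - E n x - (\<Sum>i\<in>UNIV. S n i x))"
      unfolding key by (intro integral_nonneg_AE AE_I2 mult_nonneg_nonneg W0 sum_nonneg) auto
    also have "\<dots> = (LBINT x. T x) - (LBINT x. E n x)"
      using iT iE iS by (simp add: intS)
    finally show ?thesis by simp
  qed
  have "(LBINT x. a x - b x * k) \<le> (LBINT x. T x)"
  proof (rule integral_le_dominated_limit[where E=E and B="\<lambda>x. \<bar>a x\<bar> + \<bar>b x\<bar> * K + W x * C"])
    show "E n \<in> borel_measurable lborel" for n using iE by (rule borel_measurable_integrable)
    have "continuous_on UNIV (\<lambda>x. a x - b x * k)" by (intro continuous_intros ca)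
    then show "(\<lambda>x. a x - b x * k) \<in> borel_measurable lborel"
      using borel_measurable_continuous_onI by simp
    show "integrable lborel (\<lambda>x. \<bar>a x\<bar> + \<bar>b x\<bar> * K + W x * C)"
      by (rule integrable_continuous_cball[where R=R]) (use az Wz in \<open>auto intro!: continuous_intros ca cW\<close>)
    show "\<bar>E n x\<bar> \<le> \<bar>a x\<bar> + \<bar>b x\<bar> * K + W x * C" for n x
    proof -
      have "\<bar>b x * P n x\<bar> \<le> \<bar>b x\<bar> * K" using bP[of x n] by (simp add: P_def abs_mult mult_left_mono)
      moreover have "\<bar>W x * ((U x)\<^sup>2 * Q n x)\<bar> \<le> W x * C"
        using bQ[of x n] W0[of x] by (simp add: Q_def abs_mult mult_left_mono)
      ultimately show ?thesis unfolding E_def by linarith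
    qed
    show "AE x in lborel. (\<lambda>n. E n x) \<longlonglongrightarrow> a x - b x * k"
      using lP lQ
    proof eventually_elim
      case (elim x)
      have "(\<lambda>n. a x - b x * P n x - W x * ((U x)\<^sup>2 * Q n x)) \<longlonglongrightarrow> a x - b x * k - W x * ((U x)\<^sup>2 * 0)"
        unfolding P_def Q_def by (intro tendsto_intros elim)
      then show ?case by (simp add: E_def)
    qed
  qed (rule leE)
  moreover have "(\<lambda>x. a x - b x * k) = (\<lambda>x. hardy_potential CARD('n) k w w1 y y1 (x \<bullet> x) * (U x)\<^sup>2)"
    by (simp add: fun_eq_iff a_def b_def hardy_potential_def W_def W1_def Y_def Y1_def q_def algebra_simps)
  ultimately show "(LBINT x. hardy_potential CARD('n) k w w1 y y1 (x \<bullet> x) * (U x)\<^sup>2)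
       \<le> (LBINT x. w (x \<bullet> x) * (\<Sum>i\<in>UNIV. (G i x)\<^sup>2))"
    by (simp add: T_def W_def q_def)
qed

text \<open>The divergence theorem for the field \<open>W U grad U - U^2 grad W / 2\<close>, where \<open>grad W = 2 w1 (|x|^2) x\<close>.\<close>

lemma integral_by_parts_laplacian:
  fixes U :: "real^'n::finite \<Rightarrow> real" and w w1 w2 :: "real \<Rightarrow> real"
  assumes pd: "\<And>i. has_pd i U (G i)" "\<And>i. has_pd i (G i) (H i)"
    and c: "continuous_on UNIV U" "\<And>i. continuous_on UNIV (G i)" "\<And>i. continuous_on UNIV (H i)"
    and R: "R > 0" and rw: "radial_weight R w w1 y y1"
    and w2: "\<And>t. t \<ge> 0 \<Longrightarrow> (w1 has_real_derivative w2 t) (at t)" "continuous_on {0..} w2"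
      "\<And>t. t > R\<^sup>2 \<Longrightarrow> w2 t = 0"
  shows "(LBINT x. w (x \<bullet> x) * (\<Sum>i\<in>UNIV. (G i x)\<^sup>2)) =
     (LBINT x. (U x)\<^sup>2 * (CARD('n) * w1 (x \<bullet> x) + 2 * (x \<bullet> x) * w2 (x \<bullet> x))
        - w (x \<bullet> x) * (U x * (\<Sum>i\<in>UNIV. H i x)))"
proof -
  note rwD = radial_weightD[OF rw]
  define q where "q = (\<lambda>x::real^'n. x \<bullet> x)"
  define W where "W = (\<lambda>x::real^'n. w (q x))"
  define W1 where "W1 = (\<lambda>x::real^'n. w1 (q x))"
  define W2 where "W2 = (\<lambda>x::real^'n. w2 (q x))"
  have q0: "q x \<ge> 0" for x by (simp add: q_def)
  have cq: "continuous_on UNIV q" unfolding q_def by (intro continuous_intros)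
  have cW: "continuous_on UNIV W" "continuous_on UNIV W1" "continuous_on UNIV W2"
    unfolding W_def W1_def W2_def q_def using rwD(4,5) w2(2) by (simp_all add: continuous_radial)
  have Wz: "W x = 0" "W1 x = 0" "W2 x = 0" if "norm x > R" for x
    using rwD(8,9)[OF norm_gt_inner[OF R that]] w2(3)[OF norm_gt_inner[OF R that]]
    by (simp_all add: W_def W1_def W2_def q_def)
  have pdq: "has_pd i q (\<lambda>x. 2 * x $ i)" for i unfolding q_def by (rule has_pd_normsq)
  have pdW: "has_pd i W (\<lambda>x. W1 x * (2 * x $ i))" for i
    unfolding W_def W1_def by (rule has_pd_compose[OF pdq rwD(2)[OF q0]])
  have pdW1: "has_pd i W1 (\<lambda>x. W2 x * (2 * x $ i))" for i
    unfolding W1_def W2_def by (rule has_pd_compose[OF pdq w2(1)[OF q0]])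
  define S where "S = (\<lambda>i x. W x * (G i x)\<^sup>2 + W x * (U x * H i x) - (U x)\<^sup>2 * (W1 x + 2 * (x $ i)\<^sup>2 * W2 x))"
  have cS: "continuous_on UNIV (S i)" for i
    unfolding S_def by (intro continuous_intros cW c)
  have iS: "integrable lborel (S i)" for i
    by (rule integrable_continuous_cball[where R=R, OF cS]) (use Wz in \<open>auto simp: S_def\<close>)
  have intS: "(LBINT x. S i x) = 0" for i
  proof (rule integral_has_pd_zero[where R=R, OF _ _ cS])
    have "has_pd i (\<lambda>x. W x * (U x * G i x) - U x * U x * (x $ i * W1 x))
      (\<lambda>x. W1 x * (2 * x $ i) * (U x * G i x) + W x * (G i x * G i x + U x * H i x)
         - ((G i x * U x + U x * G i x) * (x $ i * W1 x)
         + U x * U x * ((if i = i then 1 else 0) * W1 x + x $ i * (W2 x * (2 * x $ i)))))"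
      by (intro has_pd_mult has_pd_diff pdW pd pdW1 has_pd_coord)
    then show "has_pd i (\<lambda>x. W x * (U x * G i x) - U x * U x * (x $ i * W1 x)) (S i)"
      by (rule has_pd_eq) (simp add: S_def power2_eq_square algebra_simps)
    show "continuous_on UNIV (\<lambda>x. W x * (U x * G i x) - U x * U x * (x $ i * W1 x))"
      by (intro continuous_intros cW c)
  qed (use Wz in auto)
  have i1: "integrable lborel (\<lambda>x. W x * (\<Sum>i\<in>UNIV. (G i x)\<^sup>2))"
    by (rule integrable_continuous_cball[where R=R]) (use Wz in \<open>auto intro!: continuous_intros c cW\<close>)
  have i2: "integrable lborel (\<lambda>x. (U x)\<^sup>2 * (CARD('n) * W1 x + 2 * q x * W2 x) - W x * (U x * (\<Sum>i\<in>UNIV. H i x)))"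
    by (rule integrable_continuous_cball[where R=R]) (use Wz in \<open>auto intro!: continuous_intros c cW cq\<close>)
  have eq: "(\<Sum>i\<in>UNIV. S i x) = W x * (\<Sum>i\<in>UNIV. (G i x)\<^sup>2)
      - ((U x)\<^sup>2 * (CARD('n) * W1 x + 2 * q x * W2 x) - W x * (U x * (\<Sum>i\<in>UNIV. H i x)))" for x
    by (simp add: S_def q_def inner_vec_def sum.distrib sum_subtractf sum_distrib_left power2_eq_square algebra_simps)
  have "0 = (LBINT x. (\<Sum>i\<in>UNIV. S i x))" using iS intS by simp
  also have "\<dots> = (LBINT x. W x * (\<Sum>i\<in>UNIV. (G i x)\<^sup>2))
      - (LBINT x. (U x)\<^sup>2 * (CARD('n) * W1 x + 2 * q x * W2 x) - W x * (U x * (\<Sum>i\<in>UNIV. H i x)))"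
    unfolding eq by (rule Bochner_Integration.integral_diff[OF i1 i2])
  finally show ?thesis by (simp add: W_def W1_def W2_def q_def)
qed


section \<open>Coordinate symmetries\<close>

text \<open>Transpositions of coordinates, reflections in coordinate hyperplanes and \<open>x \<mapsto> - x\<close> are all of
  this form. Preimages of boxes are again boxes, so that Lebesgue measure is invariant.\<close>

definition signed_perm :: "('n \<Rightarrow> real) \<Rightarrow> ('n \<Rightarrow> 'n) \<Rightarrow> real^'n::finite \<Rightarrow> real^'n" where
  "signed_perm \<sigma> \<pi> x = (\<chi> k. \<sigma> k * x $ \<pi> k)"

lemma measurable_signed_perm: "signed_perm \<sigma> \<pi> \<in> borel_measurable borel"
  unfolding signed_perm_def
  by (intro borel_measurable_continuous_onI continuous_intros)

lemma norm_signed_perm: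
  assumes s: "\<And>k. \<sigma> k = 1 \<or> \<sigma> k = -1" and p: "bij \<pi>"
  shows "norm (signed_perm \<sigma> \<pi> x) = norm x"
proof -
  have "signed_perm \<sigma> \<pi> x \<bullet> signed_perm \<sigma> \<pi> x = (\<Sum>k\<in>UNIV. x $ \<pi> k * x $ \<pi> k)"
    unfolding inner_vec_def signed_perm_def
  proof (intro sum.cong refl)
    fix k show "(\<chi> k. \<sigma> k * x $ \<pi> k) $ k \<bullet> (\<chi> k. \<sigma> k * x $ \<pi> k) $ k = x $ \<pi> k * x $ \<pi> k"
      using s[of k] by auto
  qed
  also have "\<dots> = x \<bullet> x"
    using sum.reindex_bij_betw[OF p, of "\<lambda>k. x $ k * x $ k"] by (simp add: inner_vec_def)
  finally show ?thesis by (simp add: norm_eq_sqrt_inner)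
qed

lemma emeasure_box_cart:
  fixes l u :: "real^'n::finite"
  assumes "\<And>k. l $ k \<le> u $ k"
  shows "emeasure lborel (box l u) = (\<Prod>k\<in>UNIV. ennreal (u $ k - l $ k))"
proof -
  have "emeasure lborel (box l u) = emeasure lborel (cbox l u)"
    by (simp add: emeasure_lborel_box_eq emeasure_lborel_cbox_eq)
  also have "\<dots> = ennreal (measure lborel (cbox l u))"
    by (rule emeasure_eq_ennreal_measure) (use emeasure_lborel_cbox_finite in \<open>simp add: less_top\<close>)
  also have "measure lborel (cbox l u) = (\<Prod>k\<in>UNIV. u $ k - l $ k)"
    using content_cbox_cart[of l u] assms by (simp add: cbox_interval less_eq_vec_def)
  finally show ?thesis using assms by (simp add: prod_ennreal)
qed

lemma lborel_distr_signed_perm: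
  assumes s: "\<And>k. \<sigma> k = 1 \<or> \<sigma> k = -1" and p: "bij \<pi>"
  shows "distr lborel borel (signed_perm \<sigma> \<pi>) = (lborel :: (real^'n::finite) measure)"
proof (rule lborel_eqI[symmetric])
  fix l u :: "real^'n" assume lu: "\<And>b. b \<in> Basis \<Longrightarrow> l \<bullet> b \<le> u \<bullet> b"
  have lu': "l $ k \<le> u $ k" for k
    using lu[of "axis k 1"] by (simp add: inner_axis axis_in_Basis_iff)
  define \<rho> where "\<rho> = inv \<pi>"
  have rp: "\<rho> (\<pi> k) = k" "\<pi> (\<rho> k) = k" for k
    using p by (auto simp: \<rho>_def bij_is_inj bij_is_surj surj_f_inv_f)
  define l' u' where "l' = (\<chi> j. if \<sigma> (\<rho> j) = 1 then l $ \<rho> j else - u $ \<rho> j)"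
    and "u' = (\<chi> j. if \<sigma> (\<rho> j) = 1 then u $ \<rho> j else - l $ \<rho> j)"
  have vim: "signed_perm \<sigma> \<pi> -` box l u = box l' u'"
  proof (intro set_eqI)
    fix x
    have "x \<in> signed_perm \<sigma> \<pi> -` box l u \<longleftrightarrow> (\<forall>k. l $ k < \<sigma> k * x $ \<pi> k \<and> \<sigma> k * x $ \<pi> k < u $ k)"
      by (simp add: mem_box_cart signed_perm_def)
    also have "\<dots> \<longleftrightarrow> (\<forall>k. l' $ \<pi> k < x $ \<pi> k \<and> x $ \<pi> k < u' $ \<pi> k)"
    proof (intro all_cong1)
      fix k show "(l $ k < \<sigma> k * x $ \<pi> k \<and> \<sigma> k * x $ \<pi> k < u $ k) \<longleftrightarrow> (l' $ \<pi> k < x $ \<pi> k \<and> x $ \<pi> k < u' $ \<pi> k)"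
        using s[of k] by (auto simp: l'_def u'_def rp)
    qed
    also have "\<dots> \<longleftrightarrow> (\<forall>j. l' $ j < x $ j \<and> x $ j < u' $ j)" by (metis rp(2))
    finally show "x \<in> signed_perm \<sigma> \<pi> -` box l u \<longleftrightarrow> x \<in> box l' u'" by (simp add: mem_box_cart)
  qed
  have "emeasure (distr lborel borel (signed_perm \<sigma> \<pi>)) (box l u) = emeasure lborel (box l' u')"
    using measurable_signed_perm[of \<sigma> \<pi>] by (simp add: emeasure_distr vim)
  also have "\<dots> = (\<Prod>j\<in>UNIV. ennreal (u' $ j - l' $ j))"
    by (rule emeasure_box_cart) (use lu' in \<open>auto simp: l'_def u'_def\<close>)
  also have "\<dots> = (\<Prod>j\<in>UNIV. ennreal (u $ \<rho> j - l $ \<rho> j))"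
    by (intro prod.cong refl) (auto simp: l'_def u'_def)
  also have "\<dots> = (\<Prod>k\<in>UNIV. ennreal (u $ k - l $ k))"
    using prod.reindex_bij_betw[of \<rho> UNIV UNIV "\<lambda>k. ennreal (u $ k - l $ k)"] p
    by (simp add: \<rho>_def bij_imp_bij_inv)
  also have "\<dots> = emeasure lborel (box l u)" using emeasure_box_cart[OF lu'] by simp
  also have "\<dots> = (\<Prod>b\<in>Basis. (u - l) \<bullet> b)" using lu by (simp add: emeasure_lborel_box)
  finally show "emeasure (distr lborel borel (signed_perm \<sigma> \<pi>)) (box l u) = (\<Prod>b\<in>Basis. (u - l) \<bullet> b)" .
qed simp

lemma integral_signed_perm:
  fixes F :: "real^'n::finite \<Rightarrow> real"
  assumes s: "\<And>k. \<sigma> k = 1 \<or> \<sigma> k = -1" and p: "bij \<pi>"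
    and F: "F \<in> borel_measurable borel"
  shows "(LBINT x. F (signed_perm \<sigma> \<pi> x)) = (LBINT x. F x)"
proof -
  have "(LBINT x. F x) = (\<integral>x. F x \<partial>(distr lborel borel (signed_perm \<sigma> \<pi>)))"
    by (simp add: lborel_distr_signed_perm[OF s p])
  also have "\<dots> = (LBINT x. F (signed_perm \<sigma> \<pi> x))"
    by (rule integral_distr) (use measurable_signed_perm F in auto)
  finally show ?thesis by simp
qed

definition reflect :: "'n set \<Rightarrow> real^'n::finite \<Rightarrow> real^'n" where
  "reflect J = signed_perm (\<lambda>k. if k \<in> J then -1 else 1) id"

definition swap_coords :: "'n \<Rightarrow> 'n \<Rightarrow> real^'n::finite \<Rightarrow> real^'n" where
  "swap_coords i j = signed_perm (\<lambda>k. 1) (Transposition.transpose i j)"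

lemma reflect_nth: "reflect J x $ k = (if k \<in> J then - x $ k else x $ k)"
  by (simp add: reflect_def signed_perm_def)

lemma swap_coords_nth: "swap_coords i j x $ k = x $ Transposition.transpose i j k"
  by (simp add: swap_coords_def signed_perm_def)

section \<open>Functions odd in one coordinate and antisymmetric functions\<close>

text \<open>A smooth substitute for \<open>1 / t\<close>.\<close>

definition soft_recip :: "nat \<Rightarrow> real \<Rightarrow> real" where
  "soft_recip n t = t / (t\<^sup>2 + 1 / real (Suc n))"

definition soft_recip_deriv :: "nat \<Rightarrow> real \<Rightarrow> real" where
  "soft_recip_deriv n t = (1 / real (Suc n) - t\<^sup>2) / (t\<^sup>2 + 1 / real (Suc n))\<^sup>2"

lemma soft_recip_denom_pos: "t\<^sup>2 + 1 / real (Suc n) > 0"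
  by (intro add_nonneg_pos) auto

lemma DERIV_soft_recip: "(soft_recip n has_real_derivative soft_recip_deriv n t) (at t)"
proof -
  have "t\<^sup>2 + 1 / real (Suc n) \<noteq> 0" using soft_recip_denom_pos[of t n] by linarith
  then show ?thesis unfolding soft_recip_def soft_recip_deriv_def
    by (auto intro!: derivative_eq_intros simp: power2_eq_square algebra_simps)
qed

lemma continuous_soft_recip:
  "continuous_on UNIV F \<Longrightarrow> continuous_on UNIV (\<lambda>x. soft_recip n (F x))"
  "continuous_on UNIV F \<Longrightarrow> continuous_on UNIV (\<lambda>x. soft_recip_deriv n (F x))"
  unfolding soft_recip_def soft_recip_deriv_def
  using soft_recip_denom_pos[of _ n] by (auto intro!: continuous_intros simp: less_imp_neq[symmetric])

lemma soft_recip_mult_bounds: "0 \<le> t * soft_recip n t" "t * soft_recip n t \<le> 1"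
  using soft_recip_denom_pos[of t n] by (auto simp: soft_recip_def power2_eq_square divide_le_eq intro!: divide_nonneg_pos)

text \<open>The bounds do not depend on \<open>n\<close>: a function that is \<open>O(t)\<close> may be multiplied by the singular
  factors \<open>1 / t\<close>, and its square by \<open>1 / t^2\<close>.\<close>

lemma soft_recip_bound: assumes "\<bar>u\<bar> \<le> c * \<bar>t\<bar>" "c \<ge> 0" shows "\<bar>u * soft_recip n t\<bar> \<le> c"
proof -
  have "\<bar>u * soft_recip n t\<bar> \<le> c * \<bar>t\<bar> * \<bar>soft_recip n t\<bar>" using assms by (simp add: abs_mult mult_right_mono)
  also have "\<dots> = c * (t * soft_recip n t)" using soft_recip_mult_bounds(1)[of t n] by (simp add: abs_mult[symmetric])
  also have "\<dots> \<le> c * 1" by (intro mult_left_mono soft_recip_mult_bounds assms)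
  finally show ?thesis by simp
qed

lemma soft_recip_deriv_bound: assumes "\<bar>u\<bar> \<le> c * \<bar>t\<bar>" "c \<ge> 0" shows "u\<^sup>2 * \<bar>soft_recip_deriv n t\<bar> \<le> c\<^sup>2"
proof -
  let ?D = "t\<^sup>2 + 1 / real (Suc n)"
  have D: "?D > 0" by (rule soft_recip_denom_pos)
  have "\<bar>1 / real (Suc n) - t\<^sup>2\<bar> \<le> ?D" by (simp add: abs_le_iff)
  then have "\<bar>soft_recip_deriv n t\<bar> \<le> ?D / ?D\<^sup>2" using D by (simp add: soft_recip_deriv_def abs_divide divide_right_mono)
  also have "\<dots> = 1 / ?D" using D by (simp add: power2_eq_square)
  finally have "u\<^sup>2 * \<bar>soft_recip_deriv n t\<bar> \<le> u\<^sup>2 / ?D" by (metis mult_left_mono times_divide_eq_right mult.right_neutral zero_le_power2)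
  also have "\<dots> \<le> c\<^sup>2"
  proof -
    have "u\<^sup>2 \<le> (c * \<bar>t\<bar>)\<^sup>2" using assms by (metis abs_le_square_iff abs_mult abs_abs abs_of_nonneg)
    also have "\<dots> \<le> c\<^sup>2 * ?D" by (simp add: power_mult_distrib mult_left_mono)
    finally show ?thesis using D by (simp add: divide_le_eq)
  qed
  finally show ?thesis .
qed

lemma soft_recip_tendsto:
  assumes "t \<noteq> 0"
  shows "(\<lambda>n. soft_recip n t) \<longlonglongrightarrow> 1 / t" "(\<lambda>n. soft_recip_deriv n t) \<longlonglongrightarrow> - (1 / t)\<^sup>2"
proof -
  have e: "(\<lambda>n. 1 / real (Suc n)) \<longlonglongrightarrow> 0"
    using LIMSEQ_inverse_real_of_nat by (simp add: inverse_eq_divide)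
  have "(\<lambda>n. soft_recip n t) \<longlonglongrightarrow> t / (t\<^sup>2 + 0)" unfolding soft_recip_def
    by (intro tendsto_intros e) (use assms in auto)
  then show "(\<lambda>n. soft_recip n t) \<longlonglongrightarrow> 1 / t" using assms by (simp add: power2_eq_square)
  have "(\<lambda>n. soft_recip_deriv n t) \<longlonglongrightarrow> (0 - t\<^sup>2) / (t\<^sup>2 + 0)\<^sup>2" unfolding soft_recip_deriv_def
    by (intro tendsto_intros e) (use assms in auto)
  then show "(\<lambda>n. soft_recip_deriv n t) \<longlonglongrightarrow> - (1 / t)\<^sup>2" using assms by (simp add: power2_eq_square power4_eq_xxxx)
qed

definition smooth1 :: "(real^'n::finite \<Rightarrow> real) \<Rightarrow> ('n \<Rightarrow> real^'n \<Rightarrow> real) \<Rightarrow> bool" where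
  "smooth1 U G \<longleftrightarrow> (\<exists>L. L-lipschitz_on UNIV U) \<and> (\<forall>i. has_pd i U (G i) \<and> continuous_on UNIV (G i))"

lemma smooth1D:
  assumes "smooth1 U G"
  shows "\<exists>L. L-lipschitz_on UNIV U" "has_pd i U (G i)" "continuous_on UNIV (G i)" "continuous_on UNIV U"
  using assms by (auto simp: smooth1_def intro: lipschitz_on_continuous_on)

lemma has_pd_soft_recip_coord:
  "has_pd i (\<lambda>x. soft_recip n (x $ i - x $ j)) (\<lambda>x. (if i = j then 0 else soft_recip_deriv n (x $ i - x $ j)))"
proof -
  have "has_pd i (\<lambda>x. x $ i - x $ j) (\<lambda>x. (if i = i then 1 else 0) - (if j = i then 1 else 0))"
    by (intro has_pd_diff has_pd_coord)
  from has_pd_compose[OF this DERIV_soft_recip[of n]] show ?thesis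
    by (rule has_pd_eq) auto
qed

text \<open>Here \<open>V x = x $ i\<close>. Reflecting in the hyperplane \<open>x $ i = 0\<close> moves \<open>x\<close> by \<open>2 |x $ i|\<close>, and \<open>U\<close> changes
  sign, so the Lipschitz condition gives \<open>|U x| \<le> L |x $ i|\<close>.\<close>

lemma hardy_ineq_reflection_odd:
  fixes U :: "real^'n::finite \<Rightarrow> real"
  assumes sm: "smooth1 U G" and odd: "\<And>x. U (reflect {i} x) = - U x"
  shows "hardy_ineq 1 U G"
proof -
  obtain L where L: "L-lipschitz_on UNIV U" using smooth1D(1)[OF sm] by blast
  then have L0: "L \<ge> 0" by (rule lipschitz_on_nonneg)
  have bU: "\<bar>U x\<bar> \<le> L * \<bar>x $ i\<bar>" for x
  proof -
    have "x - reflect {i} x = (2 * x $ i) *\<^sub>R axis i 1"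
      by (auto simp: reflect_nth vec_eq_iff axis_def)
    then have "dist x (reflect {i} x) = 2 * \<bar>x $ i\<bar>" by (simp add: dist_norm)
    then have "dist (U x) (U (reflect {i} x)) \<le> L * (2 * \<bar>x $ i\<bar>)"
      using lipschitz_onD[OF L, of x "reflect {i} x"] by simp
    then show ?thesis by (simp add: dist_real_def odd)
  qed
  define X where "X = (\<lambda>n j x. if j = i then soft_recip n (x $ i) else 0)"
  define DX where "DX = (\<lambda>n j x. if j = i then soft_recip_deriv n (x $ i) else 0)"
  have AE: "AE x in lborel. (x::real^'n) $ i \<noteq> 0"
    using AE_lborel_inner_neq[of "axis i (1::real) :: real^'n" 0] by (simp add: inner_axis axis_in_Basis_iff)
  have sQ: "(\<Sum>j\<in>UNIV. DX n j x + (X n j x)\<^sup>2) = soft_recip_deriv n (x $ i) + (soft_recip n (x $ i))\<^sup>2" for n x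
  proof -
    have "(\<Sum>j\<in>UNIV. DX n j x + (X n j x)\<^sup>2) = (\<Sum>j\<in>UNIV. if j = i then soft_recip_deriv n (x $ i) + (soft_recip n (x $ i))\<^sup>2 else 0)"
      by (intro sum.cong refl) (auto simp: X_def DX_def)
    then show ?thesis by simp
  qed
  have sP: "(\<Sum>j\<in>UNIV. x $ j * X n j x) = x $ i * soft_recip n (x $ i)" for n x
  proof -
    have "(\<Sum>j\<in>UNIV. x $ j * X n j x) = (\<Sum>j\<in>UNIV. if j = i then x $ i * soft_recip n (x $ i) else 0)"
      by (intro sum.cong refl) (auto simp: X_def)
    then show ?thesis by simp
  qed
  show ?thesis
  proof (rule hardy_ineq_limit[of U G X DX "2 * L\<^sup>2" 1])
    show "has_pd j (X n j) (DX n j)" for n j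
    proof (cases "j = i")
      case True
      then show ?thesis
        using has_pd_compose[OF has_pd_coord[of i i] DERIV_soft_recip[of n]] by (simp add: X_def DX_def)
    qed (simp add: X_def DX_def has_pd_const)
    show "continuous_on UNIV (X n j)" "continuous_on UNIV (DX n j)" for n j
      by (cases "j = i"; simp add: X_def DX_def continuous_soft_recip continuous_intros)+
    show "(U x)\<^sup>2 * \<bar>\<Sum>j\<in>UNIV. DX n j x + (X n j x)\<^sup>2\<bar> \<le> 2 * L\<^sup>2" for n x
    proof -
      have "\<bar>U x * soft_recip n (x $ i)\<bar>\<^sup>2 \<le> L\<^sup>2" by (intro power_mono soft_recip_bound bU L0) simp
      then have "(U x)\<^sup>2 * (soft_recip n (x $ i))\<^sup>2 \<le> L\<^sup>2" by (simp add: power_mult_distrib)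
      moreover have "(U x)\<^sup>2 * \<bar>soft_recip_deriv n (x $ i)\<bar> \<le> L\<^sup>2" by (rule soft_recip_deriv_bound[OF bU L0])
      moreover have "(U x)\<^sup>2 * \<bar>soft_recip_deriv n (x $ i) + (soft_recip n (x $ i))\<^sup>2\<bar> \<le> (U x)\<^sup>2 * (\<bar>soft_recip_deriv n (x $ i)\<bar> + (soft_recip n (x $ i))\<^sup>2)"
        by (intro mult_left_mono order_trans[OF abs_triangle_ineq]) auto
      ultimately show ?thesis unfolding sQ by (simp add: distrib_left)
    qed
    show "\<bar>\<Sum>j\<in>UNIV. x $ j * X n j x\<bar> \<le> 1" for n x
      unfolding sP using soft_recip_mult_bounds[of "x $ i" n] by simp
    show "AE x in lborel. (\<lambda>n. \<Sum>j\<in>UNIV. DX n j x + (X n j x)\<^sup>2) \<longlonglongrightarrow> 0"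
      using AE unfolding sQ
    proof eventually_elim
      case (elim x)
      have "(\<lambda>n. soft_recip_deriv n (x $ i) + (soft_recip n (x $ i))\<^sup>2) \<longlonglongrightarrow> - (1 / x $ i)\<^sup>2 + (1 / x $ i)\<^sup>2"
        by (intro tendsto_intros soft_recip_tendsto elim)
      then show ?case by simp
    qed
    show "AE x in lborel. (\<lambda>n. \<Sum>j\<in>UNIV. x $ j * X n j x) \<longlonglongrightarrow> 1"
      using AE unfolding sP
    proof eventually_elim
      case (elim x)
      have "(\<lambda>n. x $ i * soft_recip n (x $ i)) \<longlonglongrightarrow> x $ i * (1 / x $ i)"
        by (intro tendsto_intros soft_recip_tendsto elim)
      then show ?case using elim by simp
    qed
  qed (use smooth1D[OF sm] in auto)
qed

text \<open>This is the harmonicity of the Vandermonde product \<open>V\<close>: the component of \<open>grad V / V\<close> in direction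
  \<open>i\<close> is the sum of \<open>1 / (a i - a j)\<close> over \<open>j \<noteq> i\<close>. Terms with three distinct indices cancel in
  cyclic triples.\<close>

lemma sum_cyclic_reciprocals_zero:
  fixes a :: "'i::finite \<Rightarrow> real"
  assumes "inj a"
  shows "(\<Sum>i\<in>UNIV. \<Sum>j\<in>-{i}. \<Sum>l\<in>-{i}. (1 / (a i - a j)) * (1 / (a i - a l)))
     = (\<Sum>i\<in>UNIV. \<Sum>j\<in>-{i}. (1 / (a i - a j))\<^sup>2)"
proof -
  define T where "T = (\<lambda>i j l. if i \<noteq> j \<and> i \<noteq> l \<and> j \<noteq> l then (1 / (a i - a j)) * (1 / (a i - a l)) else 0)"
  define S where "S = (\<Sum>i\<in>UNIV. \<Sum>j\<in>UNIV. \<Sum>l\<in>UNIV. T i j l)"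
  have cyc: "T i j l + T j l i + T l i j = 0" for i j l
  proof (cases "i \<noteq> j \<and> i \<noteq> l \<and> j \<noteq> l")
    case True
    define p q r where "p = a i - a j" and "q = a i - a l" and "r = a j - a l"
    have nz: "p \<noteq> 0" "q \<noteq> 0" "r \<noteq> 0" and r: "r = q - p"
      using True assms by (auto simp: p_def q_def r_def inj_eq)
    have "T i j l = (1 / p) * (1 / q)" "T j l i = (1 / r) * (1 / - p)" "T l i j = (1 / - q) * (1 / - r)"
      unfolding p_def q_def r_def using True by (auto simp: T_def)
    moreover have "(1 / p) * (1 / q) + (1 / r) * (1 / - p) + (1 / - q) * (1 / - r) = 0"
      using nz by (simp add: divide_simps) (simp add: r algebra_simps)
    ultimately show ?thesis by simp
  qed (auto simp: T_def)
  have rot: "(\<Sum>i\<in>UNIV. \<Sum>j\<in>UNIV. \<Sum>l\<in>UNIV. F j l i) = (\<Sum>i\<in>UNIV. \<Sum>j\<in>UNIV. \<Sum>l\<in>UNIV. F i j l)"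
    for F :: "'i \<Rightarrow> 'i \<Rightarrow> 'i \<Rightarrow> real"
  proof -
    have "(\<Sum>i\<in>UNIV. \<Sum>j\<in>UNIV. \<Sum>l\<in>UNIV. F j l i) = (\<Sum>j\<in>UNIV. \<Sum>i\<in>UNIV. \<Sum>l\<in>UNIV. F j l i)"
      by (rule sum.swap)
    also have "\<dots> = (\<Sum>j\<in>UNIV. \<Sum>l\<in>UNIV. \<Sum>i\<in>UNIV. F j l i)"
      by (rule sum.cong[OF refl], rule sum.swap)
    finally show ?thesis .
  qed
  have S2: "S = (\<Sum>i\<in>UNIV. \<Sum>j\<in>UNIV. \<Sum>l\<in>UNIV. T j l i)"
    using rot[of T] by (simp only: S_def)
  have S3: "S = (\<Sum>i\<in>UNIV. \<Sum>j\<in>UNIV. \<Sum>l\<in>UNIV. T l i j)"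
    using rot[of "\<lambda>i j l. T j l i"] S2 by (simp only:)
  \<comment> \<open>\<open>S\<close> collects the triples of distinct indices; it equals its cyclic relabellings.\<close>
  have "S + S + S = (\<Sum>i\<in>UNIV. \<Sum>j\<in>UNIV. \<Sum>l\<in>UNIV. T i j l + T j l i + T l i j)"
    unfolding sum.distrib S2[symmetric] S3[symmetric] unfolding S_def ..
  then have S0: "S = 0" by (simp add: cyc)
  have "(\<Sum>i\<in>UNIV. \<Sum>j\<in>-{i}. \<Sum>l\<in>-{i}. (1 / (a i - a j)) * (1 / (a i - a l)))
     - (\<Sum>i\<in>UNIV. \<Sum>j\<in>-{i}. (1 / (a i - a j))\<^sup>2)
     = (\<Sum>i\<in>UNIV. \<Sum>j\<in>-{i}. \<Sum>l\<in>UNIV. T i j l)"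
    unfolding sum_subtractf[symmetric]
  proof (intro sum.cong refl)
    fix i j :: 'i assume j: "j \<in> - {i}"
    have "(\<Sum>l\<in>-{i}. (1 / (a i - a j)) * (1 / (a i - a l)))
       = (\<Sum>l\<in>-{i}. (if l = j then (1 / (a i - a j))\<^sup>2 else 0) + T i j l)"
      using j by (intro sum.cong refl) (auto simp: T_def power2_eq_square)
    also have "\<dots> = (1 / (a i - a j))\<^sup>2 + (\<Sum>l\<in>-{i}. T i j l)"
      using j by (simp add: sum.distrib)
    also have "(\<Sum>l\<in>-{i}. T i j l) = (\<Sum>l\<in>UNIV. T i j l)"
      by (rule sum.mono_neutral_left) (auto simp: T_def)
    finally show "(\<Sum>l\<in>-{i}. (1 / (a i - a j)) * (1 / (a i - a l))) - (1 / (a i - a j))\<^sup>2 = (\<Sum>l\<in>UNIV. T i j l)"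
      by simp
  qed
  also have "\<dots> = S" unfolding S_def
    by (intro sum.cong refl sum.mono_neutral_left) (auto simp: T_def)
  finally show ?thesis using S0 by simp
qed

text \<open>Here \<open>V\<close> is the Vandermonde product, of degree \<open>k = d (d - 1) / 2\<close>. Exchanging two coordinates
  shows \<open>|U x| \<le> L |x $ i - x $ j|\<close>. Each term of \<open>div X\<close> and each product of two terms of \<open>X\<close> contains two
  reciprocals of such differences, and \<open>U^2\<close> supplies one small factor for each.\<close>

lemma hardy_ineq_antisymmetric:
  fixes U :: "real^'n::finite \<Rightarrow> real"
  assumes sm: "smooth1 U G" and anti: "\<And>i j x. i \<noteq> j \<Longrightarrow> U (swap_coords i j x) = - U x"
  shows "hardy_ineq (real CARD('n) * (real CARD('n) - 1) / 2) U G"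
proof -
  obtain L where L: "L-lipschitz_on UNIV U" using smooth1D(1)[OF sm] by blast
  then have L0: "L \<ge> 0" by (rule lipschitz_on_nonneg)
  have bU: "\<bar>U x\<bar> \<le> L * \<bar>x $ i - x $ j\<bar>" if ij: "i \<noteq> j" for x i j
  proof -
    have "x - swap_coords i j x = (x $ i - x $ j) *\<^sub>R (axis i 1 - axis j 1)"
      using ij by (auto simp: swap_coords_nth vec_eq_iff axis_def Transposition.transpose_def)
    then have "dist x (swap_coords i j x) = \<bar>x $ i - x $ j\<bar> * norm (axis i (1::real) - axis j 1)" by (simp add: dist_norm)
    also have "\<dots> \<le> \<bar>x $ i - x $ j\<bar> * 2"
      by (intro mult_left_mono order_trans[OF norm_triangle_ineq4]) auto
    finally have "L * dist x (swap_coords i j x) \<le> L * (\<bar>x $ i - x $ j\<bar> * 2)" by (intro mult_left_mono L0)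
    then have "dist (U x) (U (swap_coords i j x)) \<le> L * (\<bar>x $ i - x $ j\<bar> * 2)"
      using lipschitz_onD[OF L, of x "swap_coords i j x"] by simp
    then show ?thesis by (simp add: dist_real_def anti[OF ij])
  qed
  define X where "X = (\<lambda>n i (x::real^'n). \<Sum>j\<in>-{i}. soft_recip n (x $ i - x $ j))"
  define DX where "DX = (\<lambda>n i (x::real^'n). \<Sum>j\<in>-{i}. soft_recip_deriv n (x $ i - x $ j))"
  define N where "N = real CARD('n)"
  have AE: "AE x in lborel. inj (($) (x::real^'n))"
  proof -
    have "AE x in lborel. (x::real^'n) $ i \<noteq> x $ j" if "i \<noteq> j" for i j
    proof -
      have "axis i 1 - axis j 1 \<noteq> (0 :: real^'n)" using that by (auto simp: vec_eq_iff axis_def)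
      then have "negligible {x::real^'n. (axis i 1 - axis j 1) \<bullet> x = 0}" by (intro negligible_hyperplane) auto
      then have "AE x in lebesgue. (x::real^'n) $ i \<noteq> x $ j"
        by (intro AE_I'[where N="{x. (axis i 1 - axis j 1) \<bullet> x = 0}"])
          (auto simp: negligible_iff_null_sets inner_diff_left inner_axis')
      then show ?thesis by (simp add: AE_completion_iff)
    qed
    then have "AE x in lborel. \<forall>i\<in>UNIV. \<forall>j\<in>UNIV. i \<noteq> j \<longrightarrow> (x::real^'n) $ i \<noteq> x $ j"
      by (intro AE_finite_allI) (auto)
    then show ?thesis by eventually_elim (auto simp: inj_def)
  qed
  have X2: "(X n i x)\<^sup>2 = (\<Sum>j\<in>-{i}. \<Sum>l\<in>-{i}. soft_recip n (x $ i - x $ j) * soft_recip n (x $ i - x $ l))" for n i x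
    by (simp add: X_def power2_eq_square sum_product)
  have rodd: "soft_recip n (- t) = - soft_recip n t" for n t by (simp add: soft_recip_def)
  have sP: "(\<Sum>i\<in>UNIV. x $ i * X n i x)
      = (\<Sum>i\<in>UNIV. \<Sum>j\<in>-{i}. (x $ i - x $ j) * soft_recip n (x $ i - x $ j)) / 2" for n and x :: "real^'n"
  proof -
    have full: "(\<Sum>j\<in>-{i}. c i j * soft_recip n (x $ i - x $ j)) = (\<Sum>j\<in>UNIV. c i j * soft_recip n (x $ i - x $ j))" for c :: "'n \<Rightarrow> 'n \<Rightarrow> real" and i
      by (rule sum.mono_neutral_left) (auto simp: soft_recip_def)
    have a: "(\<Sum>i\<in>UNIV. x $ i * X n i x) = (\<Sum>i\<in>UNIV. \<Sum>j\<in>UNIV. x $ i * soft_recip n (x $ i - x $ j))"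
      unfolding X_def sum_distrib_left full[of "\<lambda>i j. x $ i"] ..
    also have "\<dots> = (\<Sum>i\<in>UNIV. \<Sum>j\<in>UNIV. x $ j * soft_recip n (x $ j - x $ i))" by (rule sum.swap)
    also have "\<dots> = (\<Sum>i\<in>UNIV. \<Sum>j\<in>UNIV. - (x $ j * soft_recip n (x $ i - x $ j)))"
      using rodd[of n] by (intro sum.cong refl) (metis minus_diff_eq mult_minus_right)
    finally have b: "(\<Sum>i\<in>UNIV. x $ i * X n i x) = (\<Sum>i\<in>UNIV. \<Sum>j\<in>UNIV. - (x $ j * soft_recip n (x $ i - x $ j)))" .
    have "(\<Sum>i\<in>UNIV. x $ i * X n i x) + (\<Sum>i\<in>UNIV. x $ i * X n i x)
        = (\<Sum>i\<in>UNIV. \<Sum>j\<in>UNIV. (x $ i - x $ j) * soft_recip n (x $ i - x $ j))"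
      by (subst a, subst b) (simp add: sum.distrib[symmetric] algebra_simps)
    then show ?thesis unfolding full[of "\<lambda>i j. x $ i - x $ j"] by simp
  qed
  have cardc: "real (card (- {i::'n})) = N - 1" for i
    by (simp add: Compl_eq_Diff_UNIV card_Diff_singleton N_def of_nat_diff Suc_leI)
  show ?thesis
  proof (rule hardy_ineq_limit[of U G X DX "N * ((N - 1) * L\<^sup>2 + (N - 1) * ((N - 1) * L\<^sup>2))" "N * (N - 1) / 2"])
    show "has_pd i (X n i) (DX n i)" for n i
    proof -
      have "has_pd i (X n i) (\<lambda>x. \<Sum>j\<in>-{i}. if i = j then 0 else soft_recip_deriv n (x $ i - x $ j))"
        unfolding X_def by (intro has_pd_sum has_pd_soft_recip_coord)
      then show ?thesis by (rule has_pd_eq) (auto simp: DX_def intro!: sum.cong)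
    qed
    show "continuous_on UNIV (X n i)" "continuous_on UNIV (DX n i)" for n i
      unfolding X_def DX_def by (intro continuous_on_sum continuous_soft_recip continuous_intros)+
    show "(U x)\<^sup>2 * \<bar>\<Sum>i\<in>UNIV. DX n i x + (X n i x)\<^sup>2\<bar> \<le> N * ((N - 1) * L\<^sup>2 + (N - 1) * ((N - 1) * L\<^sup>2))" for n x
    proof -
      have 1: "(U x)\<^sup>2 * \<bar>DX n i x\<bar> \<le> (N - 1) * L\<^sup>2" for i
      proof -
        have "(U x)\<^sup>2 * \<bar>DX n i x\<bar> \<le> (U x)\<^sup>2 * (\<Sum>j\<in>-{i}. \<bar>soft_recip_deriv n (x $ i - x $ j)\<bar>)"
          unfolding DX_def by (intro mult_left_mono sum_abs) auto
        also have "\<dots> \<le> (\<Sum>j\<in>-{i}. L\<^sup>2)"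
          unfolding sum_distrib_left by (intro sum_mono soft_recip_deriv_bound bU L0) auto
        finally show ?thesis by (simp add: cardc)
      qed
      have 2: "(U x)\<^sup>2 * (X n i x)\<^sup>2 \<le> (N - 1) * ((N - 1) * L\<^sup>2)" for i
      proof -
        have "\<bar>U x * X n i x\<bar> \<le> (\<Sum>j\<in>-{i}. \<bar>U x * soft_recip n (x $ i - x $ j)\<bar>)"
          unfolding X_def sum_distrib_left by (rule sum_abs)
        also have "\<dots> \<le> (\<Sum>j\<in>-{i}. L)" by (intro sum_mono soft_recip_bound bU L0) auto
        finally have "\<bar>U x * X n i x\<bar> \<le> (N - 1) * L" by (simp add: cardc)
        then have "\<bar>U x * X n i x\<bar>\<^sup>2 \<le> ((N - 1) * L)\<^sup>2" by (intro power_mono) auto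
        then show ?thesis by (simp add: power_mult_distrib power2_eq_square mult_ac)
      qed
      have "(U x)\<^sup>2 * \<bar>\<Sum>i\<in>UNIV. DX n i x + (X n i x)\<^sup>2\<bar> \<le> (U x)\<^sup>2 * (\<Sum>i\<in>UNIV. \<bar>DX n i x\<bar> + (X n i x)\<^sup>2)"
        by (intro mult_left_mono order_trans[OF sum_abs] sum_mono order_trans[OF abs_triangle_ineq]) auto
      also have "\<dots> \<le> (\<Sum>i\<in>(UNIV::'n set). (N - 1) * L\<^sup>2 + (N - 1) * ((N - 1) * L\<^sup>2))"
        unfolding sum_distrib_left distrib_left by (intro sum_mono add_mono 1 2)
      also have "\<dots> = N * ((N - 1) * L\<^sup>2 + (N - 1) * ((N - 1) * L\<^sup>2))" by (simp add: N_def)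
      finally show ?thesis .
    qed
    have prod1: "(\<Sum>i\<in>(UNIV::'n set). \<Sum>j\<in>-{i}. (1::real)) = N * (N - 1)" by (simp add: cardc N_def)
    show "\<bar>\<Sum>i\<in>UNIV. x $ i * X n i x\<bar> \<le> N * (N - 1) / 2" for n x
    proof -
      have "(\<Sum>i\<in>UNIV. \<Sum>j\<in>-{i}. (x $ i - x $ j) * soft_recip n (x $ i - x $ j)) \<le> (\<Sum>i\<in>(UNIV::'n set). \<Sum>j\<in>-{i}. 1)"
        by (intro sum_mono soft_recip_mult_bounds)
      moreover have "(\<Sum>i\<in>UNIV. \<Sum>j\<in>-{i}. (x $ i - x $ j) * soft_recip n (x $ i - x $ j)) \<ge> 0"
        by (intro sum_nonneg soft_recip_mult_bounds)
      ultimately show ?thesis unfolding sP prod1 by simp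
    qed
    show "AE x in lborel. (\<lambda>n. \<Sum>i\<in>UNIV. DX n i x + (X n i x)\<^sup>2) \<longlonglongrightarrow> 0"
      using AE
    proof eventually_elim
      case (elim x)
      have nz: "x $ i - x $ j \<noteq> 0" if "j \<in> - {i}" for i j using elim that by (auto simp: inj_eq)
      have "(\<lambda>n. \<Sum>i\<in>UNIV. DX n i x + (X n i x)\<^sup>2) \<longlonglongrightarrow>
         (\<Sum>i\<in>UNIV. (\<Sum>j\<in>-{i}. - (1 / (x $ i - x $ j))\<^sup>2)
           + (\<Sum>j\<in>-{i}. \<Sum>l\<in>-{i}. (1 / (x $ i - x $ j)) * (1 / (x $ i - x $ l))))"
        unfolding DX_def X2 by (intro tendsto_intros soft_recip_tendsto nz)
      then show ?case
        unfolding sum.distrib[of _ _ UNIV] sum_negf sum_cyclic_reciprocals_zero[OF elim]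
        by (simp add: sum.distrib)
    qed
    show "AE x in lborel. (\<lambda>n. \<Sum>i\<in>UNIV. x $ i * X n i x) \<longlonglongrightarrow> real CARD('n) * (real CARD('n) - 1) / 2"
      using AE
    proof eventually_elim
      case (elim x)
      have nz: "x $ i - x $ j \<noteq> 0" if "j \<in> - {i}" for i j using elim that by (auto simp: inj_eq)
      have "(\<lambda>n. (\<Sum>i\<in>UNIV. \<Sum>j\<in>-{i}. (x $ i - x $ j) * soft_recip n (x $ i - x $ j)) / 2) \<longlonglongrightarrow>
         (\<Sum>i\<in>UNIV. \<Sum>j\<in>-{i}. (x $ i - x $ j) * (1 / (x $ i - x $ j))) / 2"
        by (intro tendsto_intros soft_recip_tendsto nz) auto
      also have "(\<Sum>i\<in>UNIV. \<Sum>j\<in>-{i}. (x $ i - x $ j) * (1 / (x $ i - x $ j))) = (\<Sum>i\<in>(UNIV::'n set). \<Sum>j\<in>-{i}. 1)"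
        using nz by (intro sum.cong refl) auto
      finally show ?case unfolding sP prod1 by (simp add: N_def)
    qed
  qed (use smooth1D[OF sm] in auto)
qed


section \<open>Odd functions by decomposition into parities\<close>

lemma integral_reflect:
  fixes F :: "real^'n::finite \<Rightarrow> real"
  assumes "F \<in> borel_measurable borel"
  shows "(LBINT x. F (reflect J x)) = (LBINT x. F x)"
  unfolding reflect_def by (rule integral_signed_perm[OF _ bij_id assms]) auto

lemma norm_reflect: "norm (reflect J x) = norm x"
  unfolding reflect_def by (rule norm_signed_perm[OF _ bij_id]) auto

lemma reflect_diff: "reflect J x - reflect J y = reflect J (x - y)"
  by (simp add: vec_eq_iff reflect_nth)

lemma continuous_reflect: "continuous_on UNIV F \<Longrightarrow> continuous_on UNIV (\<lambda>x. F (reflect J x))"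
  for F :: "real^'n::finite \<Rightarrow> real"
  by (rule continuous_on_compose2[of UNIV F]) (auto simp: reflect_def signed_perm_def intro!: continuous_intros)

lemma has_pd_reflect:
  assumes "has_pd i U G"
  shows "has_pd i (\<lambda>x. U (reflect J x)) (\<lambda>x. (if i \<in> J then -1 else 1) * G (reflect J x))"
  unfolding has_pd_def
proof
  fix x
  define s :: real where "s = (if i \<in> J then -1 else 1)"
  have e: "reflect J (x + t *\<^sub>R axis i 1) = reflect J x + (s * t) *\<^sub>R axis i 1" for t
    by (simp add: vec_eq_iff reflect_nth axis_def s_def)
  have "((\<lambda>r. U (reflect J x + r *\<^sub>R axis i 1)) has_real_derivative G (reflect J x)) (at (s * 0))"
    using assms by (simp add: has_pd_def)
  moreover have "((\<lambda>t. s * t) has_real_derivative s) (at 0)"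
    by (auto intro!: derivative_eq_intros)
  ultimately have "((\<lambda>t. U (reflect J x + (s * t) *\<^sub>R axis i 1)) has_real_derivative G (reflect J x) * s) (at 0)"
    by (rule DERIV_chain2)
  then show "((\<lambda>t. U (reflect J (x + t *\<^sub>R axis i 1))) has_real_derivative (if i \<in> J then -1 else 1) * G (reflect J x)) (at 0)"
    by (simp add: e s_def mult.commute)
qed

lemma smooth1_reflect_average:
  fixes U :: "real^'n::finite \<Rightarrow> real"
  assumes sm: "smooth1 U G"
  shows "smooth1 (\<lambda>x. (1/2) * U x + c * U (reflect J x))
     (\<lambda>i x. (1/2) * G i x + c * ((if i \<in> J then -1 else 1) * G i (reflect J x)))"
  unfolding smooth1_def
proof (intro conjI allI)
  obtain L where L: "L-lipschitz_on UNIV U" using smooth1D(1)[OF sm] by blast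
  have "L-lipschitz_on UNIV (\<lambda>x. U (reflect J x))"
  proof (rule lipschitz_onI)
    show "dist (U (reflect J x)) (U (reflect J y)) \<le> L * dist x y" for x y
      using lipschitz_onD[OF L, of "reflect J x" "reflect J y"] by (simp add: dist_norm reflect_diff norm_reflect)
  qed (rule lipschitz_on_nonneg[OF L])
  from lipschitz_on_add[OF lipschitz_on_cmult_real[OF L, of "1/2"] lipschitz_on_cmult_real[OF this, of c]]
  show "\<exists>L. L-lipschitz_on UNIV (\<lambda>x. (1/2) * U x + c * U (reflect J x))" by blast
  show "has_pd i (\<lambda>x. (1/2) * U x + c * U (reflect J x))
     (\<lambda>x. (1/2) * G i x + c * ((if i \<in> J then -1 else 1) * G i (reflect J x)))" for i
    by (intro has_pd_add has_pd_cmult has_pd_reflect smooth1D[OF sm])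
  show "continuous_on UNIV (\<lambda>x. (1/2) * G i x + c * ((if i \<in> J then -1 else 1) * G i (reflect J x)))" for i
    by (intro continuous_intros continuous_reflect smooth1D[OF sm])
qed

lemma continuous_hardy_potential:
  assumes "radial_weight R w w1 y y1"
  shows "continuous_on UNIV (\<lambda>x::real^'n::finite. hardy_potential d k w w1 y y1 (x \<bullet> x))"
  unfolding hardy_potential_def
  by (intro continuous_intros continuous_radial[OF radial_weightD(4)[OF assms]]
    continuous_radial[OF radial_weightD(5)[OF assms]] continuous_radial[OF radial_weightD(6)[OF assms]]
    continuous_radial[OF radial_weightD(7)[OF assms]])

text \<open>The parallelogram law, applied to \<open>U\<close> and to each component of its gradient, together with the invariance of the
  weights under reflections: both sides of the inequality are additive over the odd and the even
  part.\<close>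

lemma hardy_ineq_parity_split:
  fixes U :: "real^'n::finite \<Rightarrow> real"
  assumes sm: "smooth1 U G"
    and m: "hardy_ineq k (\<lambda>x. (1/2) * U x + (-1/2) * U (reflect J x))
      (\<lambda>i x. (1/2) * G i x + (-1/2) * ((if i \<in> J then -1 else 1) * G i (reflect J x)))"
    and p: "hardy_ineq k (\<lambda>x. (1/2) * U x + (1/2) * U (reflect J x))
      (\<lambda>i x. (1/2) * G i x + (1/2) * ((if i \<in> J then -1 else 1) * G i (reflect J x)))"
  shows "hardy_ineq k U G"
  unfolding hardy_ineq_def
proof (intro allI impI)
  fix R w w1 y y1 assume R: "R > 0" and rw: "radial_weight R w w1 y y1"
  note rwD = radial_weightD[OF rw]
  define \<kappa> where "\<kappa> = (\<lambda>x::real^'n. hardy_potential CARD('n) k w w1 y y1 (x \<bullet> x))"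
  define W where "W = (\<lambda>x::real^'n. w (x \<bullet> x))"
  have c\<kappa>: "continuous_on UNIV \<kappa>" unfolding \<kappa>_def by (rule continuous_hardy_potential[OF rw])
  have cW: "continuous_on UNIV W" unfolding W_def by (intro continuous_radial rwD)
  have inner_reflect: "reflect J x \<bullet> reflect J x = x \<bullet> x" for x :: "real^'n"
    by (simp add: dot_square_norm norm_reflect)
  have z: "\<forall>x. norm x > R \<longrightarrow> \<kappa> x = 0" "\<forall>x. norm x > R \<longrightarrow> W x = 0"
    by (simp_all add: \<kappa>_def W_def hardy_potential_def rwD(8,9)[OF norm_gt_inner[OF R]])
  have inv: "\<kappa> (reflect J x) = \<kappa> x" "W (reflect J x) = W x" for x by (simp_all add: \<kappa>_def W_def inner_reflect)
  have split: "(LBINT x. A x * ((1/2) * F x + (-1/2) * (\<epsilon> * F (reflect J x)))\<^sup>2)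
       + (LBINT x. A x * ((1/2) * F x + (1/2) * (\<epsilon> * F (reflect J x)))\<^sup>2) = (LBINT x. A x * (F x)\<^sup>2)"
    and int: "integrable lborel (\<lambda>x. A x * ((1/2) * F x + (-1/2) * (\<epsilon> * F (reflect J x)))\<^sup>2)"
      "integrable lborel (\<lambda>x. A x * ((1/2) * F x + (1/2) * (\<epsilon> * F (reflect J x)))\<^sup>2)"
      "integrable lborel (\<lambda>x. A x * (F x)\<^sup>2)"
    if A: "continuous_on UNIV A" "\<forall>x. norm x > R \<longrightarrow> A x = 0" "\<And>x. A (reflect J x) = A x"
      and F: "continuous_on UNIV F" and e: "\<epsilon> = 1 \<or> \<epsilon> = -1" for A F :: "real^'n \<Rightarrow> real" and \<epsilon> :: real
  proof -
    show i: "integrable lborel (\<lambda>x. A x * ((1/2) * F x + (-1/2) * (\<epsilon> * F (reflect J x)))\<^sup>2)"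
      "integrable lborel (\<lambda>x. A x * ((1/2) * F x + (1/2) * (\<epsilon> * F (reflect J x)))\<^sup>2)"
      "integrable lborel (\<lambda>x. A x * (F x)\<^sup>2)"
      by (rule integrable_continuous_cball[where R=R],
        intro continuous_intros continuous_reflect F A(1), simp add: A(2))+
    have i4: "integrable lborel (\<lambda>x. A x * (F (reflect J x))\<^sup>2)"
      by (rule integrable_continuous_cball[where R=R],
        intro continuous_intros continuous_reflect F A(1), simp add: A(2))
    have "(LBINT x. A x * ((1/2) * F x + (-1/2) * (\<epsilon> * F (reflect J x)))\<^sup>2)
       + (LBINT x. A x * ((1/2) * F x + (1/2) * (\<epsilon> * F (reflect J x)))\<^sup>2)
       = (LBINT x. (1/2) * (A x * (F x)\<^sup>2) + (1/2) * (A x * (F (reflect J x))\<^sup>2))"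
      unfolding Bochner_Integration.integral_add[OF i(1,2), symmetric]
      proof (rule Bochner_Integration.integral_cong[OF refl])
      fix x
      have "(\<epsilon> * F (reflect J x))\<^sup>2 = (F (reflect J x))\<^sup>2" using e by (auto simp: power_mult_distrib)
      moreover have "a * ((1/2) * f + (-1/2) * g)\<^sup>2 + a * ((1/2) * f + (1/2) * g)\<^sup>2
          = (1/2) * (a * f\<^sup>2) + (1/2) * (a * g\<^sup>2)" for a f g :: real
        by (simp add: power2_eq_square algebra_simps)
      ultimately show "A x * ((1/2) * F x + (-1/2) * (\<epsilon> * F (reflect J x)))\<^sup>2 + A x * ((1/2) * F x + (1/2) * (\<epsilon> * F (reflect J x)))\<^sup>2
        = (1/2) * (A x * (F x)\<^sup>2) + (1/2) * (A x * (F (reflect J x))\<^sup>2)"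
        by (simp only:)
    qed
    also have "\<dots> = (1/2) * (LBINT x. A x * (F x)\<^sup>2) + (1/2) * (LBINT x. A x * (F (reflect J x))\<^sup>2)"
      using i(3) i4 by simp
    also have "(LBINT x. A x * (F (reflect J x))\<^sup>2) = (LBINT x. A x * (F x)\<^sup>2)"
    proof -
      have "continuous_on UNIV (\<lambda>x. A x * (F x)\<^sup>2)" by (intro continuous_intros A F)
      from integral_reflect[OF borel_measurable_continuous_onI[OF this], of J] show ?thesis by (simp add: A(3))
    qed
    finally show "(LBINT x. A x * ((1/2) * F x + (-1/2) * (\<epsilon> * F (reflect J x)))\<^sup>2)
       + (LBINT x. A x * ((1/2) * F x + (1/2) * (\<epsilon> * F (reflect J x)))\<^sup>2) = (LBINT x. A x * (F x)\<^sup>2)" by simp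
  qed
  let ?s = "\<lambda>i. if i \<in> J then - 1 else (1::real)"
  have s: "?s i = 1 \<or> ?s i = -1" for i by auto
  have splitG: "(LBINT x. W x * ((1/2) * G i x + (-1/2) * (?s i * G i (reflect J x)))\<^sup>2)
       + (LBINT x. W x * ((1/2) * G i x + (1/2) * (?s i * G i (reflect J x)))\<^sup>2)
       = (LBINT x. W x * (G i x)\<^sup>2)" for i
    by (rule split[OF cW z(2) inv(2) smooth1D(3)[OF sm, of i] s[of i]])
  have intG: "integrable lborel (\<lambda>x. W x * ((1/2) * G i x + (-1/2) * (?s i * G i (reflect J x)))\<^sup>2)"
    "integrable lborel (\<lambda>x. W x * ((1/2) * G i x + (1/2) * (?s i * G i (reflect J x)))\<^sup>2)"
    "integrable lborel (\<lambda>x. W x * (G i x)\<^sup>2)" for i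
    by (rule int[OF cW z(2) inv(2) smooth1D(3)[OF sm, of i] s[of i]])+
  have "(LBINT x. \<kappa> x * (U x)\<^sup>2) = (LBINT x. \<kappa> x * ((1/2) * U x + (-1/2) * U (reflect J x))\<^sup>2)
       + (LBINT x. \<kappa> x * ((1/2) * U x + (1/2) * U (reflect J x))\<^sup>2)"
    using split[OF c\<kappa> z(1) inv(1) smooth1D(4)[OF sm], of 1] unfolding mult_1_left by simp
  also have "\<dots> \<le> (LBINT x. W x * (\<Sum>i\<in>UNIV. ((1/2) * G i x + (-1/2) * (?s i * G i (reflect J x)))\<^sup>2))
       + (LBINT x. W x * (\<Sum>i\<in>UNIV. ((1/2) * G i x + (1/2) * (?s i * G i (reflect J x)))\<^sup>2))"
    unfolding \<kappa>_def W_def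
    by (rule add_mono[OF m[unfolded hardy_ineq_def, rule_format, OF R rw] p[unfolded hardy_ineq_def, rule_format, OF R rw]])
  also have "\<dots> = (\<Sum>i\<in>UNIV. (LBINT x. W x * ((1/2) * G i x + (-1/2) * (?s i * G i (reflect J x)))\<^sup>2))
       + (\<Sum>i\<in>UNIV. (LBINT x. W x * ((1/2) * G i x + (1/2) * (?s i * G i (reflect J x)))\<^sup>2))"
    by (simp only: sum_distrib_left Bochner_Integration.integral_sum[OF intG(1)] Bochner_Integration.integral_sum[OF intG(2)])
  also have "\<dots> = (\<Sum>i\<in>UNIV. (LBINT x. W x * (G i x)\<^sup>2))"
    by (simp only: sum.distrib[symmetric] splitG)
  also have "\<dots> = (LBINT x. W x * (\<Sum>i\<in>UNIV. (G i x)\<^sup>2))"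
    by (simp only: sum_distrib_left Bochner_Integration.integral_sum[OF intG(3)])
  finally show "(LBINT x. hardy_potential CARD('n) k w w1 y y1 (x \<bullet> x) * (U x)\<^sup>2)
       \<le> (LBINT x. w (x \<bullet> x) * (\<Sum>i\<in>UNIV. (G i x)\<^sup>2))"
    unfolding \<kappa>_def W_def .
qed

lemma reflect_commute: "reflect I (reflect J x) = reflect J (reflect I x)"
  by (simp add: vec_eq_iff reflect_nth)

lemma reflect_reflect: "reflect J (reflect J x) = x"
  by (simp add: vec_eq_iff reflect_nth)

lemma reflect_minus: "reflect J (- x) = - reflect J x"
  by (simp add: vec_eq_iff reflect_nth)

lemma reflect_insert: "i \<notin> J \<Longrightarrow> reflect (insert i J) x = reflect {i} (reflect J x)"
  by (simp add: vec_eq_iff reflect_nth)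

lemma hardy_ineq_zero: "hardy_ineq k (\<lambda>x. 0) G"
  unfolding hardy_ineq_def
proof (intro allI impI)
  fix R w w1 y y1 assume rw: "radial_weight R w w1 y y1"
  have "0 \<le> (LBINT x. w (x \<bullet> x) * (\<Sum>i\<in>UNIV. (G i x)\<^sup>2))"
    by (intro integral_nonneg_AE AE_I2 mult_nonneg_nonneg sum_nonneg radial_weightD(1)[OF rw]) auto
  then show "(LBINT x. hardy_potential CARD('a) k w w1 y y1 (x \<bullet> x) * 0\<^sup>2)
      \<le> (LBINT x. w (x \<bullet> x) * (\<Sum>i\<in>UNIV. (G i x)\<^sup>2))" by simp
qed

lemma reflect_invariant:
  assumes "\<And>i x. U (reflect {i} x) = U x"
  shows "U (reflect J x) = U x"
proof -
  have "finite J" by simp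
  then show ?thesis
  proof (induction J)
    case empty
    have "reflect {} x = x" by (simp add: vec_eq_iff reflect_nth)
    then show ?case by simp
  next
    case (insert i J)
    have "U (reflect (insert i J) x) = U (reflect {i} (reflect J x))" by (simp only: reflect_insert[OF insert.hyps(2)])
    also have "\<dots> = U (reflect J x)" by (rule assms)
    also have "\<dots> = U x" by (rule insert.IH)
    finally show ?case .
  qed
qed

text \<open>Coordinates are split one by one. When none is left, \<open>U\<close> is even in every coordinate, hence
  \<open>U (- x) = U x\<close>, and oddness forces \<open>U = 0\<close>.\<close>

lemma hardy_ineq_odd_even_off:
  fixes U :: "real^'n::finite \<Rightarrow> real"
  assumes "finite J" "smooth1 U G" "\<And>x. U (- x) = - U x"
    "\<And>i x. i \<notin> J \<Longrightarrow> U (reflect {i} x) = U x"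
  shows "hardy_ineq 1 U G"
  using assms
proof (induction J arbitrary: U G rule: finite_induct)
  case empty
  have "U x = 0" for x
  proof -
    have "reflect UNIV x = - x" by (simp add: vec_eq_iff reflect_nth)
    then have "U (- x) = U x" using reflect_invariant[of U UNIV x] empty.prems(3) by simp
    then show ?thesis using empty.prems(2)[of x] by linarith
  qed
  then have "U = (\<lambda>x. 0)" by auto
  then show ?case by (simp only: hardy_ineq_zero)
next
  case (insert i J)
  note prem = insert.prems
  note IH = insert.IH
  show ?case
  proof (rule hardy_ineq_parity_split[where J="{i}"])
    show "hardy_ineq 1 (\<lambda>x. (1/2) * U x + (-1/2) * U (reflect {i} x))
      (\<lambda>j x. (1/2) * G j x + (-1/2) * ((if j \<in> {i} then -1 else 1) * G j (reflect {i} x)))"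
    proof (rule hardy_ineq_reflection_odd[where i=i, OF smooth1_reflect_average[OF prem(1)]])
      show "(1/2) * U (reflect {i} x) + (-1/2) * U (reflect {i} (reflect {i} x)) = - ((1/2) * U x + (-1/2) * U (reflect {i} x))" for x
        unfolding reflect_reflect by linarith
    qed
    show "hardy_ineq 1 (\<lambda>x. (1/2) * U x + (1/2) * U (reflect {i} x))
      (\<lambda>j x. (1/2) * G j x + (1/2) * ((if j \<in> {i} then -1 else 1) * G j (reflect {i} x)))"
    proof (rule IH[OF smooth1_reflect_average[OF prem(1)]])
      show "(1/2) * U (- x) + (1/2) * U (reflect {i} (- x)) = - ((1/2) * U x + (1/2) * U (reflect {i} x))" for x
        unfolding reflect_minus using prem(2)[of x] prem(2)[of "reflect {i} x"] by linarith
      show "(1/2) * U (reflect {l} x) + (1/2) * U (reflect {i} (reflect {l} x)) = (1/2) * U x + (1/2) * U (reflect {i} x)"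
        if "l \<notin> J" for l x
      proof (cases "l = i")
        case True then show ?thesis unfolding True reflect_reflect by linarith
      next
        case False
        then have "l \<notin> insert i J" using that by simp
        from prem(3)[OF this, of x] prem(3)[OF this, of "reflect {i} x"]
        show ?thesis unfolding reflect_commute[of "{i}" "{l}"] by linarith
      qed
    qed
  qed (rule prem)
qed

lemma hardy_ineq_odd:
  fixes U :: "real^'n::finite \<Rightarrow> real"
  assumes "smooth1 U G" "\<And>x. U (- x) = - U x"
  shows "hardy_ineq 1 U G"
  by (rule hardy_ineq_odd_even_off[of UNIV]) (use assms in auto)


section \<open>The Rellich inequality for smooth functions\<close>

lemma DERIV_max_power:
  "((\<lambda>z::real. (max 0 z) ^ Suc (Suc n)) has_real_derivative real (Suc (Suc n)) * (max 0 z) ^ Suc n) (at z)"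
proof -
  consider "z > 0" | "z < 0" | "z = 0" by linarith
  then show ?thesis
  proof cases
    case 1
    then have "eventually (\<lambda>t. t ^ Suc (Suc n) = (max 0 t) ^ Suc (Suc n)) (nhds z)"
      using eventually_nhds_in_open[of "{0<..}" z] by (auto elim!: eventually_mono)
    moreover have "((\<lambda>t. t ^ Suc (Suc n)) has_real_derivative real (Suc (Suc n)) * z ^ Suc n) (at z)"
      using DERIV_pow[of "Suc (Suc n)" z UNIV] by simp
    ultimately show ?thesis using 1 DERIV_cong_ev[OF refl _ refl] by fastforce
  next
    case 2
    then have "eventually (\<lambda>t. 0 = (max 0 t) ^ Suc (Suc n)) (nhds z)"
      using eventually_nhds_in_open[of "{..<0}" z] by (auto elim!: eventually_mono)
    moreover have "((\<lambda>t. 0) has_real_derivative 0) (at z)" by simp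
    ultimately show ?thesis using 2 DERIV_cong_ev[OF refl _ refl] by fastforce
  next
    case 3
    have "((\<lambda>h::real. (max 0 h) ^ Suc (Suc n) / h) \<longlongrightarrow> 0) (at 0)"
    proof (rule Lim_null_comparison)
      show "eventually (\<lambda>h::real. norm ((max 0 h) ^ Suc (Suc n) / h) \<le> \<bar>h\<bar> ^ Suc n) (at 0)"
      proof (intro always_eventually allI)
        fix h :: real
        show "norm ((max 0 h) ^ Suc (Suc n) / h) \<le> \<bar>h\<bar> ^ Suc n"
          by (cases "h \<le> 0") (simp_all add: max_absorb1 max_absorb2 abs_divide del: power_Suc, simp)
      qed
      have "((\<lambda>h::real. \<bar>h\<bar> ^ Suc n) \<longlongrightarrow> \<bar>0\<bar> ^ Suc n) (at 0)" by (intro tendsto_intros)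
      then show "((\<lambda>h::real. \<bar>h\<bar> ^ Suc n) \<longlongrightarrow> 0) (at 0)" by simp
    qed
    then show ?thesis using 3 by (simp add: has_field_derivative_iff)
  qed
qed

text \<open>The computation that singles out \<open>m = s (s + 2)\<close>. Here \<open>p = 1 / (t + \<delta>)\<close>, and \<open>c\<close> is a cut-off
  with derivatives \<open>c1\<close> and \<open>c2\<close>. The left-hand side is the Hardy potential minus half the Laplacian of the
  weight \<open>c p\<close>. Once \<open>d + 2 k = 2 (s + 2)\<close> is
  inserted, the terms in \<open>c\<close> and \<open>c1\<close> other than \<open>m c p^2\<close> contain the nonnegative factor \<open>1 - t p\<close>, and only the term in \<open>c2\<close> has the wrong sign.\<close>

lemma rellich_weight_inequality:
  fixes c c1 c2 p t s k d m :: real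
  assumes d: "d + 2 * k = 2 * (s + 2)" and m: "m = s * (s + 2)" and tp: "0 \<le> t * p" "t * p \<le> 1"
    and c: "c \<ge> 0" "c1 \<le> 0" "p \<ge> 0" "s \<ge> 0" "2 * c2 \<le> e" "c2 \<ge> 0"
    and w1: "w1 = c1 * p - c * p\<^sup>2" and w2: "w2 = c2 * p - 2 * c1 * p\<^sup>2 + 2 * c * p ^ 3"
  shows "- (2 * w1 * (k + t * (- s * p)) + c * p * (d * (- s * p) + 2 * t * (s * p\<^sup>2)
      + t * (- s * p)\<^sup>2 + 2 * k * (- s * p))) - (d * w1 + 2 * t * w2) \<ge> m * (c * p\<^sup>2) - e"
proof -
  have d': "d = 2 * (s + 2) - 2 * k" using d by simp
  have "- (2 * w1 * (k + t * (- s * p)) + c * p * (d * (- s * p) + 2 * t * (s * p\<^sup>2)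
      + t * (- s * p)\<^sup>2 + 2 * k * (- s * p))) - (d * w1 + 2 * t * w2)
    = m * (c * p\<^sup>2) + c * p\<^sup>2 * (s + 2)\<^sup>2 * (1 - t * p) + 2 * p * (- c1) * (s + 2) * (1 - t * p) - (t * p) * (2 * c2)"
    unfolding w1 w2 m d' by (simp add: power2_eq_square power3_eq_cube algebra_simps)
  moreover have "c * p\<^sup>2 * (s + 2)\<^sup>2 * (1 - t * p) \<ge> 0" "2 * p * (- c1) * (s + 2) * (1 - t * p) \<ge> 0"
    by (intro mult_nonneg_nonneg; use tp c in simp)+
  moreover have "(t * p) * (2 * c2) \<le> 1 * e" using tp c by (intro mult_mono) auto
  ultimately show ?thesis by linarith
qed

text \<open>The third power is the lowest one for which the cut-off is twice continuously differentiable; it is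
  also nonincreasing and convex on \<open>t \<ge> 0\<close>. Its second derivative is at most \<open>6 / R^4\<close>.\<close>

lemma rellich_cutoff:
  fixes U :: "real^'n::finite \<Rightarrow> real"
  assumes H: "hardy_ineq k U G"
    and pd: "\<And>i. has_pd i U (G i)" "\<And>i. has_pd i (G i) (H i)"
    and c: "continuous_on UNIV U" "\<And>i. continuous_on UNIV (G i)" "\<And>i. continuous_on UNIV (H i)"
    and R: "R > 0" and \<delta>: "\<delta> > 0" and s: "s > 0" "real CARD('n) + 2 * k = 2 * (s + 2)"
    and m: "m = s * (s + 2)"
    and iU: "integrable lborel (\<lambda>x. (U x)\<^sup>2)"
    and iH: "integrable lborel (\<lambda>x. (\<Sum>i\<in>UNIV. H i x)\<^sup>2)"
  shows "(LBINT x. (max 0 (1 - (x \<bullet> x) / R\<^sup>2)) ^ 3 / (x \<bullet> x + \<delta>)\<^sup>2 * (U x)\<^sup>2)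
      \<le> (LBINT x. (\<Sum>i\<in>UNIV. H i x)\<^sup>2) / m\<^sup>2 + 24 / (m * R ^ 4) * (LBINT x. (U x)\<^sup>2)"
proof -
  define z where "z = (\<lambda>t::real. max 0 (1 - t / R\<^sup>2))"
  define c0 where "c0 = (\<lambda>t. (z t) ^ 3)"
  define c1 where "c1 = (\<lambda>t. - 3 / R\<^sup>2 * (z t)\<^sup>2)"
  define c2 where "c2 = (\<lambda>t. 6 / R ^ 4 * z t)"
  define p where "p = (\<lambda>t::real. 1 / (t + \<delta>))"
  define w where "w = (\<lambda>t. c0 t * p t)"
  define w1 where "w1 = (\<lambda>t. c1 t * p t - c0 t * (p t)\<^sup>2)"
  define w2 where "w2 = (\<lambda>t. c2 t * p t - 2 * c1 t * (p t)\<^sup>2 + 2 * c0 t * (p t) ^ 3)"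
  define y where "y = (\<lambda>t. - s * p t)"
  define y1 where "y1 = (\<lambda>t. s * (p t)\<^sup>2)"
  have m0: "m > 0" using s m by simp
  have dz: "((\<lambda>t. 1 - t / R\<^sup>2) has_real_derivative - 1 / R\<^sup>2) (at t)" for t
    using DERIV_diff[OF DERIV_const[of 1] DERIV_cdivide[OF DERIV_ident, where c="R\<^sup>2"]] by simp
  have dc0: "(c0 has_real_derivative c1 t) (at t)" for t
  proof -
    have "((\<lambda>t. (max 0 (1 - t / R\<^sup>2)) ^ Suc (Suc 1)) has_real_derivative
        real (Suc (Suc 1)) * (max 0 (1 - t / R\<^sup>2)) ^ Suc 1 * (- 1 / R\<^sup>2)) (at t)"
      by (rule DERIV_chain2[OF DERIV_max_power dz])
    then show ?thesis by (simp add: c0_def c1_def z_def numeral_3_eq_3 power2_eq_square)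
  qed
  have dc1: "(c1 has_real_derivative c2 t) (at t)" for t
  proof -
    have "((\<lambda>t. (max 0 (1 - t / R\<^sup>2)) ^ Suc (Suc 0)) has_real_derivative
        real (Suc (Suc 0)) * (max 0 (1 - t / R\<^sup>2)) ^ Suc 0 * (- 1 / R\<^sup>2)) (at t)"
      by (rule DERIV_chain2[OF DERIV_max_power dz])
    moreover have "- 3 / R\<^sup>2 * (real (Suc (Suc 0)) * (max 0 (1 - t / R\<^sup>2)) ^ Suc 0 * (- 1 / R\<^sup>2)) = c2 t"
      by (simp add: c2_def z_def power2_eq_square power4_eq_xxxx)
    ultimately show ?thesis
      unfolding c1_def z_def power2_eq_square[of "max _ _"] using DERIV_cmult[of _ _ t UNIV "- 3 / R\<^sup>2"] by fastforce
  qed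
  have dp: "(p has_real_derivative - (p t)\<^sup>2) (at t)" if "t \<ge> 0" for t
    using that \<delta> unfolding p_def
    by (auto intro!: derivative_eq_intros simp: power2_eq_square divide_simps)
  have dw: "(w has_real_derivative w1 t) (at t)" if "t \<ge> 0" for t
    unfolding w_def w1_def
    by (rule derivative_eq_intros dc0 dp[OF that] refl)+ (simp add: algebra_simps)
  have dw1: "(w1 has_real_derivative w2 t) (at t)" if "t \<ge> 0" for t
    unfolding w1_def w2_def
    by (rule derivative_eq_intros dc0 dc1 dp[OF that] refl)+
      (simp add: algebra_simps power2_eq_square power3_eq_cube)
  have dy: "(y has_real_derivative y1 t) (at t)" if "t \<ge> 0" for t
    unfolding y_def y1_def
    by (rule derivative_eq_intros dp[OF that] refl)+ (simp add: algebra_simps)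
  have cz: "continuous_on S z" for S unfolding z_def by (intro continuous_intros) (use R in auto)
  have cp: "continuous_on {0..} p"
    using dp by (intro continuous_on_DERIV[of "{0..}" p "\<lambda>t. - (p t)\<^sup>2"]) auto
  have cw: "continuous_on {0..} w1" "continuous_on {0..} w2" "continuous_on {0..} y1"
    unfolding w1_def w2_def y1_def c0_def c1_def c2_def by (intro continuous_intros cz cp)+
  have zR: "z t = 0" if "t > R\<^sup>2" for t using that R by (simp add: z_def)
  have z0: "z t \<ge> 0" for t by (simp add: z_def)
  have z1: "z t \<le> 1" if "t \<ge> 0" for t using that by (simp add: z_def)
  have p0: "p t > 0" if "t \<ge> 0" for t using that \<delta> by (simp add: p_def)
  have rw: "radial_weight R w w1 y y1"
    unfolding radial_weight_def using dw dy cw zR z0 p0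
    by (auto simp: w_def w1_def c0_def c1_def less_imp_le)
  have w2z: "w2 t = 0" if "t > R\<^sup>2" for t using zR[OF that] by (simp add: w2_def c0_def c1_def c2_def)
  define e where "e = 12 / R ^ 4"
  define L where "L = (\<lambda>x. \<Sum>i\<in>UNIV. H i x)"
  define \<kappa> where "\<kappa> = (\<lambda>x::real^'n. hardy_potential CARD('n) k w w1 y y1 (x \<bullet> x))"
  define v where "v = (\<lambda>x::real^'n. CARD('n) * w1 (x \<bullet> x) + 2 * (x \<bullet> x) * w2 (x \<bullet> x))"
  define B where "B = (\<lambda>x::real^'n. c0 (x \<bullet> x) * (p (x \<bullet> x))\<^sup>2)"
  have low: "\<kappa> x - v x \<ge> m * B x - e" for x
    unfolding \<kappa>_def v_def hardy_potential_def B_def y_def y1_def w_def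
  proof (rule rellich_weight_inequality[OF s(2) m])
    let ?t = "x \<bullet> x"
    have t: "?t \<ge> 0" by simp
    show "0 \<le> ?t * p ?t" "?t * p ?t \<le> 1" using add_nonneg_pos[OF t \<delta>] \<delta> by (simp_all add: p_def divide_le_eq)
    show "0 \<le> c0 ?t" "c1 ?t \<le> 0" "0 \<le> p ?t" "0 \<le> s" "0 \<le> c2 ?t"
      using z0 p0[OF t] s by (simp_all add: c0_def c1_def c2_def less_imp_le)
    show "2 * c2 ?t \<le> e" using z1[OF t] R by (simp add: c2_def e_def divide_right_mono)
  qed (simp_all add: w1_def w2_def)
  have cL: "continuous_on UNIV L" unfolding L_def by (intro continuous_intros c)
  have cv: "continuous_on UNIV v" unfolding v_def
    by (intro continuous_intros continuous_radial cw)
  have cW: "continuous_on UNIV (\<lambda>x::real^'n. w (x \<bullet> x))" by (rule continuous_radial[OF radial_weightD(4)[OF rw]])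
  have c\<kappa>: "continuous_on UNIV \<kappa>" unfolding \<kappa>_def by (rule continuous_hardy_potential[OF rw])
  have cB: "continuous_on UNIV B" unfolding B_def c0_def
    by (intro continuous_intros continuous_radial[OF cz] continuous_radial[OF cp])
  have zero: "\<kappa> x = 0" "v x = 0" "w (x \<bullet> x) = 0" "B x = 0" if "norm x > R" for x
    using zR[OF norm_gt_inner[OF R that]] w2z[OF norm_gt_inner[OF R that]]
    by (simp_all add: \<kappa>_def v_def hardy_potential_def w_def w1_def c0_def c1_def B_def)
  have i\<kappa>: "integrable lborel (\<lambda>x. \<kappa> x * (U x)\<^sup>2)"
    by (rule integrable_continuous_cball[where R=R]) (use zero in \<open>auto intro!: continuous_intros c\<kappa> c\<close>)
  have iv: "integrable lborel (\<lambda>x. (U x)\<^sup>2 * v x)"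
    by (rule integrable_continuous_cball[where R=R]) (use zero in \<open>auto intro!: continuous_intros cv c\<close>)
  have iW: "integrable lborel (\<lambda>x. w (x \<bullet> x) * (U x * L x))"
    by (rule integrable_continuous_cball[where R=R]) (use zero in \<open>auto intro!: continuous_intros cW cL c\<close>)
  have iB: "integrable lborel (\<lambda>x. B x * (U x)\<^sup>2)"
    by (rule integrable_continuous_cball[where R=R]) (use zero in \<open>auto intro!: continuous_intros cB c\<close>)
  have "(LBINT x. \<kappa> x * (U x)\<^sup>2) \<le> (LBINT x. (U x)\<^sup>2 * v x - w (x \<bullet> x) * (U x * L x))"
    using H[unfolded hardy_ineq_def, rule_format, OF R rw]
      integral_by_parts_laplacian[OF pd c R rw dw1 cw(2) w2z]
    by (simp add: \<kappa>_def v_def L_def)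
  then have "(LBINT x. \<kappa> x * (U x)\<^sup>2) - (LBINT x. (U x)\<^sup>2 * v x) + (LBINT x. w (x \<bullet> x) * (U x * L x)) \<le> 0"
    using iv iW by simp
  moreover have "m / 2 * (LBINT x. B x * (U x)\<^sup>2) - e * (LBINT x. (U x)\<^sup>2) - 1 / (2 * m) * (LBINT x. (L x)\<^sup>2)
     = (LBINT x. m / 2 * (B x * (U x)\<^sup>2) - e * (U x)\<^sup>2 - 1 / (2 * m) * (L x)\<^sup>2)"
    using iB iU iH by (simp add: L_def)
  moreover have "\<dots> \<le> (LBINT x. \<kappa> x * (U x)\<^sup>2 - (U x)\<^sup>2 * v x + w (x \<bullet> x) * (U x * L x))"
  proof (rule integral_mono)
    show "integrable lborel (\<lambda>x. m / 2 * (B x * (U x)\<^sup>2) - e * (U x)\<^sup>2 - 1 / (2 * m) * (L x)\<^sup>2)"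
      using iB iU iH by (simp add: L_def)
    show "integrable lborel (\<lambda>x. \<kappa> x * (U x)\<^sup>2 - (U x)\<^sup>2 * v x + w (x \<bullet> x) * (U x * L x))"
      using i\<kappa> iv iW by simp
    fix x :: "real^'n"
    let ?t = "x \<bullet> x"
    have t: "?t \<ge> 0" by simp
    have c01: "0 \<le> c0 ?t" "c0 ?t \<le> 1"
      using z0[of ?t] z1[OF t] by (simp_all add: c0_def power_le_one)
    \<comment> \<open>Young's inequality, with the constant balanced so that half of the main term is absorbed.\<close>
    have "(m * (p ?t * U x) + L x)\<^sup>2 \<ge> 0" by simp
    then have "- (p ?t * U x * L x) \<le> m / 2 * ((p ?t)\<^sup>2 * (U x)\<^sup>2) + 1 / (2 * m) * (L x)\<^sup>2"
      using m0 by (simp add: power2_eq_square field_simps)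
    then have "c0 ?t * - (p ?t * U x * L x) \<le> c0 ?t * (m / 2 * ((p ?t)\<^sup>2 * (U x)\<^sup>2) + 1 / (2 * m) * (L x)\<^sup>2)"
      using c01(1) by (rule mult_left_mono)
    moreover have "c0 ?t * (1 / (2 * m) * (L x)\<^sup>2) \<le> 1 * (1 / (2 * m) * (L x)\<^sup>2)"
      using c01(2) m0 by (intro mult_right_mono) auto
    ultimately have 1: "- (w ?t * (U x * L x)) \<le> m / 2 * (B x * (U x)\<^sup>2) + 1 / (2 * m) * (L x)\<^sup>2"
      by (simp add: w_def B_def algebra_simps)
    have "(m * B x - e) * (U x)\<^sup>2 \<le> (\<kappa> x - v x) * (U x)\<^sup>2"
      using low[of x] by (rule mult_right_mono) simp
    then have "m * (B x * (U x)\<^sup>2) - e * (U x)\<^sup>2 \<le> \<kappa> x * (U x)\<^sup>2 - (U x)\<^sup>2 * v x"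
      by (simp add: algebra_simps)
    with 1 show "m / 2 * (B x * (U x)\<^sup>2) - e * (U x)\<^sup>2 - 1 / (2 * m) * (L x)\<^sup>2
        \<le> \<kappa> x * (U x)\<^sup>2 - (U x)\<^sup>2 * v x + w (x \<bullet> x) * (U x * L x)" by (simp add: field_simps)
  qed
  moreover have "(LBINT x. \<kappa> x * (U x)\<^sup>2 - (U x)\<^sup>2 * v x + w (x \<bullet> x) * (U x * L x)) =
     (LBINT x. \<kappa> x * (U x)\<^sup>2) - (LBINT x. (U x)\<^sup>2 * v x) + (LBINT x. w (x \<bullet> x) * (U x * L x))"
    using i\<kappa> iv iW by simp
  ultimately have fin: "m / 2 * (LBINT x. B x * (U x)\<^sup>2) \<le> e * (LBINT x. (U x)\<^sup>2) + 1 / (2 * m) * (LBINT x. (L x)\<^sup>2)"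
    by linarith
  have "(LBINT x. B x * (U x)\<^sup>2) = 2 / m * (m / 2 * (LBINT x. B x * (U x)\<^sup>2))" using m0 by simp
  also have "\<dots> \<le> 2 / m * (e * (LBINT x. (U x)\<^sup>2) + 1 / (2 * m) * (LBINT x. (L x)\<^sup>2))"
    using fin m0 by (intro mult_left_mono) auto
  also have "\<dots> = (LBINT x. (L x)\<^sup>2) / m\<^sup>2 + 24 / (m * R ^ 4) * (LBINT x. (U x)\<^sup>2)"
    using m0 by (simp add: e_def power2_eq_square field_simps)
  finally show ?thesis by (simp add: B_def L_def c0_def z_def p_def power_divide)
qed


section \<open>Test functions and a smooth radial kernel\<close>

lemma differentiable_compose_at:
  "f differentiable (at x) \<Longrightarrow> g differentiable (at (f x)) \<Longrightarrow> (\<lambda>x. g (f x)) differentiable (at x)"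
  using differentiable_chain_at[of f x g] by (simp add: o_def)

lemma has_pd_partial_deriv:
  assumes "\<And>x. f differentiable (at x)"
  shows "has_pd i f (partial_deriv i f)"
  unfolding has_pd_def
proof
  fix x
  have D: "(f has_derivative frechet_derivative f (at x)) (at (x + 0 *\<^sub>R axis i 1))"
    using assms[of x] frechet_derivative_works by auto
  have l: "linear (frechet_derivative f (at x))"
    using linear_frechet_derivative[OF assms[of x]] .
  have "((\<lambda>t. x + t *\<^sub>R axis i 1) has_derivative (\<lambda>t. t *\<^sub>R axis i 1)) (at (0::real))"
    by (auto intro!: derivative_eq_intros)
  then have "((\<lambda>t. f (x + t *\<^sub>R axis i 1)) has_derivative (\<lambda>t. frechet_derivative f (at x) (t *\<^sub>R axis i 1))) (at 0)"
    using has_derivative_compose[of "\<lambda>t. x + t *\<^sub>R axis i 1" _ 0 UNIV f] D by blast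
  then show "((\<lambda>t. f (x + t *\<^sub>R axis i 1)) has_real_derivative partial_deriv i f x) (at 0)"
    by (simp add: has_field_derivative_def partial_deriv_def linear_scale[OF l] mult_commute_abs)
qed

lemma partial_deriv_eqI:
  assumes "\<And>x. f differentiable (at x)" "has_pd i f f'"
  shows "partial_deriv i f = f'"
  using has_pd_partial_deriv[OF assms(1), of i] assms(2) DERIV_unique
  unfolding has_pd_def by blast

lemma test_function_differentiable: "test_function \<phi> \<Longrightarrow> iterated_partial \<alpha> \<phi> differentiable (at x)"
  by (auto simp: test_function_def differentiable_on_eq_differentiable_at)

lemma test_function_has_pd: "test_function \<phi> \<Longrightarrow> has_pd i \<phi> (partial_deriv i \<phi>)"
  using test_function_differentiable[of \<phi> "[]"] by (intro has_pd_partial_deriv) simp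

lemma test_function_continuous: "test_function \<phi> \<Longrightarrow> continuous_on UNIV \<phi>"
  using test_function_differentiable[of \<phi> "[]"]
  by (auto simp: continuous_on_eq_continuous_at intro!: differentiable_imp_continuous_within)

lemma test_function_support:
  assumes "test_function \<phi>"
  obtains r where "r > 0" "\<And>x. norm x > r \<Longrightarrow> \<phi> x = 0"
proof -
  have "bounded {x. \<phi> x \<noteq> 0}" using assms by (simp add: test_function_def)
  then obtain r where "r > 0" "\<And>x. \<phi> x \<noteq> 0 \<Longrightarrow> norm x \<le> r" unfolding bounded_pos by auto
  then show ?thesis using that[of r] by (meson not_le)
qed

lemma iterated_partial_snoc: "iterated_partial \<alpha> (partial_deriv i \<phi>) = iterated_partial (\<alpha> @ [i]) \<phi>"
  by (induction \<alpha>) auto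

lemma test_function_partial:
  assumes "test_function \<phi>" shows "test_function (partial_deriv i \<phi>)"
proof -
  obtain r where r: "\<And>x. norm x > r \<Longrightarrow> \<phi> x = 0" using test_function_support[OF assms] by blast
  have "partial_deriv i \<phi> x = 0" if "norm x > r" for x
    using has_pd_zero_outside[OF test_function_has_pd[OF assms] r that] by simp
  then have "bounded {x. partial_deriv i \<phi> x \<noteq> 0}"
    unfolding bounded_iff by (metis (mono_tags, lifting) mem_Collect_eq not_le)
  then show ?thesis using assms by (simp add: test_function_def iterated_partial_snoc)
qed

lemma test_function_lipschitz:
  fixes \<phi> :: "real^'n::finite \<Rightarrow> real"
  assumes "test_function \<phi>"
  obtains L where "L \<ge> 0" "\<And>x y. \<bar>\<phi> x - \<phi> y\<bar> \<le> L * norm (x - y)"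
proof -
  have diff: "\<phi> differentiable (at x)" for x using test_function_differentiable[OF assms, of "[]"] by simp
  have "\<exists>M\<ge>0. \<forall>x. \<bar>partial_deriv i \<phi> x\<bar> \<le> M" for i
  proof -
    note t = test_function_partial[OF assms, of i]
    obtain r where r: "\<And>x. norm x > r \<Longrightarrow> partial_deriv i \<phi> x = 0" using test_function_support[OF t] by blast
    show ?thesis using bounded_continuous_cball[OF test_function_continuous[OF t] r] by metis
  qed
  then obtain M where M: "\<And>i. M i \<ge> 0" "\<And>i x. \<bar>partial_deriv i \<phi> x\<bar> \<le> M i" by metis
  define L where "L = (\<Sum>i\<in>UNIV. M i)"
  have L0: "L \<ge> 0" unfolding L_def by (intro sum_nonneg M)
  have "norm (\<phi> x - \<phi> y) \<le> L * norm (x - y)" for x y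
  proof (rule differentiable_bound[where S=UNIV and f'="\<lambda>x. frechet_derivative \<phi> (at x)"])
    show "(\<phi> has_derivative frechet_derivative \<phi> (at z)) (at z within UNIV)" for z
      using diff[of z] frechet_derivative_works by auto
    show "onorm (frechet_derivative \<phi> (at z)) \<le> L" for z
    proof (rule onorm_le)
      fix h :: "real^'n"
      have l: "linear (frechet_derivative \<phi> (at z))" by (rule linear_frechet_derivative[OF diff])
      have "h = (\<Sum>i\<in>UNIV. h $ i *\<^sub>R axis i 1)" by (simp add: vec_eq_iff axis_def if_distrib cong: if_cong)
      then have "frechet_derivative \<phi> (at z) h = (\<Sum>i\<in>UNIV. h $ i * partial_deriv i \<phi> z)"
        using linear_sum[OF l, of "\<lambda>i. h $ i *\<^sub>R axis i 1" UNIV] linear_scale[OF l]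
        by (simp add: partial_deriv_def)
      also have "norm \<dots> \<le> (\<Sum>i\<in>UNIV. norm h * M i)"
        by (rule order_trans[OF norm_sum], rule sum_mono)
          (auto simp: abs_mult intro!: mult_mono M component_le_norm_cart)
      finally show "norm (frechet_derivative \<phi> (at z) h) \<le> L * norm h"
        by (simp add: L_def sum_distrib_left mult.commute sum_distrib_right)
    qed
  qed auto
  then show ?thesis using that[OF L0] by simp
qed

text \<open>Translates of the kernel are the test functions to which the weak derivatives are applied.\<close>

lemma iterated_partial_shift:
  assumes "test_function \<phi>"
  shows "iterated_partial \<alpha> (\<lambda>y. \<phi> (y - x)) = (\<lambda>y. iterated_partial \<alpha> \<phi> (y - x))"
proof (induction \<alpha>)
  case (Cons i \<alpha>)
  let ?f = "iterated_partial \<alpha> \<phi>"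
  have d: "?f differentiable (at z)" for z by (rule test_function_differentiable[OF assms])
  have "partial_deriv i (\<lambda>y. ?f (y - x)) = (\<lambda>y. partial_deriv i ?f (y - x))"
  proof (rule partial_deriv_eqI)
    show "(\<lambda>y. ?f (y - x)) differentiable at z" for z
      using differentiable_compose_at[of "\<lambda>y. y - x" z ?f] d by simp
    show "has_pd i (\<lambda>y. ?f (y - x)) (\<lambda>y. partial_deriv i ?f (y - x))"
      unfolding has_pd_def
    proof
      fix z
      have eq: "z + t *\<^sub>R axis i 1 - x = (z - x) + t *\<^sub>R axis i 1" for t by simp
      show "((\<lambda>t. ?f (z + t *\<^sub>R axis i 1 - x)) has_real_derivative partial_deriv i ?f (z - x)) (at 0)"
        unfolding eq using has_pd_partial_deriv[OF d, of i] unfolding has_pd_def by blast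
    qed
  qed
  then show ?case by (simp add: Cons.IH)
qed simp

lemma test_function_shift:
  assumes "test_function \<phi>"
  shows "test_function (\<lambda>y. \<phi> (y - x))"
  unfolding test_function_def
proof (intro conjI allI)
  show "iterated_partial \<alpha> (\<lambda>y. \<phi> (y - x)) differentiable_on UNIV" for \<alpha>
    unfolding iterated_partial_shift[OF assms] differentiable_on_eq_differentiable_at[OF open_UNIV]
    using differentiable_compose_at[of "\<lambda>y. y - x" _ "iterated_partial \<alpha> \<phi>"]
      test_function_differentiable[OF assms] by simp
  obtain r where r: "r > 0" "\<And>x. norm x > r \<Longrightarrow> \<phi> x = 0" using test_function_support[OF assms] by blast
  have "{y. \<phi> (y - x) \<noteq> 0} \<subseteq> cball x r"
    using r(2) by (auto simp: dist_norm norm_minus_commute) (meson not_le)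
  then show "compact (closure {y. \<phi> (y - x) \<noteq> 0})"
    using bounded_subset bounded_cball by (metis compact_closure)
qed

text \<open>The powers of \<open>1 / t\<close> make this family closed under differentiation up to linear combinations.\<close>

definition flat :: "nat \<Rightarrow> real \<Rightarrow> real" where
  "flat k t = (if t > 0 then exp (- inverse t) * inverse t ^ k else 0)"

lemma flat_nonneg: "flat k t \<ge> 0" by (simp add: flat_def)

lemma DERIV_flat: "(flat k has_real_derivative flat (k + 2) t - real k * flat (k + 1) t) (at t)"
proof -
  consider "t > 0" | "t < 0" | "t = 0" by linarith
  then show ?thesis
  proof cases
    case 1
    have p: "((\<lambda>t. inverse t ^ k) has_real_derivative - real k * inverse t ^ (k + 1)) (at t)"
    proof (induction k)
      case (Suc k)
      have "((\<lambda>t. inverse t) has_real_derivative - (inverse t * inverse t)) (at t)"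
        using 1 by (auto intro!: derivative_eq_intros)
      from DERIV_mult[OF this Suc.IH]
      have "((\<lambda>t. inverse t * inverse t ^ k) has_real_derivative - real (Suc k) * inverse t ^ (Suc k + 1)) (at t)"
        by (rule DERIV_cong) (simp add: algebra_simps)
      then show ?case by simp
    qed simp
    have "((\<lambda>t. exp (- inverse t)) has_real_derivative exp (- inverse t) * (inverse t)\<^sup>2) (at t)"
      using 1 by (auto intro!: derivative_eq_intros simp: power2_eq_square)
    from DERIV_mult[OF this p]
    have d: "((\<lambda>t. exp (- inverse t) * inverse t ^ k) has_real_derivative flat (k + 2) t - real k * flat (k + 1) t) (at t)"
      by (rule DERIV_cong) (use 1 in \<open>simp add: flat_def power_add power2_eq_square algebra_simps\<close>)
    have ev: "eventually (\<lambda>s. flat k s = exp (- inverse s) * inverse s ^ k) (nhds t)"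
      using eventually_nhds_in_open[of "{0<..}" t] 1 by (auto elim!: eventually_mono simp: flat_def)
    show ?thesis using DERIV_cong_ev[OF refl ev refl] d by blast
  next
    case 2
    have "eventually (\<lambda>s. flat k s = 0) (nhds t)"
      using eventually_nhds_in_open[of "{..<0}" t] 2 by (auto elim!: eventually_mono simp: flat_def)
    moreover have "flat (k + 2) t - real k * flat (k + 1) t = 0" using 2 by (simp add: flat_def)
    ultimately show ?thesis using DERIV_cong_ev[OF refl _ refl, of "flat k" "\<lambda>_. 0" t 0] by simp
  next
    case 3
    have r: "((\<lambda>h. flat k h / h) \<longlongrightarrow> 0) (at_right 0)"
    proof -
      have "((\<lambda>x::real. x ^ (k + 1) / exp x) \<longlongrightarrow> 0) at_top" by (rule tendsto_power_div_exp_0)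
      then have "((\<lambda>h::real. (inverse h) ^ (k + 1) / exp (inverse h)) \<longlongrightarrow> 0) (at_right 0)"
        by (rule filterlim_compose) (rule filterlim_inverse_at_top_right)
      moreover have "eventually (\<lambda>h. (inverse h) ^ (k + 1) / exp (inverse h) = flat k h / h) (at_right 0)"
        unfolding eventually_at_right_field
        by (rule exI[of _ 1]) (auto simp: flat_def exp_minus divide_inverse algebra_simps)
      ultimately show ?thesis by (rule Lim_transform_eventually)
    qed
    have l: "((\<lambda>h. flat k h / h) \<longlongrightarrow> 0) (at_left 0)"
      by (rule tendsto_eventually) (auto simp: flat_def eventually_at_left_field intro!: exI[of _ "-1"])
    have "((\<lambda>h. flat k h / h) \<longlongrightarrow> 0) (at 0)"
      using l r by (simp add: filterlim_split_at_real)
    then show ?thesis using 3 by (simp add: has_field_derivative_iff flat_def)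
  qed
qed

text \<open>A set of functions that contains \<open>exp (- 1 / (a - |x|^2))\<close>, extended by zero, and is closed under
  partial derivatives. Smoothness to all orders follows without a formula for iterated derivatives.\<close>

inductive bump_span :: "real \<Rightarrow> (real^'n::finite \<Rightarrow> real) \<Rightarrow> bool" for a where
  base: "bump_span a (\<lambda>x. flat k (a - x \<bullet> x))"
| coord: "bump_span a f \<Longrightarrow> bump_span a (\<lambda>x. x $ i * f x)"
| const: "bump_span a f \<Longrightarrow> bump_span a (\<lambda>x. c * f x)"
| add: "bump_span a f \<Longrightarrow> bump_span a g \<Longrightarrow> bump_span a (\<lambda>x. f x + g x)"

lemma bump_span_differentiable: "bump_span a f \<Longrightarrow> f differentiable (at x)"
proof (induction rule: bump_span.induct)
  case (base k)
  have "flat k differentiable at (a - x \<bullet> x)"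
    using DERIV_flat real_differentiable_def by blast
  moreover have "(\<lambda>x. a - x \<bullet> x) differentiable at x"
    unfolding differentiable_def by (rule exI) (rule derivative_eq_intros refl)+
  ultimately show ?case using differentiable_compose_at[of "\<lambda>x. a - x \<bullet> x" x "flat k"] by simp
next
  case (coord f i)
  have "(\<lambda>x. x $ i) differentiable at x"
    by (intro bounded_linear_imp_differentiable bounded_linear_vec_nth)
  then show ?case using coord by (intro differentiable_mult)
qed (auto intro!: differentiable_add differentiable_mult)

lemma bump_span_partial: "bump_span a f \<Longrightarrow> \<exists>f'. has_pd i f f' \<and> bump_span a f'"
proof (induction rule: bump_span.induct)
  case (base k)
  have "has_pd i (\<lambda>x. a - x \<bullet> x) (\<lambda>x. 0 - 2 * x $ i)"
    by (intro has_pd_diff has_pd_const has_pd_normsq)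
  from has_pd_compose[OF this DERIV_flat[of k]]
  have "has_pd i (\<lambda>x. flat k (a - x \<bullet> x))
     (\<lambda>x. (-2) * (x $ i * flat (k + 2) (a - x \<bullet> x)) + (2 * real k) * (x $ i * flat (k + 1) (a - x \<bullet> x)))"
    by (rule has_pd_eq) (simp add: algebra_simps)
  moreover have "bump_span a (\<lambda>x. (-2) * (x $ i * flat (k + 2) (a - x \<bullet> x)) + (2 * real k) * (x $ i * flat (k + 1) (a - x \<bullet> x)))"
    by (intro bump_span.intros)
  ultimately show ?case by blast
next
  case (coord f j)
  then obtain f' where f': "has_pd i f f'" "bump_span a f'" by blast
  have "has_pd i (\<lambda>x. x $ j * f x) (\<lambda>x. (if j = i then 1 else 0) * f x + x $ j * f' x)"
    by (intro has_pd_mult has_pd_coord f')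
  moreover have "bump_span a (\<lambda>x. (if j = i then 1 else 0) * f x + x $ j * f' x)"
    by (intro bump_span.intros f' coord)
  ultimately show ?case by blast
next
  case (const f c)
  then show ?case using has_pd_cmult bump_span.const by blast
next
  case (add f g)
  then show ?case using has_pd_add bump_span.add by blast
qed

lemma bump_span_iterated: "bump_span a f \<Longrightarrow> bump_span a (iterated_partial \<alpha> f)"
proof (induction \<alpha>)
  case (Cons i \<alpha>)
  then have b: "bump_span a (iterated_partial \<alpha> f)" by simp
  obtain f' where f': "has_pd i (iterated_partial \<alpha> f) f'" "bump_span a f'" using bump_span_partial[OF b] by blast
  then show ?case using partial_deriv_eqI[OF bump_span_differentiable[OF b] f'(1)] by simp
qed simp

text \<open>The kernel depends on \<open>norm x\<close> only, so that mollification commutes with every coordinate symmetry.\<close>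

definition mollifier :: "real \<Rightarrow> (real^'n::finite \<Rightarrow> real) \<Rightarrow> bool" where
  "mollifier e \<eta> \<longleftrightarrow> test_function \<eta> \<and> (\<forall>x. \<eta> x \<ge> 0) \<and> (\<forall>x. norm x > e \<longrightarrow> \<eta> x = 0) \<and>
     (\<forall>x y. norm x = norm y \<longrightarrow> \<eta> x = \<eta> y) \<and> (LBINT x. \<eta> x) = 1"

lemma mollifier_exists:
  fixes e :: real
  assumes e: "e > 0"
  shows "\<exists>\<eta>. mollifier e (\<eta> :: real^'n::finite \<Rightarrow> real)"
proof -
  define \<psi> where "\<psi> = (\<lambda>x::real^'n. flat 0 (e\<^sup>2 - x \<bullet> x))"
  have b: "bump_span (e\<^sup>2) \<psi>" unfolding \<psi>_def by (rule bump_span.base)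
  have z: "\<psi> x = 0" if "norm x > e" for x
    using norm_gt_inner[OF e that] by (simp add: \<psi>_def flat_def)
  have c: "continuous_on UNIV \<psi>"
    using bump_span_differentiable[OF b]
    by (auto simp: continuous_on_eq_continuous_at intro!: differentiable_imp_continuous_within)
  have i: "integrable lborel \<psi>" by (rule integrable_continuous_cball[OF c z])
  have nn: "\<psi> x \<ge> 0" for x by (simp add: \<psi>_def flat_nonneg)
  define I where "I = (LBINT x. \<psi> x)"
  have "I \<noteq> 0"
  proof
    assume "I = 0"
    then have A: "AE x in lborel. \<psi> x = 0"
      using integral_nonneg_eq_0_iff_AE[OF i] nn by (simp add: I_def)
    have P: "\<psi> x > 0" if "x \<in> ball 0 e" for x
    proof -
      have "norm x < e" using that by simp
      then have "x \<bullet> x < e\<^sup>2" by (simp add: dot_square_norm power_strict_mono)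
      then show ?thesis by (simp add: \<psi>_def flat_def)
    qed
    have "AE x in lborel. x \<notin> ball (0::real^'n) e"
      using A by (rule eventually_mono) (use P in force)
    then have "ball (0::real^'n) e \<in> null_sets lborel" using AE_iff_null_sets[of "ball (0::real^'n) e" lborel] by simp
    then have "negligible (ball (0::real^'n) e)"
      by (simp add: negligible_iff_null_sets null_sets_completionI)
    then show False using e open_not_negligible[of "ball (0::real^'n) e"] by simp
  qed
  then have I: "I > 0" using nn by (simp add: I_def less_le integral_nonneg_AE)
  define \<eta> where "\<eta> = (\<lambda>x. (1 / I) * \<psi> x)"
  have b': "bump_span (e\<^sup>2) \<eta>" unfolding \<eta>_def by (rule bump_span.const[OF b])
  have "bounded {x. \<eta> x \<noteq> 0}"
    unfolding bounded_iff
  proof (intro exI[of _ e] ballI)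
    fix x assume "x \<in> {x. \<eta> x \<noteq> 0}"
    then show "norm x \<le> e" using z[of x] by (auto simp: \<eta>_def not_less[symmetric])
  qed
  then have t: "test_function \<eta>"
    using bump_span_differentiable[OF bump_span_iterated[OF b']]
    by (simp add: test_function_def differentiable_on_eq_differentiable_at)
  have "(LBINT x. \<eta> x) = 1" using I i by (simp add: \<eta>_def I_def[symmetric])
  moreover have "\<eta> x = \<eta> y" if "norm x = norm y" for x y
    using that by (simp add: \<eta>_def \<psi>_def dot_square_norm)
  moreover have "\<eta> x \<ge> 0" for x using I nn by (simp add: \<eta>_def)
  moreover have "\<eta> x = 0" if "norm x > e" for x using z[OF that] by (simp add: \<eta>_def)
  ultimately have "mollifier e \<eta>" using t unfolding mollifier_def by blast
  then show ?thesis using exI[of "mollifier e" \<eta>] by blast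
qed


section \<open>Mollification\<close>

text \<open>The argument of the kernel is \<open>y - x\<close>, not \<open>x - y\<close>: as a function of \<open>y\<close> it is a translate of \<open>\<phi>\<close>
  without a reflection, which suits the definition of weak derivatives. Derivatives in \<open>x\<close> then
  fall on \<open>\<phi>\<close> with a minus sign.\<close>

definition mollify :: "(real^'n::finite \<Rightarrow> real) \<Rightarrow> (real^'n \<Rightarrow> real) \<Rightarrow> real^'n \<Rightarrow> real" where
  "mollify \<phi> u x = (LBINT y. \<phi> (y - x) * u y)"

definition L2 :: "(real^'n::finite \<Rightarrow> real) \<Rightarrow> bool" where
  "L2 u \<longleftrightarrow> u \<in> borel_measurable borel \<and> integrable lborel (\<lambda>x. (u x)\<^sup>2)"

lemma abs_le_one_plus_square: "\<bar>a\<bar> \<le> 1 + a\<^sup>2" for a :: real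
proof -
  have "0 \<le> (\<bar>a\<bar> - 1)\<^sup>2" by simp
  then show ?thesis by (simp add: power2_eq_square algebra_simps abs_mult_self_eq)
qed

lemma integrable_mult_L2:
  fixes u \<psi> :: "real^'n::finite \<Rightarrow> real"
  assumes u: "L2 u" and c: "continuous_on UNIV \<psi>" and z: "\<And>x. norm x > r \<Longrightarrow> \<psi> x = 0"
  shows "integrable lborel (\<lambda>y. \<psi> y * u y)" "integrable lborel (\<lambda>y. \<psi> y * (u y)\<^sup>2)"
proof -
  have um: "u \<in> borel_measurable borel" "integrable lborel (\<lambda>x. (u x)\<^sup>2)" using u by (auto simp: L2_def)
  have pm: "\<psi> \<in> borel_measurable borel" by (rule borel_measurable_continuous_onI[OF c])
  obtain M where M: "M \<ge> 0" "\<And>x. \<bar>\<psi> x\<bar> \<le> M" using bounded_continuous_cball[OF c z] by blast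
  have i: "integrable lborel \<psi>" by (rule integrable_continuous_cball[OF c z])
  have le: "\<bar>\<psi> y * (u y)\<^sup>2\<bar> \<le> M * (u y)\<^sup>2" for y
    using M(2)[of y] by (simp add: abs_mult mult_right_mono)
  show i2: "integrable lborel (\<lambda>y. \<psi> y * (u y)\<^sup>2)"
    by (rule Bochner_Integration.integrable_bound[of _ "\<lambda>y. M * (u y)\<^sup>2"])
      (use um pm le M in \<open>auto intro!: AE_I2\<close>)
  show "integrable lborel (\<lambda>y. \<psi> y * u y)"
  proof (rule Bochner_Integration.integrable_bound)
    show "integrable lborel (\<lambda>y. \<bar>\<psi> y\<bar> + \<bar>\<psi> y * (u y)\<^sup>2\<bar>)" using i i2 by simp
    show "AE y in lborel. norm (\<psi> y * u y) \<le> norm (\<bar>\<psi> y\<bar> + \<bar>\<psi> y * (u y)\<^sup>2\<bar>)"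
    proof (rule AE_I2)
      fix y
      have "\<bar>\<psi> y\<bar> * \<bar>u y\<bar> \<le> \<bar>\<psi> y\<bar> * (1 + (u y)\<^sup>2)"
        by (intro mult_left_mono abs_le_one_plus_square) simp
      then show "norm (\<psi> y * u y) \<le> norm (\<bar>\<psi> y\<bar> + \<bar>\<psi> y * (u y)\<^sup>2\<bar>)"
        by (simp add: abs_mult distrib_left)
    qed
  qed (use um pm in auto)
qed

lemma integrable_mollify:
  assumes "test_function \<phi>" "L2 u"
  shows "integrable lborel (\<lambda>y. \<phi> (y - x) * u y)" "integrable lborel (\<lambda>y. \<phi> (y - x) * (u y)\<^sup>2)"
proof -
  note t = test_function_shift[OF assms(1), of x]
  obtain r where r: "\<And>y. norm y > r \<Longrightarrow> \<phi> (y - x) = 0" using test_function_support[OF t] by blast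
  show "integrable lborel (\<lambda>y. \<phi> (y - x) * u y)" "integrable lborel (\<lambda>y. \<phi> (y - x) * (u y)\<^sup>2)"
    using integrable_mult_L2[OF assms(2) test_function_continuous[OF t] r] by auto
qed

lemma integrable_indicator_cball: "integrable lborel (indicator (cball a r) :: real^'n::finite \<Rightarrow> real)"
  using emeasure_bounded_finite[OF bounded_cball[of a r]] by (intro integrable_real_indicator) auto

lemma measure_cball_translate:
  fixes a :: "real^'n::finite"
  shows "measure lborel (cball a r) = measure lborel (cball (0::real^'n) r)"
proof -
  have "(indicator (cball a r) :: real^'n \<Rightarrow> real) = (\<lambda>y. indicator (cball 0 r) (y + - a))"
    by (auto simp: fun_eq_iff indicator_def dist_norm norm_minus_commute)
  then have "(LBINT y. indicator (cball a r) y) = (LBINT y. indicator (cball 0 r) (y + - a) :: real)"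
    by (rule arg_cong)
  also have "\<dots> = (LBINT y. indicator (cball 0 r) (y::real^'n))"
    by (rule lborel_integral_translate[of "indicator (cball 0 r)" "- a"]) (auto intro!: borel_measurable_indicator)
  finally show ?thesis by simp
qed

lemma abs_integral_le:
  fixes f g :: "'a \<Rightarrow> real"
  assumes "integrable M f" "integrable M g" "\<And>x. \<bar>f x\<bar> \<le> g x"
  shows "\<bar>\<integral>x. f x \<partial>M\<bar> \<le> (\<integral>x. g x \<partial>M)"
proof -
  have "\<bar>\<integral>x. f x \<partial>M\<bar> \<le> (\<integral>x. \<bar>f x\<bar> \<partial>M)" by (rule integral_abs_bound)
  also have "\<dots> \<le> (\<integral>x. g x \<partial>M)" using assms by (intro integral_mono) auto
  finally show ?thesis .
qed

text \<open>The Lipschitz constant is global, since \<open>|u| \<le> 1 + u^2\<close> bounds the integral of \<open>|u|\<close> over any ball of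
  fixed radius independently of its centre.\<close>

lemma mollify_lipschitz:
  assumes t: "test_function \<phi>" and u: "L2 u"
  shows "\<exists>L. L-lipschitz_on UNIV (mollify \<phi> u)"
proof -
  obtain r where r: "r > 0" "\<And>x. norm x > r \<Longrightarrow> \<phi> x = 0" using test_function_support[OF t] by blast
  obtain L where L: "L \<ge> 0" "\<And>x y. \<bar>\<phi> x - \<phi> y\<bar> \<le> L * norm (x - y)" using test_function_lipschitz[OF t] by blast
  have iu: "integrable lborel (\<lambda>y. (u y)\<^sup>2)" using u by (simp add: L2_def)
  define V where "V = (LBINT y. indicator (cball 0 r) (y::real^'a) :: real)"
  define S where "S = (LBINT y. (u y)\<^sup>2)"
  have V0: "V \<ge> 0" and S0: "S \<ge> 0" by (auto simp: V_def S_def intro!: integral_nonneg_AE)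
  have "dist (mollify \<phi> u x) (mollify \<phi> u x') \<le> (L * (2 * V + 2 * S)) * dist x x'" for x x'
  proof -
    let ?B = "\<lambda>y. L * norm (x - x') * ((indicator (cball x r) y + (u y)\<^sup>2) + (indicator (cball x' r) y + (u y)\<^sup>2))"
    have "\<bar>\<phi> (y - x) * u y - \<phi> (y - x') * u y\<bar> \<le> ?B y" for y
    proof -
      define I :: real where "I = indicator (cball x r) y"
      define I' :: real where "I' = indicator (cball x' r) y"
      have I: "I \<in> {0,1}" "I' \<in> {0,1}" by (auto simp: I_def I'_def indicator_def)
      have "\<bar>\<phi> (y - x) - \<phi> (y - x')\<bar> \<le> L * norm (x - x') * (I + I')"
      proof (cases "y \<in> cball x r \<or> y \<in> cball x' r")
        case True
        then have "1 \<le> I + I'" by (auto simp: I_def I'_def indicator_def)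
        then have "L * norm (x - x') * 1 \<le> L * norm (x - x') * (I + I')" using L(1) by (intro mult_left_mono) auto
        moreover have "y - x - (y - x') = - (x - x')" by simp
        ultimately show ?thesis using L(2)[of "y - x" "y - x'"] by (simp add: norm_minus_commute)
      next
        case False
        then have "norm (y - x) > r" "norm (y - x') > r" by (auto simp: dist_norm norm_minus_commute)
        then show ?thesis using r(2) I L(1) by auto
      qed
      then have "\<bar>\<phi> (y - x) - \<phi> (y - x')\<bar> * \<bar>u y\<bar> \<le> L * norm (x - x') * (I + I') * \<bar>u y\<bar>" by (rule mult_right_mono) simp
      also have "\<dots> = L * norm (x - x') * ((I + I') * \<bar>u y\<bar>)" by simp
      also have "\<dots> \<le> L * norm (x - x') * ((I + (u y)\<^sup>2) + (I' + (u y)\<^sup>2))"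
      proof (rule mult_left_mono)
        show "(I + I') * \<bar>u y\<bar> \<le> (I + (u y)\<^sup>2) + (I' + (u y)\<^sup>2)"
          using abs_le_one_plus_square[of "u y"] zero_le_power2[of "u y"] I by (elim insertE emptyE; simp; linarith)
      qed (use L(1) in simp)
      finally show ?thesis by (simp add: I_def I'_def abs_mult left_diff_distrib[symmetric])
    qed
    note b = this
    have iB: "integrable lborel ?B" using iu integrable_indicator_cball[of x r] integrable_indicator_cball[of x' r] by simp
    have "\<bar>mollify \<phi> u x - mollify \<phi> u x'\<bar> = \<bar>LBINT y. \<phi> (y - x) * u y - \<phi> (y - x') * u y\<bar>"
      using integrable_mollify(1)[OF t u] by (simp add: mollify_def)
    also have "\<dots> \<le> (LBINT y. ?B y)"
      using integrable_mollify(1)[OF t u] by (intro abs_integral_le iB b) simp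
    also have "\<dots> = L * norm (x - x') * ((V + S) + (V + S))"
      using iu integrable_indicator_cball[of x r] integrable_indicator_cball[of x' r]
      by (simp add: measure_cball_translate[of x r] measure_cball_translate[of x' r] V_def S_def)
    finally show ?thesis by (simp add: dist_norm algebra_simps)
  qed
  then have "(L * (2 * V + 2 * S))-lipschitz_on UNIV (mollify \<phi> u)"
    using L(1) V0 S0 by (intro lipschitz_onI) auto
  then show ?thesis ..
qed

lemma continuous_mollify: "test_function \<phi> \<Longrightarrow> L2 u \<Longrightarrow> continuous_on UNIV (mollify \<phi> u)"
  using mollify_lipschitz lipschitz_on_continuous_on by blast

lemma has_pd_mollify:
  assumes t: "test_function \<phi>" and u: "L2 u"
  shows "has_pd i (mollify \<phi> u) (\<lambda>x. - mollify (partial_deriv i \<phi>) u x)"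
  unfolding has_pd_def
proof
  fix x
  obtain r where r: "r > 0" "\<And>x. norm x > r \<Longrightarrow> \<phi> x = 0" using test_function_support[OF t] by blast
  obtain L where L: "L \<ge> 0" "\<And>x y. \<bar>\<phi> x - \<phi> y\<bar> \<le> L * norm (x - y)" using test_function_lipschitz[OF t] by blast
  have iu: "integrable lborel (\<lambda>y. (u y)\<^sup>2)" using u by (simp add: L2_def)
  define f where "f = (\<lambda>t y. \<phi> (y - (x + t *\<^sub>R axis i 1)) * u y)"
  have "((\<lambda>t. LBINT y. f t y) has_real_derivative (LBINT y. - (partial_deriv i \<phi> (y - x) * u y))) (at 0)"
  proof (rule integral_has_derivative_lipschitz(1))
    show "integrable lborel (f t)" for t unfolding f_def by (rule integrable_mollify(1)[OF assms])
    show "((\<lambda>t. f t y) has_real_derivative - (partial_deriv i \<phi> (y - x) * u y)) (at 0)" for y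
    proof -
      have "((\<lambda>t. \<phi> ((y - x) + t *\<^sub>R axis i 1)) has_real_derivative partial_deriv i \<phi> (y - x)) (at (- 0))"
        using test_function_has_pd[OF t, of i] by (simp add: has_pd_def)
      moreover have "((\<lambda>t. - t) has_real_derivative - 1) (at (0::real))" by (auto intro!: derivative_eq_intros)
      ultimately have "((\<lambda>t. \<phi> ((y - x) + (- t) *\<^sub>R axis i 1)) has_real_derivative partial_deriv i \<phi> (y - x) * - 1) (at 0)"
        by (rule DERIV_chain2)
      from DERIV_cmult_right[OF this, of "u y"] show ?thesis by (simp add: f_def diff_diff_add)
    qed
    show "integrable lborel (\<lambda>y. L * (indicator (cball x (r + 1)) y + (u y)\<^sup>2))"
      using iu integrable_indicator_cball[of x "r + 1"] by simp
    show "\<bar>f t y - f 0 y\<bar> \<le> \<bar>t\<bar> * (L * (indicator (cball x (r + 1)) y + (u y)\<^sup>2))" if t1: "\<bar>t\<bar> \<le> 1" for t y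
    proof (cases "y \<in> cball x (r + 1)")
      case True
      have "\<bar>\<phi> (y - (x + t *\<^sub>R axis i 1)) - \<phi> (y - x)\<bar> \<le> L * \<bar>t\<bar>"
        using L(2)[of "y - (x + t *\<^sub>R axis i 1)" "y - x"] by simp
      then have "\<bar>\<phi> (y - (x + t *\<^sub>R axis i 1)) - \<phi> (y - x)\<bar> * \<bar>u y\<bar> \<le> (L * \<bar>t\<bar>) * (1 + (u y)\<^sup>2)"
        using L(1) by (intro mult_mono abs_le_one_plus_square) auto
      then show ?thesis using True
        by (simp add: f_def left_diff_distrib[symmetric] abs_mult) (simp add: mult_ac)
    next
      case False
      then have n: "norm (y - x) > r + 1" by (simp add: dist_norm norm_minus_commute)
      have "norm (y - x) - norm (t *\<^sub>R axis i (1::real)) \<le> norm (y - x - t *\<^sub>R axis i 1)" by (rule norm_triangle_ineq2)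
      then have "norm (y - (x + t *\<^sub>R axis i 1)) > r" using n t1 by (simp add: diff_diff_add)
      then show ?thesis using r n L(1) by (simp add: f_def)
    qed
  qed
  then show "((\<lambda>t. mollify \<phi> u (x + t *\<^sub>R axis i 1)) has_real_derivative - mollify (partial_deriv i \<phi>) u x) (at 0)"
    by (simp add: f_def mollify_def)
qed

lemma has_pd_minus_mollify_partial:
  assumes "test_function \<phi>" "L2 u"
  shows "has_pd i (\<lambda>x. - mollify (partial_deriv i \<phi>) u x) (mollify (iterated_partial [i, i] \<phi>) u)"
  using has_pd_cmult[OF has_pd_mollify[OF test_function_partial[OF assms(1)] assms(2)], of i "-1"] by simp

lemma smooth1_mollify:
  assumes "test_function \<phi>" "L2 u"
  shows "smooth1 (mollify \<phi> u) (\<lambda>i x. - mollify (partial_deriv i \<phi>) u x)"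
  unfolding smooth1_def
  using mollify_lipschitz[OF assms] has_pd_mollify[OF assms] continuous_mollify[OF test_function_partial[OF assms(1)] assms(2)]
  by (auto intro!: continuous_intros)

lemma mollifierD:
  assumes "mollifier e \<eta>"
  shows "test_function \<eta>" "\<eta> x \<ge> 0" "norm x > e \<Longrightarrow> \<eta> x = 0" "norm x = norm y \<Longrightarrow> \<eta> x = \<eta> y"
    "(LBINT x. \<eta> x) = 1"
  using assms unfolding mollifier_def by blast+

lemma mollify_signed_perm:
  fixes u :: "real^'n::finite \<Rightarrow> real"
  assumes m: "mollifier e \<eta>" and u: "L2 u"
    and s: "\<And>k. \<sigma> k = 1 \<or> \<sigma> k = -1" and p: "bij \<pi>"
    and sym: "AE x in lborel. u (signed_perm \<sigma> \<pi> x) = - u x"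
  shows "mollify \<eta> u (signed_perm \<sigma> \<pi> x) = - mollify \<eta> u x"
proof -
  let ?T = "signed_perm \<sigma> \<pi>"
  note \<eta> = mollifierD[OF m]
  have [measurable]: "u \<in> borel_measurable borel" using u by (simp add: L2_def)
  have [measurable]: "\<eta> \<in> borel_measurable borel"
    by (rule borel_measurable_continuous_onI[OF test_function_continuous[OF \<eta>(1)]])
  have T[measurable]: "?T \<in> borel_measurable borel" by (rule measurable_signed_perm)
  have eq: "\<eta> (?T y - ?T x) = \<eta> (y - x)" for y
  proof (rule \<eta>(4))
    have "?T y - ?T x = ?T (y - x)" by (simp add: vec_eq_iff signed_perm_def right_diff_distrib)
    then show "norm (?T y - ?T x) = norm (y - x)" by (simp add: norm_signed_perm[OF s p])
  qed
  have "mollify \<eta> u (?T x) = (LBINT y. \<eta> (?T y - ?T x) * u (?T y))"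
    unfolding mollify_def by (rule integral_signed_perm[OF s p, symmetric]) measurable
  also have "\<dots> = (LBINT y. - (\<eta> (y - x) * u y))"
    unfolding eq by (rule integral_cong_AE) (use sym in \<open>auto elim!: eventually_mono\<close>)
  also have "\<dots> = - mollify \<eta> u x" by (simp add: mollify_def)
  finally show ?thesis .
qed

lemma mollifier_integral_shift:
  fixes \<eta> :: "real^'n::finite \<Rightarrow> real"
  assumes m: "mollifier e \<eta>"
  shows "(LBINT y. \<eta> (y - x)) = 1" "(LBINT x. \<eta> (y - x)) = 1"
    "integrable lborel (\<lambda>y. \<eta> (y - x))" "integrable lborel (\<lambda>x. \<eta> (y - x))"
proof -
  note t = mollifierD(1)[OF m]
  have sy: "\<eta> (y - x) = \<eta> (x - y)" for x y
    by (rule mollifierD(4)[OF m]) (rule norm_minus_commute)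
  have meas: "\<eta> \<in> borel_measurable borel"
    by (rule borel_measurable_continuous_onI[OF test_function_continuous[OF t]])
  show 1: "(LBINT y. \<eta> (y - x)) = 1" for x
    using lborel_integral_translate[OF meas, of "- x"] mollifierD(5)[OF m] by simp
  show i: "integrable lborel (\<lambda>y. \<eta> (y - x))" for x
  proof -
    note t' = test_function_shift[OF t, of x]
    obtain r where "\<And>y. norm y > r \<Longrightarrow> \<eta> (y - x) = 0" using test_function_support[OF t'] by blast
    then show ?thesis by (rule integrable_continuous_cball[OF test_function_continuous[OF t']])
  qed
  show "(LBINT x. \<eta> (y - x)) = 1" "integrable lborel (\<lambda>x. \<eta> (y - x))"
    unfolding sy[of y] by (rule 1, rule i)
qed

text \<open>Jensen's inequality for the square, obtained from the nonnegativity of the variance.\<close>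

lemma mollify_square_le:
  assumes m: "mollifier e \<eta>" and f: "L2 f"
  shows "(mollify \<eta> f x)\<^sup>2 \<le> (LBINT y. \<eta> (y - x) * (f y)\<^sup>2)"
proof -
  note t = mollifierD(1)[OF m] and nn = mollifierD(2)[OF m]
  note i = integrable_mollify[OF t f, of x] mollifier_integral_shift[OF m, of x]
  define c where "c = mollify \<eta> f x"
  have "0 \<le> (LBINT y. \<eta> (y - x) * (f y - c)\<^sup>2)"
    by (intro integral_nonneg_AE AE_I2 mult_nonneg_nonneg nn) simp
  also have "\<dots> = (LBINT y. \<eta> (y - x) * (f y)\<^sup>2 - 2 * c * (\<eta> (y - x) * f y) + c\<^sup>2 * \<eta> (y - x))"
    by (rule Bochner_Integration.integral_cong) (auto simp: power2_eq_square algebra_simps)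
  also have "\<dots> = (LBINT y. \<eta> (y - x) * (f y)\<^sup>2) - 2 * c * c + c\<^sup>2"
    using i by (simp add: c_def mollify_def)
  finally show ?thesis by (simp add: c_def power2_eq_square)
qed

lemma mollify_L2_contraction:
  fixes f :: "real^'n::finite \<Rightarrow> real"
  assumes m: "mollifier e \<eta>" and f: "L2 f"
  shows "integrable lborel (\<lambda>x. (mollify \<eta> f x)\<^sup>2)"
    "(LBINT x. (mollify \<eta> f x)\<^sup>2) \<le> (LBINT x. (f x)\<^sup>2)"
proof -
  note t = mollifierD(1)[OF m] and nn = mollifierD(2)[OF m]
  have [measurable]: "f \<in> borel_measurable borel" and i: "integrable lborel (\<lambda>x. (f x)\<^sup>2)" using f by (auto simp: L2_def)
  have [measurable]: "\<eta> \<in> borel_measurable borel"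
    by (rule borel_measurable_continuous_onI[OF test_function_continuous[OF t]])
  have mm[measurable]: "mollify \<eta> f \<in> borel_measurable borel"
    by (rule borel_measurable_continuous_onI[OF continuous_mollify[OF t f]])
  have "(\<integral>\<^sup>+x. ennreal ((mollify \<eta> f x)\<^sup>2) \<partial>lborel) \<le> (\<integral>\<^sup>+x. (\<integral>\<^sup>+y. ennreal (\<eta> (y - x) * (f y)\<^sup>2) \<partial>lborel) \<partial>lborel)"
  proof (rule nn_integral_mono)
    fix x
    have "(\<integral>\<^sup>+y. ennreal (\<eta> (y - x) * (f y)\<^sup>2) \<partial>lborel) = ennreal (LBINT y. \<eta> (y - x) * (f y)\<^sup>2)"
      by (rule nn_integral_eq_integral[OF integrable_mollify(2)[OF t f]]) (auto simp: nn)
    then show "ennreal ((mollify \<eta> f x)\<^sup>2) \<le> (\<integral>\<^sup>+y. ennreal (\<eta> (y - x) * (f y)\<^sup>2) \<partial>lborel)"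
      using mollify_square_le[OF m f, of x] by (simp add: ennreal_leI)
  qed
  also have "\<dots> = (\<integral>\<^sup>+y. (\<integral>\<^sup>+x. ennreal (\<eta> (y - x) * (f y)\<^sup>2) \<partial>lborel) \<partial>lborel)"
    by (rule lborel_pair.Fubini') measurable
  also have "\<dots> = (\<integral>\<^sup>+y. ennreal ((f y)\<^sup>2) \<partial>lborel)"
  proof (rule nn_integral_cong)
    fix y
    have "(\<integral>\<^sup>+x. ennreal (\<eta> (y - x) * (f y)\<^sup>2) \<partial>lborel) = ennreal (LBINT x. \<eta> (y - x) * (f y)\<^sup>2)"
      by (rule nn_integral_eq_integral) (use nn mollifier_integral_shift(4)[OF m] in auto)
    then show "(\<integral>\<^sup>+x. ennreal (\<eta> (y - x) * (f y)\<^sup>2) \<partial>lborel) = ennreal ((f y)\<^sup>2)"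
      using mollifier_integral_shift(2)[OF m, of y] by simp
  qed
  also have "\<dots> = ennreal (LBINT y. (f y)\<^sup>2)" by (rule nn_integral_eq_integral[OF i]) auto
  finally have le: "(\<integral>\<^sup>+x. ennreal ((mollify \<eta> f x)\<^sup>2) \<partial>lborel) \<le> ennreal (LBINT y. (f y)\<^sup>2)" .
  show int: "integrable lborel (\<lambda>x. (mollify \<eta> f x)\<^sup>2)"
    by (rule integrableI_bounded) (use le in \<open>auto simp: le_less_trans[OF _ ennreal_less_top]\<close>)
  show "(LBINT x. (mollify \<eta> f x)\<^sup>2) \<le> (LBINT x. (f x)\<^sup>2)"
    using le nn_integral_eq_integral[OF int] by (simp add: integral_nonneg_AE ennreal_le_iff)
qed

lemma mollify_transfer:
  fixes G u :: "real^'n::finite \<Rightarrow> real"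
  assumes t: "test_function \<eta>" and nn: "\<And>x. \<eta> x \<ge> 0" and u: "L2 u" and G: "continuous_on UNIV G" "\<And>x. norm x > r \<Longrightarrow> G x = 0"
  shows "(LBINT x. G x * mollify \<eta> u x) = (LBINT y. u y * (LBINT x. \<eta> (y - x) * G x))"
proof -
  have [measurable]: "u \<in> borel_measurable borel" using u by (auto simp: L2_def)
  have u': "L2 (\<lambda>y. \<bar>u y\<bar>)" using u by (auto simp: L2_def)
  have [measurable]: "\<eta> \<in> borel_measurable borel" "G \<in> borel_measurable borel"
    using borel_measurable_continuous_onI[OF test_function_continuous[OF t]] borel_measurable_continuous_onI[OF G(1)] by auto
  define F where "F = (\<lambda>x y. G x * (\<eta> (y - x) * u y))"
  have int: "integrable (lborel \<Otimes>\<^sub>M lborel) (\<lambda>(x, y). F x y)"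
  proof (rule lborel_pair.Fubini_integrable)
    show "(\<lambda>(x, y). F x y) \<in> borel_measurable (lborel \<Otimes>\<^sub>M lborel)"
      unfolding F_def by measurable
    have "(LBINT y. norm (case (x, y) of (x, y) \<Rightarrow> F x y)) = \<bar>G x\<bar> * mollify \<eta> (\<lambda>y. \<bar>u y\<bar>) x" for x
      by (simp add: F_def mollify_def abs_mult nn)
    moreover have "integrable lborel (\<lambda>x. \<bar>G x\<bar> * mollify \<eta> (\<lambda>y. \<bar>u y\<bar>) x)"
      by (rule integrable_continuous_cball[where R=r])
        (use G in \<open>auto intro!: continuous_intros continuous_mollify[OF t u']\<close>)
    ultimately show "integrable lborel (\<lambda>x. LBINT y. norm (case (x, y) of (x, y) \<Rightarrow> F x y))" by simp
    show "AE x in lborel. integrable lborel (\<lambda>y. case (x, y) of (x, y) \<Rightarrow> F x y)"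
      using integrable_mollify(1)[OF t u] by (auto simp: F_def)
  qed
  have "(LBINT x. G x * mollify \<eta> u x) = (LBINT x. (LBINT y. F x y))"
    by (simp add: F_def mollify_def)
  also have "\<dots> = (LBINT y. (LBINT x. F x y))"
    by (rule lborel_pair.Fubini_integral[OF int, symmetric])
  also have "\<dots> = (LBINT y. u y * (LBINT x. \<eta> (y - x) * G x))"
    by (rule Bochner_Integration.integral_cong) (auto simp: F_def mult_ac simp flip: integral_mult_right_zero)
  finally show ?thesis .
qed

text \<open>By Fubini the mollification is moved to the continuous function \<open>G\<close>, whose mollifications
  converge pointwise and are uniformly bounded with supports in a fixed ball.\<close>

lemma mollify_weak_convergence:
  fixes G u :: "real^'n::finite \<Rightarrow> real"
  assumes m: "\<And>n. mollifier (1 / real (Suc n)) (\<eta> n)" and u: "L2 u"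
    and G: "continuous_on UNIV G" "\<And>x. norm x > r \<Longrightarrow> G x = 0"
  shows "(\<lambda>n. LBINT x. G x * mollify (\<eta> n) u x) \<longlonglongrightarrow> (LBINT x. G x * u x)"
proof -
  note t = mollifierD(1)[OF m] and nn = mollifierD(2)[OF m] and z = mollifierD(3)[OF m]
  have um[measurable]: "u \<in> borel_measurable borel" and iu: "integrable lborel (\<lambda>x. (u x)\<^sup>2)" using u by (auto simp: L2_def)
  have [measurable]: "\<eta> n \<in> borel_measurable borel" "G \<in> borel_measurable borel" for n
    using borel_measurable_continuous_onI[OF test_function_continuous[OF t]] borel_measurable_continuous_onI[OF G(1)] by auto
  obtain M where M: "M \<ge> 0" "\<And>x. \<bar>G x\<bar> \<le> M" using bounded_continuous_cball[OF G] by blast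
  define g where "g = (\<lambda>n y. LBINT x. \<eta> n (y - x) * G x)"
  have iG: "integrable lborel (\<lambda>x. \<eta> n (y - x) * G x)" for n y
  proof (rule Bochner_Integration.integrable_bound)
    show "integrable lborel (\<lambda>x. M * \<eta> n (y - x))" using mollifier_integral_shift(4)[OF m] by simp
    show "AE x in lborel. norm (\<eta> n (y - x) * G x) \<le> norm (M * \<eta> n (y - x))"
      using M nn by (auto simp: abs_mult mult.commute[of M] intro!: mult_left_mono)
  qed measurable
  have dev: "\<bar>g n y - G y\<bar> \<le> c" if c: "\<And>x. norm (y - x) \<le> 1 / real (Suc n) \<Longrightarrow> \<bar>G x - G y\<bar> \<le> c" for n y c
  proof -
    have "g n y - G y = (LBINT x. \<eta> n (y - x) * G x - G y * \<eta> n (y - x))"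
      using iG mollifier_integral_shift(2,4)[OF m, where y=y] by (simp add: g_def)
    moreover have "\<bar>\<dots>\<bar> \<le> (LBINT x. c * \<eta> n (y - x))"
    proof (rule abs_integral_le)
      show "integrable lborel (\<lambda>x. \<eta> n (y - x) * G x - G y * \<eta> n (y - x))" "integrable lborel (\<lambda>x. c * \<eta> n (y - x))"
        using iG mollifier_integral_shift(4)[OF m, where y=y] by simp_all
      show "\<bar>\<eta> n (y - x) * G x - G y * \<eta> n (y - x)\<bar> \<le> c * \<eta> n (y - x)" for x
      proof (cases "norm (y - x) \<le> 1 / real (Suc n)")
        case True
        have "\<eta> n (y - x) * G x - G y * \<eta> n (y - x) = \<eta> n (y - x) * (G x - G y)" by (simp add: algebra_simps)
        moreover have "\<eta> n (y - x) * \<bar>G x - G y\<bar> \<le> \<eta> n (y - x) * c" using c[OF True] nn by (rule mult_left_mono)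
        ultimately show ?thesis using nn[of n "y - x"] by (simp add: abs_mult mult.commute[of c])
      qed (use z in auto)
    qed
    ultimately show ?thesis using mollifier_integral_shift(2)[OF m, where y=y] by simp
  qed
  have lim: "(\<lambda>n. g n y) \<longlonglongrightarrow> G y" for y
  proof (rule LIMSEQ_I)
    fix e :: real assume e: "e > 0"
    have "isCont G y" using G(1) by (simp add: continuous_on_eq_continuous_at)
    then obtain d where d: "d > 0" "\<And>x. dist x y < d \<Longrightarrow> dist (G x) (G y) < e / 2"
      using e unfolding continuous_at_eps_delta by (metis half_gt_zero)
    obtain N where N: "1 / real (Suc N) < d" using d(1) reals_Archimedean[of d] by (auto simp: inverse_eq_divide)
    have "norm (g n y - G y) < e" if "n \<ge> N" for n
    proof -
      have "1 / real (Suc n) \<le> 1 / real (Suc N)" using that by (simp add: frac_le)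
      then have "\<bar>g n y - G y\<bar> \<le> e / 2"
        using d(2) N by (intro dev) (fastforce simp: dist_norm norm_minus_commute less_imp_le)
      then show ?thesis using e by simp
    qed
    then show "\<exists>N. \<forall>n\<ge>N. norm (g n y - G y) < e" by blast
  qed
  have gb: "\<bar>g n y\<bar> \<le> 3 * M * indicator (cball 0 (r + 1)) y" for n y
  proof (cases "norm y \<le> r + 1")
    case True
    have "\<bar>g n y - G y\<bar> \<le> 2 * M"
      using M(2) by (intro dev) (smt (verit))
    then show ?thesis using True M(2)[of y] by (simp add: indicator_def)
  next
    case False
    have "g n y = (\<integral>x. 0 \<partial>(lborel :: (real^'n) measure))" unfolding g_def
    proof (rule Bochner_Integration.integral_cong[OF refl])
      fix x
      show "\<eta> n (y - x) * G x = 0"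
      proof (cases "norm x > r")
        case True then show ?thesis using G(2) by simp
      next
        case f: False
        have "norm y \<le> norm (y - x) + norm x" using norm_triangle_ineq[of "y - x" x] by simp
        then have "norm (y - x) > 1" using False f by linarith
        moreover have "1 / real (Suc n) \<le> 1" by simp
        ultimately have "norm (y - x) > 1 / real (Suc n)" by linarith
        from z[OF this] show ?thesis by simp
      qed
    qed
    then show ?thesis using M(1) by simp
  qed
  have "(\<lambda>n. LBINT y. u y * g n y) \<longlonglongrightarrow> (LBINT y. u y * G y)"
  proof (rule integral_dominated_convergence[where w="\<lambda>y. 3 * M * (indicator (cball 0 (r + 1)) y + (u y)\<^sup>2)"])
    show "integrable lborel (\<lambda>y. 3 * M * (indicator (cball 0 (r + 1)) y + (u y)\<^sup>2))"
      by (intro integrable_mult_right Bochner_Integration.integrable_add iu integrable_indicator_cball)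
    show "(\<lambda>y. u y * G y) \<in> borel_measurable lborel" by measurable
    show "(\<lambda>y. u y * g n y) \<in> borel_measurable lborel" for n
      unfolding g_def by measurable
    show "AE y in lborel. (\<lambda>n. u y * g n y) \<longlonglongrightarrow> u y * G y"
      using lim by (auto intro!: tendsto_intros)
    show "AE y in lborel. norm (u y * g n y) \<le> 3 * M * (indicator (cball 0 (r + 1)) y + (u y)\<^sup>2)" for n
    proof (rule AE_I2)
      fix y :: "real^'n"
      define I :: real where "I = indicator (cball 0 (r + 1)) y"
      have I: "I \<in> {0,1}" by (auto simp: I_def indicator_def)
      have "\<bar>u y\<bar> * \<bar>g n y\<bar> \<le> \<bar>u y\<bar> * (3 * M * I)" using gb[of n y] by (intro mult_left_mono) (auto simp: I_def)
      also have "\<dots> = 3 * M * (I * \<bar>u y\<bar>)" by simp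
      also have "\<dots> \<le> 3 * M * (I + (u y)\<^sup>2)"
        using I abs_le_one_plus_square[of "u y"] M(1) by (intro mult_left_mono) auto
      finally show "norm (u y * g n y) \<le> 3 * M * (indicator (cball 0 (r + 1)) y + (u y)\<^sup>2)"
        by (simp add: I_def abs_mult)
    qed
  qed
  then show ?thesis
    using mollify_transfer[OF t nn u G] by (simp add: g_def mult.commute)
qed


section \<open>Passage to weakly differentiable functions\<close>

definition rellich_weight :: "real \<Rightarrow> real \<Rightarrow> real^'n::finite \<Rightarrow> real" where
  "rellich_weight R \<delta> x = (max 0 (1 - (x \<bullet> x) / R\<^sup>2)) ^ 3 / (x \<bullet> x + \<delta>)\<^sup>2"

lemma rellich_weight_props:
  assumes R: "R > 0" and \<delta>: "\<delta> > 0"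
  shows "rellich_weight R \<delta> x \<ge> 0" "continuous_on UNIV (rellich_weight R \<delta> :: real^'n::finite \<Rightarrow> real)"
    "norm x > R \<Longrightarrow> rellich_weight R \<delta> x = 0"
proof -
  have p: "x \<bullet> x + \<delta> > 0" for x :: "real^'n" by (rule add_nonneg_pos) (use \<delta> in auto)
  show "rellich_weight R \<delta> x \<ge> 0" by (simp add: rellich_weight_def)
  show "continuous_on UNIV (rellich_weight R \<delta> :: real^'n::finite \<Rightarrow> real)"
    unfolding rellich_weight_def[abs_def]
    by (intro continuous_intros) (use R p in \<open>auto simp: less_imp_neq[symmetric]\<close>)
  show "norm x > R \<Longrightarrow> rellich_weight R \<delta> x = 0"
    using norm_gt_inner[OF R, of x] R by (simp add: rellich_weight_def)
qed

lemma AE_limit_continuous: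
  fixes u :: "real^'n::finite \<Rightarrow> real"
  assumes "u \<in> borel_measurable borel"
  obtains h where "\<And>n::nat. continuous_on UNIV (h n)" "AE x in lborel. (\<lambda>n. h n x) \<longlonglongrightarrow> u x"
proof -
  have "u \<in> borel_measurable lebesgue" using assms by (intro measurable_completion) simp
  then have "u measurable_on UNIV" by (rule lebesgue_measurable_imp_measurable_on) simp
  then obtain N h where N: "negligible N" "\<And>n. continuous_on UNIV (h n)" "\<And>x. x \<notin> N \<Longrightarrow> (\<lambda>n. h n x) \<longlonglongrightarrow> u x"
    unfolding measurable_on_def by auto
  have "AE x in lebesgue. (\<lambda>n. h n x) \<longlonglongrightarrow> u x"
    by (rule AE_I'[of N]) (use N in \<open>auto simp: negligible_iff_null_sets\<close>)
  then have "AE x in lborel. (\<lambda>n. h n x) \<longlonglongrightarrow> u x" unfolding AE_completion_iff .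
  then show ?thesis by (rule that[of h, OF N(2)])
qed

text \<open>Weak lower semicontinuity of a weighted norm. Expanding \<open>B (U n - g)^2 \<ge> 0\<close> bounds the integral of
  \<open>B (2 g u - g^2)\<close> by \<open>K\<close> for continuous \<open>g\<close>. The choice \<open>g = u\<close> would be optimal; it is approached
  by truncations of continuous functions that converge to \<open>u\<close> almost everywhere.\<close>

lemma weighted_square_le_weak_limit:
  fixes u B :: "real^'n::finite \<Rightarrow> real"
  assumes B: "\<And>x. B x \<ge> 0" "continuous_on UNIV B" "\<And>x. norm x > R \<Longrightarrow> B x = 0"
    and u: "L2 u" and U: "\<And>n. continuous_on UNIV (U n)"
    and weak: "\<And>G. continuous_on UNIV G \<Longrightarrow> (\<And>x. norm x > R \<Longrightarrow> G x = 0) \<Longrightarrow>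
       (\<lambda>n. LBINT x. G x * U n x) \<longlonglongrightarrow> (LBINT x. G x * u x)"
    and le: "\<And>n::nat. (LBINT x. B x * (U n x)\<^sup>2) \<le> K"
  shows "integrable lborel (\<lambda>x. B x * (u x)\<^sup>2)" "(LBINT x. B x * (u x)\<^sup>2) \<le> K"
proof -
  have um[measurable]: "u \<in> borel_measurable borel" using u by (simp add: L2_def)
  have [measurable]: "B \<in> borel_measurable borel" by (rule borel_measurable_continuous_onI[OF B(2)])
  show iBu: "integrable lborel (\<lambda>x. B x * (u x)\<^sup>2)" by (rule integrable_mult_L2[OF u B(2,3)])
  have iB: "integrable lborel B" by (rule integrable_continuous_cball[OF B(2,3)])
  have step1: "(LBINT x. B x * (2 * g x * u x - (g x)\<^sup>2)) \<le> K" if g: "continuous_on UNIV g" for g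
  proof -
    define G where "G = (\<lambda>x. B x * (2 * g x))"
    have cG: "continuous_on UNIV G" unfolding G_def by (intro continuous_intros B g)
    have zG: "G x = 0" if "norm x > R" for x using B(3)[OF that] by (simp add: G_def)
    have ig: "integrable lborel (\<lambda>x. B x * (g x)\<^sup>2)"
      by (rule integrable_continuous_cball[where R=R]) (use B in \<open>auto intro!: continuous_intros g\<close>)
    have iU: "integrable lborel (\<lambda>x. B x * (U n x)\<^sup>2)" for n
      by (rule integrable_continuous_cball[where R=R]) (use B in \<open>auto intro!: continuous_intros U\<close>)
    have iGU: "integrable lborel (\<lambda>x. G x * U n x)" for n
      by (rule integrable_continuous_cball[where R=R]) (use zG in \<open>auto intro!: continuous_intros U cG\<close>)
    have "(LBINT x. G x * U n x) - (LBINT x. B x * (g x)\<^sup>2) \<le> K" for n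
    proof -
      have "(LBINT x. G x * U n x) - (LBINT x. B x * (g x)\<^sup>2) = (LBINT x. G x * U n x - B x * (g x)\<^sup>2)"
        using iGU ig by simp
      also have "\<dots> \<le> (LBINT x. B x * (U n x)\<^sup>2)"
      proof (rule integral_mono)
        show "G x * U n x - B x * (g x)\<^sup>2 \<le> B x * (U n x)\<^sup>2" for x
        proof -
          have "0 \<le> B x * (U n x - g x)\<^sup>2" using B(1) by simp
          then show ?thesis by (simp add: G_def power2_eq_square algebra_simps)
        qed
      qed (use iGU ig iU in auto)
      finally show ?thesis using le[of n] by linarith
    qed
    moreover have "(\<lambda>n. (LBINT x. G x * U n x) - (LBINT x. B x * (g x)\<^sup>2))
       \<longlonglongrightarrow> (LBINT x. G x * u x) - (LBINT x. B x * (g x)\<^sup>2)"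
      by (intro tendsto_intros weak cG zG)
    ultimately have "(LBINT x. G x * u x) - (LBINT x. B x * (g x)\<^sup>2) \<le> K"
      using LIMSEQ_le_const2 by blast
    moreover have "(LBINT x. B x * (2 * g x * u x - (g x)\<^sup>2)) = (LBINT x. G x * u x - B x * (g x)\<^sup>2)"
      by (rule Bochner_Integration.integral_cong) (auto simp: G_def algebra_simps)
    ultimately show ?thesis using integrable_mult_L2(1)[OF u cG zG] ig by simp
  qed
  obtain h where h: "\<And>n::nat. continuous_on UNIV (h n)" "AE x in lborel. (\<lambda>n. h n x) \<longlonglongrightarrow> u x"
    using AE_limit_continuous[OF um] by blast
  define clip where "clip = (\<lambda>N (t::real). max (- real N) (min (real N) t))"
  have clip_bound: "\<bar>clip N t\<bar> \<le> real N" for N t by (auto simp: clip_def)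
  have clip_cont: "continuous_on UNIV (clip N)" for N
    unfolding clip_def by (intro continuous_intros)
  have clip_le: "(clip N t)\<^sup>2 \<le> 2 * clip N t * t - (clip N t)\<^sup>2" for N t
  proof -
    have "0 \<le> clip N t * (t - clip N t)"
      by (cases "t \<ge> 0") (auto simp: clip_def max_def min_def mult_le_0_iff intro!: mult_nonneg_nonneg mult_nonpos_nonpos)
    then show ?thesis by (simp add: power2_eq_square algebra_simps)
  qed
  have [measurable]: "clip N \<in> borel_measurable borel" for N
    by (rule borel_measurable_continuous_onI[OF clip_cont])
  have step2: "(LBINT x. B x * (2 * clip N (u x) * u x - (clip N (u x))\<^sup>2)) \<le> K" for N
  proof (rule integral_le_dominated_limit[where E="\<lambda>n x. B x * (2 * clip N (h n x) * u x - (clip N (h n x))\<^sup>2)"])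
    have ch: "continuous_on UNIV (\<lambda>x. clip N (h n x))" for n
      by (rule continuous_on_compose2[OF clip_cont h(1)]) auto
    show "(\<lambda>x. B x * (2 * clip N (h n x) * u x - (clip N (h n x))\<^sup>2)) \<in> borel_measurable lborel" for n
      using borel_measurable_continuous_onI[OF ch[of n]] by measurable
    show "(\<lambda>x. B x * (2 * clip N (u x) * u x - (clip N (u x))\<^sup>2)) \<in> borel_measurable lborel" by measurable
    show "integrable lborel (\<lambda>x. 2 * real N * \<bar>B x * u x\<bar> + (real N)\<^sup>2 * B x)"
      using integrable_mult_L2(1)[OF u B(2,3)] iB by simp
    show "\<bar>B x * (2 * clip N (h n x) * u x - (clip N (h n x))\<^sup>2)\<bar> \<le> 2 * real N * \<bar>B x * u x\<bar> + (real N)\<^sup>2 * B x" for n x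
    proof -
      let ?c = "clip N (h n x)"
      have "\<bar>?c * u x\<bar> \<le> real N * \<bar>u x\<bar>" using clip_bound[of N "h n x"] by (simp add: abs_mult mult_right_mono)
      moreover have "\<bar>?c\<bar>\<^sup>2 \<le> (real N)\<^sup>2" by (intro power_mono clip_bound) simp
      ultimately have "\<bar>2 * ?c * u x - ?c\<^sup>2\<bar> \<le> 2 * (real N * \<bar>u x\<bar>) + (real N)\<^sup>2"
        using zero_le_power2[of ?c] unfolding abs_le_iff power2_abs by linarith
      then have "B x * \<bar>2 * ?c * u x - ?c\<^sup>2\<bar> \<le> B x * (2 * (real N * \<bar>u x\<bar>) + (real N)\<^sup>2)"
        using B(1) by (rule mult_left_mono)
      moreover have "\<bar>B x * (2 * ?c * u x - ?c\<^sup>2)\<bar> = B x * \<bar>2 * ?c * u x - ?c\<^sup>2\<bar>"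
        using B(1)[of x] by (simp only: abs_mult abs_of_nonneg)
      moreover have "B x * (2 * (real N * \<bar>u x\<bar>) + (real N)\<^sup>2) = 2 * real N * \<bar>B x * u x\<bar> + (real N)\<^sup>2 * B x"
        using B(1)[of x] by (simp add: abs_mult algebra_simps)
      ultimately show ?thesis by (simp only:)
    qed
    show "AE x in lborel. (\<lambda>n. B x * (2 * clip N (h n x) * u x - (clip N (h n x))\<^sup>2))
        \<longlonglongrightarrow> B x * (2 * clip N (u x) * u x - (clip N (u x))\<^sup>2)"
      using h(2)
    proof eventually_elim
      case (elim x)
      have "(\<lambda>n. clip N (h n x)) \<longlonglongrightarrow> clip N (u x)"
        unfolding clip_def by (intro tendsto_intros elim)
      then show ?case by (intro tendsto_intros)
    qed
    show "(LBINT x. B x * (2 * clip N (h n x) * u x - (clip N (h n x))\<^sup>2)) \<le> K" for n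
      by (rule step1[OF ch])
  qed
  have clip_sq: "(clip N t)\<^sup>2 \<le> t\<^sup>2" for N t
    by (subst abs_le_square_iff[symmetric]) (auto simp: clip_def)
  have intc: "integrable lborel (\<lambda>x. B x * (clip N (u x))\<^sup>2)" "integrable lborel (\<lambda>x. B x * (2 * clip N (u x) * u x - (clip N (u x))\<^sup>2))" for N
  proof -
    show i: "integrable lborel (\<lambda>x. B x * (clip N (u x))\<^sup>2)"
      by (rule Bochner_Integration.integrable_bound[OF iBu])
        (use clip_sq B(1) in \<open>auto simp: abs_mult intro!: mult_left_mono\<close>)
    have "integrable lborel (\<lambda>x. B x * (clip N (u x) * u x))"
    proof (rule Bochner_Integration.integrable_bound[OF iBu])
      show "AE x in lborel. norm (B x * (clip N (u x) * u x)) \<le> norm (B x * (u x)\<^sup>2)"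
      proof (rule AE_I2)
        fix x
        have "\<bar>clip N (u x)\<bar> \<le> \<bar>u x\<bar>" by (auto simp: clip_def)
        then have "\<bar>clip N (u x)\<bar> * \<bar>u x\<bar> \<le> \<bar>u x\<bar> * \<bar>u x\<bar>" by (rule mult_right_mono) simp
        then show "norm (B x * (clip N (u x) * u x)) \<le> norm (B x * (u x)\<^sup>2)"
          by (simp add: abs_mult power2_eq_square mult_left_mono)
      qed
    qed measurable
    from Bochner_Integration.integrable_diff[OF integrable_mult_right[OF this, of 2] i]
    show "integrable lborel (\<lambda>x. B x * (2 * clip N (u x) * u x - (clip N (u x))\<^sup>2))"
      by (simp add: algebra_simps)
  qed
  show "(LBINT x. B x * (u x)\<^sup>2) \<le> K"
  proof (rule integral_le_dominated_limit[where E="\<lambda>N x. B x * (clip N (u x))\<^sup>2" and B="\<lambda>x. B x * (u x)\<^sup>2"])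
    show "\<bar>B x * (clip N (u x))\<^sup>2\<bar> \<le> B x * (u x)\<^sup>2" for N x
      using B(1) clip_sq by (simp add: abs_mult mult_left_mono)
    show "AE x in lborel. (\<lambda>N. B x * (clip N (u x))\<^sup>2) \<longlonglongrightarrow> B x * (u x)\<^sup>2"
    proof (rule AE_I2)
      fix x
      obtain M :: nat where M: "\<bar>u x\<bar> \<le> real M" using real_arch_simple by blast
      have c: "clip N (u x) = u x" if "N \<ge> M" for N
        using M that by (auto simp: clip_def max_def min_def)
      have "eventually (\<lambda>N. B x * (u x)\<^sup>2 = B x * (clip N (u x))\<^sup>2) sequentially"
        by (rule eventually_sequentiallyI[of M]) (simp add: c)
      then show "(\<lambda>N. B x * (clip N (u x))\<^sup>2) \<longlonglongrightarrow> B x * (u x)\<^sup>2" by (rule Lim_transform_eventually[OF tendsto_const])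
    qed
    show "(LBINT x. B x * (clip N (u x))\<^sup>2) \<le> K" for N
    proof -
      have "(LBINT x. B x * (clip N (u x))\<^sup>2) \<le> (LBINT x. B x * (2 * clip N (u x) * u x - (clip N (u x))\<^sup>2))"
        by (rule integral_mono[OF intc]) (intro mult_left_mono clip_le B(1))
      then show ?thesis using step2[of N] by linarith
    qed
  qed (use iBu in auto)
qed

lemma sum_mollify_laplacian:
  fixes u f :: "real^'n::finite \<Rightarrow> real"
  assumes t: "test_function \<eta>" and u: "L2 u"
    and weak: "\<And>\<phi>. test_function \<phi> \<Longrightarrow>
      (LBINT y. (\<Sum>i\<in>UNIV. iterated_partial [i, i] \<phi> y) * u y) = (LBINT y. \<phi> y * f y)"
  shows "(\<Sum>i\<in>UNIV. mollify (iterated_partial [i, i] \<eta>) u x) = mollify \<eta> f x"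
proof -
  have t2: "test_function (iterated_partial [i, i] \<eta>)" for i
    using test_function_partial[OF test_function_partial[OF t]] by simp
  have "(\<Sum>i\<in>UNIV. mollify (iterated_partial [i, i] \<eta>) u x)
     = (LBINT y. (\<Sum>i\<in>UNIV. iterated_partial [i, i] \<eta> (y - x) * u y))"
    unfolding mollify_def by (rule Bochner_Integration.integral_sum[symmetric], rule integrable_mollify[OF t2 u])
  also have "\<dots> = (LBINT y. (\<Sum>i\<in>UNIV. iterated_partial [i, i] (\<lambda>y. \<eta> (y - x)) y) * u y)"
    by (simp only: iterated_partial_shift[OF t] sum_distrib_right)
  also have "\<dots> = mollify \<eta> f x" unfolding mollify_def by (rule weak[OF test_function_shift[OF t]])
  finally show ?thesis .
qed

text \<open>The symmetry of \<open>u\<close> enters only through the Hardy inequality for its mollifications.\<close>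

lemma rellich_weak_real:
  fixes u f :: "real^'n::finite \<Rightarrow> real"
  assumes s: "s > 0" "real CARD('n) + 2 * k = 2 * (s + 2)" and m: "m = s * (s + 2)"
    and u: "L2 u" and f: "L2 f"
    and weak: "\<And>\<phi>. test_function \<phi> \<Longrightarrow>
      (LBINT y. (\<Sum>i\<in>UNIV. iterated_partial [i, i] \<phi> y) * u y) = (LBINT y. \<phi> y * f y)"
    and hardy: "\<And>e \<eta>. mollifier e \<eta> \<Longrightarrow> hardy_ineq k (mollify \<eta> u) (\<lambda>i x. - mollify (partial_deriv i \<eta>) u x)"
  shows "ennreal (m\<^sup>2) * (\<integral>\<^sup>+x. ennreal ((u x)\<^sup>2 / norm x ^ 4) \<partial>lborel) \<le> (\<integral>\<^sup>+x. ennreal ((f x)\<^sup>2) \<partial>lborel)"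
proof -
  have m0: "m > 0" using s m by simp
  have [measurable]: "u \<in> borel_measurable borel" using u by (simp add: L2_def)
  have "\<forall>n. \<exists>\<eta>. mollifier (1 / real (Suc n)) (\<eta> :: real^'n \<Rightarrow> real)"
    by (intro allI mollifier_exists) simp
  then obtain \<eta> where \<eta>: "\<And>n. mollifier (1 / real (Suc n)) (\<eta> n :: real^'n \<Rightarrow> real)" by metis
  note t = mollifierD(1)[OF \<eta>]
  define F where "F = (LBINT x. (f x)\<^sup>2)"
  define S where "S = (LBINT x. (u x)\<^sup>2)"
  have F0: "F \<ge> 0" and S0: "S \<ge> 0" by (auto simp: F_def S_def intro!: integral_nonneg_AE)
  have smooth: "(LBINT x. rellich_weight R \<delta> x * (mollify (\<eta> n) u x)\<^sup>2) \<le> F / m\<^sup>2 + 24 / (m * R ^ 4) * S"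
    if R: "R > 0" and \<delta>: "\<delta> > 0" for R \<delta> n
  proof -
    have L: "(\<Sum>i\<in>UNIV. mollify (iterated_partial [i, i] (\<eta> n)) u x) = mollify (\<eta> n) f x" for x
      by (rule sum_mollify_laplacian[OF t u]) (rule weak)
    have t2: "test_function (iterated_partial [i, i] (\<eta> n))" for i
      using test_function_partial[OF test_function_partial[OF t]] by simp
    note sm = smooth1_mollify[OF t[of n] u]
    have "(LBINT x. rellich_weight R \<delta> x * (mollify (\<eta> n) u x)\<^sup>2)
      \<le> (LBINT x. (\<Sum>i\<in>UNIV. mollify (iterated_partial [i, i] (\<eta> n)) u x)\<^sup>2) / m\<^sup>2
        + 24 / (m * R ^ 4) * (LBINT x. (mollify (\<eta> n) u x)\<^sup>2)"
      unfolding rellich_weight_def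
    proof (rule rellich_cutoff[OF hardy[OF \<eta>] _ _ _ _ _ R \<delta> s m])
      show "has_pd i (mollify (\<eta> n) u) (\<lambda>x. - mollify (partial_deriv i (\<eta> n)) u x)" for i by (rule has_pd_mollify[OF t u])
      show "has_pd i (\<lambda>x. - mollify (partial_deriv i (\<eta> n)) u x) (mollify (iterated_partial [i, i] (\<eta> n)) u)" for i
        by (rule has_pd_minus_mollify_partial[OF t u])
      show "continuous_on UNIV (mollify (\<eta> n) u)" by (rule continuous_mollify[OF t u])
      show "continuous_on UNIV (\<lambda>x. - mollify (partial_deriv i (\<eta> n)) u x)" for i by (rule smooth1D(3)[OF sm])
      show "continuous_on UNIV (mollify (iterated_partial [i, i] (\<eta> n)) u)" for i by (rule continuous_mollify[OF t2 u])
      show "integrable lborel (\<lambda>x. (mollify (\<eta> n) u x)\<^sup>2)" by (rule mollify_L2_contraction[OF \<eta> u])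
      show "integrable lborel (\<lambda>x. (\<Sum>i\<in>UNIV. mollify (iterated_partial [i, i] (\<eta> n)) u x)\<^sup>2)"
        unfolding L by (rule mollify_L2_contraction[OF \<eta> f])
    qed
    also have "\<dots> \<le> F / m\<^sup>2 + 24 / (m * R ^ 4) * S"
      unfolding L F_def S_def
      by (intro add_mono divide_right_mono mult_left_mono mollify_L2_contraction[OF \<eta>] u f) (use m0 R in auto)
    finally show ?thesis .
  qed
  have main: "integrable lborel (\<lambda>x. rellich_weight R \<delta> x * (u x)\<^sup>2)"
      "(LBINT x. rellich_weight R \<delta> x * (u x)\<^sup>2) \<le> F / m\<^sup>2 + 24 / (m * R ^ 4) * S"
    if R: "R > 0" and \<delta>: "\<delta> > 0" for R \<delta>
  proof -
    have *: "integrable lborel (\<lambda>x. rellich_weight R \<delta> x * (u x)\<^sup>2) \<and>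
      (LBINT x. rellich_weight R \<delta> x * (u x)\<^sup>2) \<le> F / m\<^sup>2 + 24 / (m * R ^ 4) * S"
    proof (intro conjI; rule weighted_square_le_weak_limit[where R=R and U="\<lambda>n. mollify (\<eta> n) u"])
      fix G :: "real^'n \<Rightarrow> real"
      assume G: "continuous_on UNIV G" "\<And>x. norm x > R \<Longrightarrow> G x = 0"
      show "(\<lambda>n. LBINT x. G x * mollify (\<eta> n) u x) \<longlonglongrightarrow> (LBINT x. G x * u x)"
        by (rule mollify_weak_convergence[OF \<eta> u G])
      then show "(\<lambda>n. LBINT x. G x * mollify (\<eta> n) u x) \<longlonglongrightarrow> (LBINT x. G x * u x)" .
    qed (rule rellich_weight_props[OF R \<delta>] u continuous_mollify[OF t u] smooth[OF R \<delta>]; assumption?)+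
    show "integrable lborel (\<lambda>x. rellich_weight R \<delta> x * (u x)\<^sup>2)"
      "(LBINT x. rellich_weight R \<delta> x * (u x)\<^sup>2) \<le> F / m\<^sup>2 + 24 / (m * R ^ 4) * S"
      using * by blast+
  qed
  \<comment> \<open>One parameter governs both limits: \<open>R = 1 / e n\<close> and \<open>\<delta> = e n\<close>.\<close>
  define e where "e = (\<lambda>n. 1 / real (Suc n))"
  have e: "e \<longlonglongrightarrow> 0" unfolding e_def using LIMSEQ_inverse_real_of_nat by (simp add: inverse_eq_divide)
  have e0: "e n > 0" for n by (simp add: e_def)
  define B where "B = (\<lambda>n x. rellich_weight (1 / e n) (e n) (x::real^'n))"
  have Blim: "(\<lambda>n. B n x * (u x)\<^sup>2) \<longlonglongrightarrow> (u x)\<^sup>2 / norm x ^ 4" if "x \<noteq> 0" for x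
  proof -
    have B: "B n x = (max 0 (1 - (x \<bullet> x) * (e n)\<^sup>2)) ^ 3 / (x \<bullet> x + e n)\<^sup>2" for n
      by (simp add: B_def rellich_weight_def power_divide)
    have "(\<lambda>n. B n x * (u x)\<^sup>2) \<longlonglongrightarrow> (max 0 (1 - (x \<bullet> x) * 0\<^sup>2)) ^ 3 / (x \<bullet> x + 0)\<^sup>2 * (u x)\<^sup>2"
      unfolding B by (intro tendsto_intros e) (use that in auto)
    moreover have "(x \<bullet> x)\<^sup>2 = norm x ^ 4" by (simp add: dot_square_norm flip: power_mult)
    ultimately show ?thesis by simp
  qed
  have Ble: "(\<integral>\<^sup>+x. ennreal (B n x * (u x)\<^sup>2) \<partial>lborel) \<le> ennreal (F / m\<^sup>2 + 24 / m * (e n) ^ 4 * S)" for n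
  proof -
    have R: "1 / e n > 0" using e0 by simp
    have "(\<integral>\<^sup>+x. ennreal (B n x * (u x)\<^sup>2) \<partial>lborel) = ennreal (LBINT x. B n x * (u x)\<^sup>2)"
      unfolding B_def
      by (rule nn_integral_eq_integral[OF main(1)[OF R e0]]) (simp add: rellich_weight_props(1)[OF R e0])
    also have "\<dots> \<le> ennreal (F / m\<^sup>2 + 24 / m * (e n) ^ 4 * S)"
      using main(2)[OF R e0, of n] by (intro ennreal_leI) (simp add: B_def power_divide)
    finally show ?thesis .
  qed
  have lim: "(\<lambda>n. ennreal (F / m\<^sup>2 + 24 / m * (e n) ^ 4 * S)) \<longlonglongrightarrow> ennreal (F / m\<^sup>2 + 24 / m * 0 ^ 4 * S)"
    by (intro tendsto_ennrealI tendsto_intros e)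
  have Bm: "(\<lambda>x. ennreal (B n x * (u x)\<^sup>2)) \<in> borel_measurable lborel" for n
    using borel_measurable_integrable[OF main(1)[of "1 / e n" "e n"]] e0 by (simp add: B_def)
  have "(\<integral>\<^sup>+x. ennreal ((u x)\<^sup>2 / norm x ^ 4) \<partial>lborel) = (\<integral>\<^sup>+x. liminf (\<lambda>n. ennreal (B n x * (u x)\<^sup>2)) \<partial>lborel)"
  proof (rule nn_integral_cong_AE)
    show "AE x in lborel. ennreal ((u x)\<^sup>2 / norm x ^ 4) = liminf (\<lambda>n. ennreal (B n x * (u x)\<^sup>2))"
      using AE_lborel_singleton[of 0]
    proof eventually_elim
      case (elim x)
      from lim_imp_Liminf[OF _ tendsto_ennrealI[OF Blim[OF elim]]] show ?case by simp
    qed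
  qed
  also have "\<dots> \<le> liminf (\<lambda>n. \<integral>\<^sup>+x. ennreal (B n x * (u x)\<^sup>2) \<partial>lborel)"
    by (rule nn_integral_liminf[OF Bm])
  also have "\<dots> \<le> liminf (\<lambda>n. ennreal (F / m\<^sup>2 + 24 / m * (e n) ^ 4 * S))"
    by (rule Liminf_mono, rule always_eventually, rule allI, rule Ble)
  also have "\<dots> = ennreal (F / m\<^sup>2)"
    using lim_imp_Liminf[OF _ lim] by simp
  finally have "ennreal (m\<^sup>2) * (\<integral>\<^sup>+x. ennreal ((u x)\<^sup>2 / norm x ^ 4) \<partial>lborel) \<le> ennreal (m\<^sup>2) * ennreal (F / m\<^sup>2)"
    by (rule mult_left_mono) simp
  also have "\<dots> = ennreal F" using m0 F0 by (simp flip: ennreal_mult')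
  also have "\<dots> = (\<integral>\<^sup>+x. ennreal ((f x)\<^sup>2) \<partial>lborel)"
    unfolding F_def by (rule nn_integral_eq_integral[symmetric]) (use f in \<open>auto simp: L2_def\<close>)
  finally show ?thesis .
qed


section \<open>Complex-valued Sobolev functions\<close>

lemma locally_integrable_measurable:
  assumes "locally_integrable v"
  shows "v \<in> borel_measurable lebesgue"
proof (rule borel_measurable_LIMSEQ_metric)
  show "(\<lambda>x. indicator (cball 0 (real n)) x *\<^sub>R v x) \<in> borel_measurable lebesgue" for n
    using assms unfolding locally_integrable_def set_integrable_def
    by (intro borel_measurable_integrable) (metis compact_cball)
  show "(\<lambda>n. indicator (cball 0 (real n)) x *\<^sub>R v x) \<longlonglongrightarrow> v x" for x
  proof -
    obtain M :: nat where M: "norm x \<le> real M" using real_arch_simple by blast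
    have "eventually (\<lambda>n. v x = indicator (cball 0 (real n)) x *\<^sub>R v x) sequentially"
      by (rule eventually_sequentiallyI[of M]) (use M in \<open>auto simp: indicator_def\<close>)
    then show ?thesis by (rule Lim_transform_eventually[OF tendsto_const])
  qed
qed

lemma integrable_test_scaleR:
  fixes \<psi> :: "real^'n::finite \<Rightarrow> real"
  assumes v: "locally_integrable v" and t: "test_function \<psi>"
  shows "integrable lebesgue (\<lambda>x. \<psi> x *\<^sub>R v x)"
proof -
  obtain r where r: "\<And>x. norm x > r \<Longrightarrow> \<psi> x = 0" using test_function_support[OF t] by blast
  obtain M where M: "M \<ge> 0" "\<And>x. \<bar>\<psi> x\<bar> \<le> M"
    using bounded_continuous_cball[OF test_function_continuous[OF t] r] by blast
  have "integrable lebesgue (\<lambda>x. indicator (cball 0 r) x *\<^sub>R v x)"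
    using v by (auto simp: locally_integrable_def set_integrable_def)
  then have i: "integrable lebesgue (\<lambda>x. M *\<^sub>R (indicator (cball 0 r) x *\<^sub>R v x))"
    by (rule integrable_scaleR_right)
  show ?thesis
  proof (rule Bochner_Integration.integrable_bound[OF i])
    have "\<psi> \<in> borel_measurable lebesgue"
      using borel_measurable_continuous_onI[OF test_function_continuous[OF t]] by (intro measurable_completion) simp
    then show "(\<lambda>x. \<psi> x *\<^sub>R v x) \<in> borel_measurable lebesgue"
      using locally_integrable_measurable[OF v] by (rule borel_measurable_scaleR)
    show "AE x in lebesgue. norm (\<psi> x *\<^sub>R v x) \<le> norm (M *\<^sub>R (indicator (cball 0 r) x *\<^sub>R v x))"
    proof (rule AE_I2)
      fix x
      show "norm (\<psi> x *\<^sub>R v x) \<le> norm (M *\<^sub>R (indicator (cball 0 r) x *\<^sub>R v x))"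
      proof (cases "norm x \<le> r")
        case True
        then show ?thesis using M by (simp add: mult_right_mono)
      next
        case False
        then show ?thesis using r[of x] by simp
      qed
    qed
  qed
qed

text \<open>Whichever weak derivatives the choice operator picks, integration against test functions is
  determined.\<close>

lemma weak_laplacian:
  fixes u :: "real^'n::finite \<Rightarrow> complex"
  assumes u: "u \<in> sobolev 2 2"
  shows "locally_integrable u" "laplacian u \<in> borel_measurable lebesgue"
    "test_function \<phi> \<Longrightarrow> integrable lebesgue (\<lambda>x. \<phi> x *\<^sub>R laplacian u x) \<and>
      (LINT x|lebesgue. (\<Sum>i\<in>UNIV. iterated_partial [i, i] \<phi> x) *\<^sub>R u x) = (LINT x|lebesgue. \<phi> x *\<^sub>R laplacian u x)"
proof -
  have wd: "is_weak_deriv [i, i] u (weak_deriv [i, i] u)" for i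
  proof -
    have "\<forall>\<alpha>. length \<alpha> \<le> 2 \<longrightarrow> (\<exists>v. is_weak_deriv \<alpha> u v)" using u unfolding sobolev_def by blast
    then have "\<exists>v. is_weak_deriv [i, i] u v" by simp
    then show ?thesis unfolding weak_deriv_def by (rule someI_ex)
  qed
  then show lu: "locally_integrable u" unfolding is_weak_deriv_def by blast
  have lv: "locally_integrable (weak_deriv [i, i] u)" for i using wd[of i] unfolding is_weak_deriv_def by blast
  show "laplacian u \<in> borel_measurable lebesgue"
    unfolding laplacian_def[abs_def] using locally_integrable_measurable[OF lv] by (intro borel_measurable_sum)
  assume t: "test_function \<phi>"
  have t2: "test_function (iterated_partial [i, i] \<phi>)" for i
    using test_function_partial[OF test_function_partial[OF t]] by simp
  have e: "(LINT x|lebesgue. iterated_partial [i, i] \<phi> x *\<^sub>R u x) = (LINT x|lebesgue. \<phi> x *\<^sub>R weak_deriv [i, i] u x)" for i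
    using wd[of i] t unfolding is_weak_deriv_def by simp
  note i1 = integrable_test_scaleR[OF lu t2] and i2 = integrable_test_scaleR[OF lv t]
  show "integrable lebesgue (\<lambda>x. \<phi> x *\<^sub>R laplacian u x) \<and>
      (LINT x|lebesgue. (\<Sum>i\<in>UNIV. iterated_partial [i, i] \<phi> x) *\<^sub>R u x) = (LINT x|lebesgue. \<phi> x *\<^sub>R laplacian u x)"
    unfolding laplacian_def scaleR_sum_left scaleR_sum_right
    using Bochner_Integration.integral_sum[OF i1] Bochner_Integration.integral_sum[OF i2] i2 e
    by (auto intro!: Bochner_Integration.integrable_sum)
qed

text \<open>Tonelli's theorem is applied to Borel functions on the product space, so Lebesgue measurable
  functions are first replaced by Borel measurable ones that agree with them almost everywhere.\<close>

lemma borel_representative: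
  fixes r :: "complex \<Rightarrow> real" and v :: "real^'n::finite \<Rightarrow> complex"
  assumes r: "bounded_linear r" "\<And>z. \<bar>r z\<bar> \<le> norm z" and v: "v \<in> borel_measurable lebesgue"
    and i: "integrable lebesgue (\<lambda>x. (norm (v x))\<^sup>2)"
  obtains w where "L2 w" "AE x in lborel. w x = r (v x)"
proof -
  have rv: "(\<lambda>x. r (v x)) \<in> borel_measurable lebesgue"
    using borel_measurable_continuous_onI[OF linear_continuous_on[OF r(1)]] v by (rule measurable_compose[rotated])
  obtain w where w: "w \<in> borel_measurable lborel" "AE x in lborel. r (v x) = w x"
    using completion_ex_borel_measurable_real[OF rv] by blast
  have "integrable lebesgue (\<lambda>x. (r (v x))\<^sup>2)"
  proof (rule Bochner_Integration.integrable_bound[OF i])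
    show "(\<lambda>x. (r (v x))\<^sup>2) \<in> borel_measurable lebesgue" using rv by (rule borel_measurable_power)
    have "(r z)\<^sup>2 \<le> (norm z)\<^sup>2" for z using r(2)[of z] by (metis abs_le_square_iff abs_norm_cancel)
    then show "AE x in lebesgue. norm ((r (v x))\<^sup>2) \<le> norm ((norm (v x))\<^sup>2)" by simp
  qed
  moreover have "AE x in lebesgue. (r (v x))\<^sup>2 = (w x)\<^sup>2"
    using AE_completion[OF w(2)] by eventually_elim simp
  moreover have wl: "w \<in> borel_measurable lebesgue" using w(1) by (rule measurable_completion)
  ultimately have "integrable lebesgue (\<lambda>x. (w x)\<^sup>2)"
    using rv by (subst integrable_cong_AE[symmetric]) auto
  then have "integrable lborel (\<lambda>x. (w x)\<^sup>2)"
    using w(1) by (subst (asm) integrable_completion) auto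
  then have "L2 w" using w(1) by (simp add: L2_def)
  moreover have "AE x in lborel. w x = r (v x)" using w(2) by eventually_elim simp
  ultimately show ?thesis by (rule that)
qed

lemma rellich_component:
  fixes u :: "real^'n::finite \<Rightarrow> complex"
  assumes u: "u \<in> sobolev 2 2" and f: "integrable lebesgue (\<lambda>x. (norm (laplacian u x))\<^sup>2)"
    and s: "s > 0" "real CARD('n) + 2 * k = 2 * (s + 2)" and m: "m = s * (s + 2)"
    and r: "bounded_linear r" "\<And>z. \<bar>r z\<bar> \<le> norm z"
    and hardy: "\<And>w e \<eta>. L2 w \<Longrightarrow> (AE x in lborel. w x = r (u x)) \<Longrightarrow> mollifier e \<eta> \<Longrightarrow>
       hardy_ineq k (mollify \<eta> w) (\<lambda>i x. - mollify (partial_deriv i \<eta>) w x)"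
  shows "ennreal (m\<^sup>2) * (\<integral>\<^sup>+x. ennreal ((r (u x))\<^sup>2 / norm x ^ 4) \<partial>lborel) \<le> (\<integral>\<^sup>+x. ennreal ((r (laplacian u x))\<^sup>2) \<partial>lborel)"
proof -
  have Lp: "u \<in> borel_measurable lebesgue" "integrable lebesgue (\<lambda>x. norm (u x) powr 2)"
    using u by (auto simp: sobolev_def Lp_space_def)
  then have "integrable lebesgue (\<lambda>x. (norm (u x))\<^sup>2)" by simp
  from borel_representative[OF r Lp(1) this] obtain w where w: "L2 w" "AE x in lborel. w x = r (u x)" by blast
  from borel_representative[OF r weak_laplacian(2)[OF u] f] obtain g where g: "L2 g" "AE x in lborel. g x = r (laplacian u x)" by blast
  have wm: "w \<in> borel_measurable borel" "g \<in> borel_measurable borel" using w g by (auto simp: L2_def)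
  have transfer: "r (LINT x|lebesgue. \<psi> x *\<^sub>R v x) = (LBINT x. \<psi> x * h x)"
    if i: "integrable lebesgue (\<lambda>x. \<psi> x *\<^sub>R v x)" and h: "h \<in> borel_measurable borel" "AE x in lborel. h x = r (v x)"
      and \<psi>: "\<psi> \<in> borel_measurable borel" for \<psi> :: "real^'n \<Rightarrow> real" and v :: "real^'n \<Rightarrow> complex" and h
  proof -
    have "r (LINT x|lebesgue. \<psi> x *\<^sub>R v x) = (LINT x|lebesgue. r (\<psi> x *\<^sub>R v x))"
      by (rule integral_bounded_linear[OF r(1) i, symmetric])
    also have "\<dots> = (LINT x|lebesgue. \<psi> x * h x)"
    proof (rule integral_cong_AE)
      show "(\<lambda>x. r (\<psi> x *\<^sub>R v x)) \<in> borel_measurable lebesgue"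
        using integrable_bounded_linear[OF r(1) i] by (rule borel_measurable_integrable)
      show "(\<lambda>x. \<psi> x * h x) \<in> borel_measurable lebesgue"
        using \<psi> h(1) by (intro measurable_completion) simp
      show "AE x in lebesgue. r (\<psi> x *\<^sub>R v x) = \<psi> x * h x"
        using AE_completion[OF h(2)] by eventually_elim (simp add: linear_scale[OF bounded_linear.linear[OF r(1)]])
    qed
    also have "\<dots> = (LBINT x. \<psi> x * h x)"
      using \<psi> h(1) by (intro integral_completion) simp
    finally show ?thesis .
  qed
  have "ennreal (m\<^sup>2) * (\<integral>\<^sup>+x. ennreal ((w x)\<^sup>2 / norm x ^ 4) \<partial>lborel) \<le> (\<integral>\<^sup>+x. ennreal ((g x)\<^sup>2) \<partial>lborel)"
  proof (rule rellich_weak_real[OF s m w(1) g(1)])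
    fix \<phi> :: "real^'n \<Rightarrow> real" assume t: "test_function \<phi>"
    have t2: "test_function (iterated_partial [i, i] \<phi>)" for i
      using test_function_partial[OF test_function_partial[OF t]] by simp
    note wl = weak_laplacian(3)[OF u t]
    have i: "integrable lebesgue (\<lambda>x. (\<Sum>i\<in>UNIV. iterated_partial [i, i] \<phi> x) *\<^sub>R u x)"
      unfolding scaleR_sum_left
      by (rule Bochner_Integration.integrable_sum) (rule integrable_test_scaleR[OF weak_laplacian(1)[OF u] t2])
    have m1: "(\<lambda>x. \<Sum>i\<in>UNIV. iterated_partial [i, i] \<phi> x) \<in> borel_measurable borel"
      by (intro borel_measurable_sum borel_measurable_continuous_onI test_function_continuous t2)
    have m2: "\<phi> \<in> borel_measurable borel" by (intro borel_measurable_continuous_onI test_function_continuous t)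
    show "(LBINT y. (\<Sum>i\<in>UNIV. iterated_partial [i, i] \<phi> y) * w y) = (LBINT y. \<phi> y * g y)"
      unfolding transfer[OF i wm(1) w(2) m1, symmetric] transfer[OF conjunct1[OF wl] wm(2) g(2) m2, symmetric]
      by (rule arg_cong[OF conjunct2[OF wl]])
  qed (rule hardy[OF w])
  also have "(\<integral>\<^sup>+x. ennreal ((w x)\<^sup>2 / norm x ^ 4) \<partial>lborel) = (\<integral>\<^sup>+x. ennreal ((r (u x))\<^sup>2 / norm x ^ 4) \<partial>lborel)"
    by (rule nn_integral_cong_AE, rule eventually_mono[OF w(2)]) simp
  also have "(\<integral>\<^sup>+x. ennreal ((g x)\<^sup>2) \<partial>lborel) = (\<integral>\<^sup>+x. ennreal ((r (laplacian u x))\<^sup>2) \<partial>lborel)"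
    by (rule nn_integral_cong_AE, rule eventually_mono[OF g(2)]) simp
  finally show ?thesis .
qed

text \<open>If the Laplacian is not square integrable, the right-hand side is infinite. Otherwise the real inequality is
  applied to the real and the imaginary part.\<close>

lemma rellich_sobolev:
  fixes u :: "real^'n::finite \<Rightarrow> complex"
  assumes u: "u \<in> sobolev 2 2"
    and s: "s > 0" "real CARD('n) + 2 * k = 2 * (s + 2)" and m: "m = s * (s + 2)"
    and hardy: "\<And>r w e \<eta>. bounded_linear r \<Longrightarrow> L2 w \<Longrightarrow> (AE x in lborel. w x = r (u x)) \<Longrightarrow> mollifier e \<eta> \<Longrightarrow>
       hardy_ineq k (mollify \<eta> w) (\<lambda>i x. - mollify (partial_deriv i \<eta>) w x)"
  shows "ennreal (m\<^sup>2) * (\<integral>\<^sup>+x. ennreal ((norm (u x))\<^sup>2 / norm x ^ 4) \<partial>lebesgue)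
     \<le> (\<integral>\<^sup>+x. ennreal ((norm (laplacian u x))\<^sup>2) \<partial>lebesgue)"
proof (cases "(\<integral>\<^sup>+x. ennreal ((norm (laplacian u x))\<^sup>2) \<partial>lebesgue) < \<infinity>")
  case True
  have um: "u \<in> borel_measurable lebesgue" using u by (auto simp: sobolev_def Lp_space_def)
  note lm = weak_laplacian(2)[OF u]
  have f: "integrable lebesgue (\<lambda>x. (norm (laplacian u x))\<^sup>2)"
    by (rule integrableI_bounded) (use lm True in auto)
  have comp: "ennreal (m\<^sup>2) * (\<integral>\<^sup>+x. ennreal ((r (u x))\<^sup>2 / norm x ^ 4) \<partial>lebesgue)
      \<le> (\<integral>\<^sup>+x. ennreal ((r (laplacian u x))\<^sup>2) \<partial>lebesgue)"
    if "bounded_linear r" "\<And>z. \<bar>r z\<bar> \<le> norm z" for r :: "complex \<Rightarrow> real"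
    unfolding nn_integral_completion by (rule rellich_component[OF u f s m that]) (rule hardy[OF that(1)])
  have nm: "(\<lambda>x. norm x ^ 4) \<in> borel_measurable (lebesgue :: (real^'n) measure)"
    by (intro measurable_completion) simp
  have parts: "(\<lambda>x. Re (v x)) \<in> borel_measurable lebesgue" "(\<lambda>x. Im (v x)) \<in> borel_measurable lebesgue"
    if "v \<in> borel_measurable lebesgue" for v :: "real^'n \<Rightarrow> complex"
    using that by auto
  have "(\<integral>\<^sup>+x. ennreal ((norm (u x))\<^sup>2 / norm x ^ 4) \<partial>lebesgue)
     = (\<integral>\<^sup>+x. ennreal ((Re (u x))\<^sup>2 / norm x ^ 4) + ennreal ((Im (u x))\<^sup>2 / norm x ^ 4) \<partial>lebesgue)"
    by (rule nn_integral_cong) (simp add: cmod_power2 add_divide_distrib flip: ennreal_plus)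
  also have "\<dots> = (\<integral>\<^sup>+x. ennreal ((Re (u x))\<^sup>2 / norm x ^ 4) \<partial>lebesgue) + (\<integral>\<^sup>+x. ennreal ((Im (u x))\<^sup>2 / norm x ^ 4) \<partial>lebesgue)"
    using parts[OF um] nm by (intro nn_integral_add) auto
  finally have "ennreal (m\<^sup>2) * (\<integral>\<^sup>+x. ennreal ((norm (u x))\<^sup>2 / norm x ^ 4) \<partial>lebesgue)
      = ennreal (m\<^sup>2) * (\<integral>\<^sup>+x. ennreal ((Re (u x))\<^sup>2 / norm x ^ 4) \<partial>lebesgue)
      + ennreal (m\<^sup>2) * (\<integral>\<^sup>+x. ennreal ((Im (u x))\<^sup>2 / norm x ^ 4) \<partial>lebesgue)" by (simp add: distrib_left)
  also have "\<dots> \<le> (\<integral>\<^sup>+x. ennreal ((Re (laplacian u x))\<^sup>2) \<partial>lebesgue) + (\<integral>\<^sup>+x. ennreal ((Im (laplacian u x))\<^sup>2) \<partial>lebesgue)"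
    by (intro add_mono comp bounded_linear_Re bounded_linear_Im abs_Re_le_cmod abs_Im_le_cmod)
  also have "\<dots> = (\<integral>\<^sup>+x. ennreal ((Re (laplacian u x))\<^sup>2) + ennreal ((Im (laplacian u x))\<^sup>2) \<partial>lebesgue)"
    using parts[OF lm] by (intro nn_integral_add[symmetric]) auto
  also have "\<dots> = (\<integral>\<^sup>+x. ennreal ((norm (laplacian u x))\<^sup>2) \<partial>lebesgue)"
    by (rule nn_integral_cong) (simp add: cmod_power2 flip: ennreal_plus)
  finally show ?thesis .
next
  case False
  then show ?thesis by (simp add: less_top[symmetric])
qed

lemma AE_signed_perm_antisymmetric:
  fixes u :: "real^'n::finite \<Rightarrow> complex"
  assumes \<sigma>: "\<And>k. \<sigma> k = 1 \<or> \<sigma> k = -1" and \<pi>: "bij \<pi>" and r: "bounded_linear r"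
    and w: "AE x in lborel. w x = r (u x)" and u: "AE x in lborel. u (signed_perm \<sigma> \<pi> x) = - u x"
  shows "AE x in lborel. w (signed_perm \<sigma> \<pi> x) = - w x"
proof -
  have m: "signed_perm \<sigma> \<pi> \<in> measurable lborel (borel :: (real^'n) measure)"
    using measurable_signed_perm[of \<sigma> \<pi>] by simp
  have "AE x in distr lborel borel (signed_perm \<sigma> \<pi>). w x = r (u x)"
    unfolding lborel_distr_signed_perm[OF \<sigma> \<pi>] by (rule w)
  then have "AE x in lborel. w (signed_perm \<sigma> \<pi> x) = r (u (signed_perm \<sigma> \<pi> x))"
    by (rule AE_distrD[OF m])
  then show ?thesis using w u
    by eventually_elim (simp add: linear_neg[OF bounded_linear.linear[OF r]])
qed

theorem mainTheorem6:
  fixes d :: nat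
  assumes "d = CARD('n::finite)" and "d \<ge> 3"
  shows "(\<forall>u \<in> (sobolev_antisym 2 2 :: (real^'n \<Rightarrow> complex) set).
            (\<integral>\<^sup>+x. ennreal ((norm (laplacian u x))\<^sup>2) \<partial>lebesgue) \<ge>
              ennreal (real d ^ 4 * ((real d)\<^sup>2 - 4)\<^sup>2 / 16) *
              (\<integral>\<^sup>+x. ennreal ((norm (u x))\<^sup>2 / norm x ^ 4) \<partial>lebesgue)) \<and>
         (\<forall>u \<in> (sobolev_odd 2 2 :: (real^'n \<Rightarrow> complex) set).
            (\<integral>\<^sup>+x. ennreal ((norm (laplacian u x))\<^sup>2) \<partial>lebesgue) \<ge>
              ennreal (((real d)\<^sup>2 - 4)\<^sup>2 / 16) *
              (\<integral>\<^sup>+x. ennreal ((norm (u x))\<^sup>2 / norm x ^ 4) \<partial>lebesgue))"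
proof (intro conjI ballI)
  have d3: "real d \<ge> 3" using assms(2) by simp
  have d9: "(real d)\<^sup>2 \<ge> 3\<^sup>2" using d3 by (intro power_mono) auto
  {
    fix u :: "real^'n \<Rightarrow> complex" assume u: "u \<in> sobolev_antisym 2 2"
    define k where "k = real d * (real d - 1) / 2"
    define s where "s = k + real d / 2 - 2"
    have s: "s = ((real d)\<^sup>2 - 4) / 2" by (simp add: s_def k_def power2_eq_square field_simps)
    have "ennreal ((s * (s + 2))\<^sup>2) * (\<integral>\<^sup>+x. ennreal ((norm (u x))\<^sup>2 / norm x ^ 4) \<partial>lebesgue)
      \<le> (\<integral>\<^sup>+x. ennreal ((norm (laplacian u x))\<^sup>2) \<partial>lebesgue)"
    proof (rule rellich_sobolev[where k=k])
      show "u \<in> sobolev 2 2" using u by (simp add: sobolev_antisym_def)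
      show "s > 0" using d9 by (simp add: s)
      show "real CARD('n) + 2 * k = 2 * (s + 2)" using assms(1) by (simp add: s_def)
      fix r :: "complex \<Rightarrow> real" and w \<eta> :: "real^'n \<Rightarrow> real" and e
      assume r: "bounded_linear r" and w: "L2 w" "AE x in lborel. w x = r (u x)" and \<eta>: "mollifier e \<eta>"
      show "hardy_ineq k (mollify \<eta> w) (\<lambda>i x. - mollify (partial_deriv i \<eta>) w x)"
        unfolding k_def assms(1)
      proof (rule hardy_ineq_antisymmetric[OF smooth1_mollify[OF mollifierD(1)[OF \<eta>] w(1)]])
        fix i j :: 'n and x assume ij: "i \<noteq> j"
        have "AE x in lebesgue. u (\<chi> k. x $ Transposition.transpose i j k) = - u x"
          using u ij unfolding sobolev_antisym_def antisymmetric_def by blast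
        then have a: "AE x in lborel. u (signed_perm (\<lambda>k. 1) (Transposition.transpose i j) x) = - u x"
          unfolding AE_completion_iff signed_perm_def mult_1_left .
        show "mollify \<eta> w (swap_coords i j x) = - mollify \<eta> w x"
          unfolding swap_coords_def
          by (rule mollify_signed_perm[OF \<eta> w(1) _ bij_transpose AE_signed_perm_antisymmetric[OF _ bij_transpose r w(2) a]])
            simp_all
      qed
    qed simp
    also have "(s * (s + 2))\<^sup>2 = real d ^ 4 * ((real d)\<^sup>2 - 4)\<^sup>2 / 16"
      by (simp add: s power2_eq_square power4_eq_xxxx field_simps)
    finally show "(\<integral>\<^sup>+x. ennreal ((norm (laplacian u x))\<^sup>2) \<partial>lebesgue) \<ge>
              ennreal (real d ^ 4 * ((real d)\<^sup>2 - 4)\<^sup>2 / 16) *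
              (\<integral>\<^sup>+x. ennreal ((norm (u x))\<^sup>2 / norm x ^ 4) \<partial>lebesgue)" .
  }
  {
    fix u :: "real^'n \<Rightarrow> complex" assume u: "u \<in> sobolev_odd 2 2"
    define s where "s = real d / 2 - 1"
    have "ennreal ((s * (s + 2))\<^sup>2) * (\<integral>\<^sup>+x. ennreal ((norm (u x))\<^sup>2 / norm x ^ 4) \<partial>lebesgue)
      \<le> (\<integral>\<^sup>+x. ennreal ((norm (laplacian u x))\<^sup>2) \<partial>lebesgue)"
    proof (rule rellich_sobolev[where k=1])
      show "u \<in> sobolev 2 2" using u by (simp add: sobolev_odd_def)
      show "s > 0" using d3 by (simp add: s_def)
      show "real CARD('n) + 2 * 1 = 2 * (s + 2)" using assms(1) by (simp add: s_def)
      fix r :: "complex \<Rightarrow> real" and w \<eta> :: "real^'n \<Rightarrow> real" and e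
      assume r: "bounded_linear r" and w: "L2 w" "AE x in lborel. w x = r (u x)" and \<eta>: "mollifier e \<eta>"
      show "hardy_ineq 1 (mollify \<eta> w) (\<lambda>i x. - mollify (partial_deriv i \<eta>) w x)"
      proof (rule hardy_ineq_odd[OF smooth1_mollify[OF mollifierD(1)[OF \<eta>] w(1)]])
        fix x
        have minus: "- x = signed_perm (\<lambda>k. -1) id x" for x :: "real^'n" by (simp add: signed_perm_def vec_eq_iff)
        have "AE x in lborel. u (- x) = - u x"
          using u unfolding sobolev_odd_def odd_function_def AE_completion_iff by blast
        then have a: "AE x in lborel. u (signed_perm (\<lambda>k. -1) id x) = - u x"
          unfolding minus .
        show "mollify \<eta> w (- x) = - mollify \<eta> w x"
          unfolding minus
          by (rule mollify_signed_perm[OF \<eta> w(1) _ bij_id AE_signed_perm_antisymmetric[OF _ bij_id r w(2) a]]) simp_all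
      qed
    qed simp
    also have "(s * (s + 2))\<^sup>2 = ((real d)\<^sup>2 - 4)\<^sup>2 / 16"
      by (simp add: s_def power2_eq_square field_simps)
    finally show "(\<integral>\<^sup>+x. ennreal ((norm (laplacian u x))\<^sup>2) \<partial>lebesgue) \<ge>
              ennreal (((real d)\<^sup>2 - 4)\<^sup>2 / 16) *
              (\<integral>\<^sup>+x. ennreal ((norm (u x))\<^sup>2 / norm x ^ 4) \<partial>lebesgue)" .
  }
qed

end
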